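(* Let $A$ be a Dedekind domain with field of fractions $K$, let $L/K$ be a finite separable field extension, and let $B$ be the integral closure of $A$ in $L$. Let $S$ be a finite set of primes of $B$. For every ideal class $c$ of $B$, there exist a finite (possibly empty) set $T$ of primes of $B$ of degree one and a function $e:T\to\mathbb{N}$ such that $c$ contains the ideal $\prod_{\mathfrak{q}\in T}\mathfrak{q}^{e(\mathfrak{q})}$, where (1) $T$ is disjoint from $S$; (2) for any two distinct $\mathfrak{q},\mathfrak{q}'\in T$, the primes $A\cap\mathfrak{q}$ and $A\cap\mathfrak{q}'$ of $A$ are different.
   Context: $\mathbb{N}$ denotes the positive integers. "Prime" means non-zero prime ideal. A prime $\mathfrak{q}$ of $B$ is of degree one (over $A$) if $A+\mathfrak{q}=B$, equivalently if the natural map $A/(A\cap\mathfrak{q})\to B/\mathfrak{q}$ is an isomorphism. Ideal classes are the elements of the ideal class group of the Dedekind domain $B$. The empty product is the unit ideal $B$. Fields are allowed as (trivial) Dedekind domains. Residue fields $A/\mathfrak{p}$ are not assumed to be finite. *)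

theory Defs
  imports "HOL-Algebra.Finite_Extensions" "HOL-Algebra.Ideal_Product" "HOL-Algebra.Coset"
begin

text \<open>
  All rings live inside one field \<open>L\<close>: the rings \<open>A\<close> and \<open>B\<close> and the field \<open>K\<close> are subsets of
  \<open>carrier L\<close>, and \<open>L\<lparr>carrier := A\<rparr>\<close> is \<open>A\<close> regarded as a ring in its own right.
\<close>

definition fraction_field :: "('a, 'm) ring_scheme \<Rightarrow> 'a set \<Rightarrow> 'a set" where
  "fraction_field L A =
     {a \<otimes>\<^bsub>L\<^esub> inv\<^bsub>L\<^esub> b | a b. a \<in> A \<and> b \<in> A - {\<zero>\<^bsub>L\<^esub>}}"

text \<open>Polynomials are the coefficient lists of the library, leading coefficient first.\<close>

definition integral_closure :: "('a, 'm) ring_scheme \<Rightarrow> 'a set \<Rightarrow> 'a set" where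
  "integral_closure L A =
     {x \<in> carrier L. \<exists>p \<in> carrier (A[X]\<^bsub>L\<^esub>).
        p \<noteq> [] \<and> lead_coeff p = \<one>\<^bsub>L\<^esub> \<and> ring.eval L p x = \<zero>\<^bsub>L\<^esub>}"

definition nonzero_primes :: "('a, 'm) ring_scheme \<Rightarrow> 'a set set" where
  "nonzero_primes R = {\<pp>. primeideal \<pp> R \<and> \<pp> \<noteq> {\<zero>\<^bsub>R\<^esub>}}"

text \<open>Fields are Dedekind domains here, since no nonzero prime is required to exist.\<close>

definition dedekind_in :: "('a, 'm) ring_scheme \<Rightarrow> 'a set \<Rightarrow> bool" where
  "dedekind_in L A \<longleftrightarrow>
     subring A L \<and>
     noetherian_domain (L\<lparr>carrier := A\<rparr>) \<and>
     fraction_field L A \<inter> integral_closure L A = A \<and>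
     (\<forall>\<pp> \<in> nonzero_primes (L\<lparr>carrier := A\<rparr>). maximalideal \<pp> (L\<lparr>carrier := A\<rparr>))"

definition formal_deriv :: "('a, 'm) ring_scheme \<Rightarrow> 'a list \<Rightarrow> 'a list" where
  "formal_deriv L p =
     ring.normalize L
       (map (\<lambda>i. add_pow L (Suc i) (ring.coeff L p (Suc i))) (rev [0..<length p - 1]))"

text \<open>A polynomial over \<open>K\<close> is separable if it is relatively prime to its derivative in \<open>K[X]\<close>.\<close>

definition separable_poly :: "('a, 'm) ring_scheme \<Rightarrow> 'a set \<Rightarrow> 'a list \<Rightarrow> bool" where
  "separable_poly L K p \<longleftrightarrow>
     (\<forall>d \<in> carrier (K[X]\<^bsub>L\<^esub>).
        d divides\<^bsub>K[X]\<^bsub>L\<^esub>\<^esub> p \<and> d divides\<^bsub>K[X]\<^bsub>L\<^esub>\<^esub> formal_deriv L p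
          \<longrightarrow> d \<in> Units (K[X]\<^bsub>L\<^esub>))"

text \<open>\<open>Irr K x\<close> is the minimal polynomial of \<open>x\<close> over \<open>K\<close>.\<close>

definition separable_extension :: "('a, 'm) ring_scheme \<Rightarrow> 'a set \<Rightarrow> bool" where
  "separable_extension L K \<longleftrightarrow>
     (\<forall>x \<in> carrier L. ring.algebraic L K x \<and> separable_poly L K (ring.Irr L K x))"

definition degree_one_prime :: "('a, 'm) ring_scheme \<Rightarrow> 'a set \<Rightarrow> 'a set \<Rightarrow> 'a set \<Rightarrow> bool" where
  "degree_one_prime L A B \<qq> \<longleftrightarrow>
     \<qq> \<in> nonzero_primes (L\<lparr>carrier := B\<rparr>) \<and> A <+>\<^bsub>L\<^esub> \<qq> = B"

text \<open>
  The class group of a domain \<open>B\<close> with field of fractions \<open>L\<close>: nonzero fractional ideals modulo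
  principal ones. These form a group under the library's product of ideals, taken in \<open>L\<close>,
  when \<open>B\<close> is Dedekind. An ideal class is thus a set of fractional ideals.
\<close>

definition fractional_ideals :: "('a, 'm) ring_scheme \<Rightarrow> 'a set \<Rightarrow> 'a set set" where
  "fractional_ideals L B =
     {M. additive_subgroup M L \<and> M \<noteq> {\<zero>\<^bsub>L\<^esub>} \<and>
         (\<forall>b \<in> B. \<forall>m \<in> M. b \<otimes>\<^bsub>L\<^esub> m \<in> M) \<and>
         (\<exists>d \<in> B - {\<zero>\<^bsub>L\<^esub>}. \<forall>m \<in> M. d \<otimes>\<^bsub>L\<^esub> m \<in> B)}"

definition fractional_ideal_group :: "('a, 'm) ring_scheme \<Rightarrow> 'a set \<Rightarrow> 'a set monoid" where
  "fractional_ideal_group L B =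
     \<lparr>carrier = fractional_ideals L B, monoid.mult = ideal_prod L, one = B\<rparr>"

definition principal_fractional_ideals :: "('a, 'm) ring_scheme \<Rightarrow> 'a set \<Rightarrow> 'a set set" where
  "principal_fractional_ideals L B = {x <#\<^bsub>L\<^esub> B | x. x \<in> carrier L - {\<zero>\<^bsub>L\<^esub>}}"

definition class_group :: "('a, 'm) ring_scheme \<Rightarrow> 'a set \<Rightarrow> 'a set set monoid" where
  "class_group L B = fractional_ideal_group L B Mod principal_fractional_ideals L B"

end

theory Submission
  imports Defs "HOL-Algebra.Algebraic_Closure"
begin

text \<open>
  It suffices to find an ideal \<open>J\<close> in the class \<open>c\<close>, contained in no prime of \<open>S\<close>, and
  \<open>d \<in> A\<close> with \<open>dB \<subseteq> A + J\<close> such that \<open>d\<close> lies in no prime containing \<open>J\<close>. Every prime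
  containing \<open>J\<close> is then of degree one, and two of them over the same prime \<open>p\<close> of \<open>A\<close> would
  make the diagonal map from \<open>A/p\<close> to \<open>A/p \<times> A/p\<close> surjective.

  Let \<open>M\<close> be a fractional ideal in \<open>c\<close> with \<open>1 \<in> M\<close>. Weak approximation gives \<open>\<alpha>\<close> with
  \<open>\<alpha>M \<subseteq> B\<close> such that \<open>\<alpha>M\<close> is not contained in any prime of \<open>B\<close> dividing a fixed nonzero
  \<open>r \<in> A\<close>; here \<open>r\<close> is divisible by elements of the primes in \<open>S\<close>, by a denominator of \<open>M\<close>
  and by the differences of \<open>n + 1\<close> elements \<open>x\<^sub>0, \<dots>, x\<^sub>n\<close> of \<open>A\<close>, where \<open>n = [L:K]\<close>. By the
  primitive element theorem \<open>\<alpha>\<close> can moreover be chosen with \<open>L = K(\<alpha>)\<close>, so that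
  \<open>dB \<subseteq> A[\<alpha>]\<close> for some nonzero \<open>d \<in> A\<close>. If a prime \<open>p\<close> of \<open>A\<close> contains \<open>d\<close> but not \<open>r\<close>,
  then the \<open>x\<^sub>i\<close> are distinct modulo \<open>p\<close>, hence one of them is not a root modulo \<open>p\<close> of the
  minimal polynomial of \<open>\<alpha>\<close>. By the Chinese remainder theorem there is \<open>a \<in> A\<close>, divisible by
  \<open>r\<close> and by the denominator of \<open>M\<close> in such a way that \<open>aM \<subseteq> rB\<close>, that is not a root modulo any
  such \<open>p\<close>. Take \<open>J = (\<alpha> - a)M\<close>: since \<open>\<alpha> \<equiv> a\<close> modulo \<open>J\<close>, the element \<open>a\<close> is a root
  modulo every prime containing \<open>J\<close>, so that no such prime contains \<open>d\<close>, and \<open>dB \<subseteq> A + J\<close>.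
\<close>

subsection \<open>Finitely generated modules over a noetherian subring\<close>

text \<open>The order of the choices breaks a circle: the primes to be feared are those containing
  \<open>d\<close>, yet \<open>d\<close> depends on \<alpha>, and modulo a prime with few residue
  classes every element of \<open>A\<close> may be a root of the minimal polynomial of \<alpha>. The
  element \<open>r\<close> is therefore fixed first. A prime of \<open>A\<close> not containing
  \<open>r\<close> has more than \<open>n\<close> residue classes whatever \<alpha> turns out to be,
  and primes over the others are kept from containing \<open>J\<close> by the approximation; adding
  a correction that makes \<alpha> primitive and subtracting \<open>a\<close> moves \<alpha>M only
  inside \<open>rB\<close>, so this persists. The inclusion of \<open>dB\<close> in
  \<open>A[\<alpha>]\<close> also gives the finiteness of \<open>B\<close> over \<open>A\<close>, on
  which the ideal theory of \<open>B\<close> rests. It comes from Euler's formula: for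
  \<open>f\<close> the minimal polynomial and \<open>f'(\<alpha>) b = g(\<alpha>)\<close> with
  \<open>g\<close> of degree below \<open>n\<close>, Lagrange interpolation at the conjugates of
  \<alpha> shows that \<open>g\<close> has integral coefficients. All this takes \<open>A\<close>
  infinite, for the \<open>n + 1\<close> elements and for primitive elements. A finite
  \<open>A\<close> is a field, and then \<open>B = L\<close> has a single class, which contains the
  empty product.\<close>

definition submodule_over :: "('a, 'm) ring_scheme \<Rightarrow> 'a set \<Rightarrow> 'a set \<Rightarrow> bool" where
  "submodule_over R A N \<longleftrightarrow>
     N \<subseteq> carrier R \<and> \<zero>\<^bsub>R\<^esub> \<in> N \<and> (\<forall>x\<in>N. \<forall>y\<in>N. x \<oplus>\<^bsub>R\<^esub> y \<in> N) \<and> (\<forall>a\<in>A. \<forall>x\<in>N. a \<otimes>\<^bsub>R\<^esub> x \<in> N)"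

text \<open>The \<open>A\<close>-module generated by \<open>G\<close>, built one summand at a time.
  A generator may occur repeatedly, so its coefficients have to be collected afterwards, as in
  \<open>mspan_insertE\<close>.\<close>

inductive_set (in ring) mspan :: "'a set \<Rightarrow> 'a set \<Rightarrow> 'a set" for A and G where
  zero [intro, simp]: "\<zero> \<in> mspan A G"
| lin: "\<lbrakk>a \<in> A; g \<in> G; s \<in> mspan A G\<rbrakk> \<Longrightarrow> a \<otimes> g \<oplus> s \<in> mspan A G"

lemma (in cring) subring_a_inv:
  assumes A: "subring A R" and "x \<in> A"
  shows "\<ominus>\<^bsub>R\<lparr>carrier := A\<rparr>\<^esub> x = \<ominus> x"
proof -
  interpret S: ring "R\<lparr>carrier := A\<rparr>" by (rule subring_is_ring[OF A])
  show ?thesis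
    using S.minus_equality[of "\<ominus> x" x] assms(2) subringE(1,5)[OF A] by (auto simp: l_neg)
qed

lemma (in cring) subring_idealI:
  assumes A: "subring A R" and "I \<subseteq> A" "\<zero> \<in> I"
    and "\<And>x y. x \<in> I \<Longrightarrow> y \<in> I \<Longrightarrow> x \<oplus> y \<in> I"
    and mult: "\<And>a x. a \<in> A \<Longrightarrow> x \<in> I \<Longrightarrow> a \<otimes> x \<in> I"
  shows "ideal I (R\<lparr>carrier := A\<rparr>)"
proof -
  note AE = subringE[OF A]
  interpret S: ring "R\<lparr>carrier := A\<rparr>" by (rule subring_is_ring[OF A])
  have neg: "\<ominus>\<^bsub>R\<lparr>carrier := A\<rparr>\<^esub> x \<in> I" if "x \<in> I" for x
  proof -
    have x: "x \<in> A" "x \<in> carrier R" using that assms(2) AE(1) by auto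
    have "\<ominus> \<one> \<otimes> x \<in> I" using mult[OF _ that] AE(3,5) by simp
    then show ?thesis using x subring_a_inv[OF A x(1)] by (simp add: l_minus)
  qed
  have "subgroup I (add_monoid (R\<lparr>carrier := A\<rparr>))"
    by (rule S.add.subgroupI) (use assms neg in \<open>auto simp: a_inv_def\<close>)
  then show ?thesis
  proof (rule idealI[OF S.ring_axioms])
    fix a x assume "a \<in> I" "x \<in> carrier (R\<lparr>carrier := A\<rparr>)"
    then have "a \<in> carrier R" "x \<in> carrier R" "x \<in> A" using assms(2) AE(1) by auto
    then show "x \<otimes>\<^bsub>R\<lparr>carrier := A\<rparr>\<^esub> a \<in> I" "a \<otimes>\<^bsub>R\<lparr>carrier := A\<rparr>\<^esub> x \<in> I"
      using mult[OF \<open>x \<in> A\<close> \<open>a \<in> I\<close>] by (simp_all add: m_comm)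
  qed
qed

lemma (in ring) subring_idealD:
  assumes "ideal I (R\<lparr>carrier := A\<rparr>)"
  shows "I \<subseteq> A" "\<zero> \<in> I" "\<And>x y. x \<in> I \<Longrightarrow> y \<in> I \<Longrightarrow> x \<oplus> y \<in> I"
    "\<And>a x. a \<in> A \<Longrightarrow> x \<in> I \<Longrightarrow> a \<otimes> x \<in> I"
    "\<And>a x. a \<in> A \<Longrightarrow> x \<in> I \<Longrightarrow> x \<otimes> a \<in> I"
proof -
  note I = ideal.axioms(1)[OF assms]
  show "I \<subseteq> A" "\<zero> \<in> I" "\<And>x y. x \<in> I \<Longrightarrow> y \<in> I \<Longrightarrow> x \<oplus> y \<in> I"
    "\<And>a x. a \<in> A \<Longrightarrow> x \<in> I \<Longrightarrow> a \<otimes> x \<in> I" "\<And>a x. a \<in> A \<Longrightarrow> x \<in> I \<Longrightarrow> x \<otimes> a \<in> I"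
    using additive_subgroup.a_subset[OF I] additive_subgroup.zero_closed[OF I]
      additive_subgroup.a_closed[OF I] ideal.I_l_closed[OF assms] ideal.I_r_closed[OF assms] by auto
qed

context cring
begin

context
  fixes A assumes A: "subring A R"
begin

lemma mspan_in_carrier: "G \<subseteq> carrier R \<Longrightarrow> s \<in> mspan A G \<Longrightarrow> s \<in> carrier R"
proof -
  assume G: "G \<subseteq> carrier R" and "s \<in> mspan A G"
  from this(2) show ?thesis
    by induction (use G subringE(1)[OF A] in auto)
qed

lemma mspan_least:
  assumes "submodule_over R A N" "G \<subseteq> N"
  shows "mspan A G \<subseteq> N"
proof
  fix s assume "s \<in> mspan A G"
  then show "s \<in> N"
    by induction (use assms in \<open>auto simp: submodule_over_def\<close>)
qed

lemma mspan_add_closed: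
  assumes G: "G \<subseteq> carrier R" and s: "s \<in> mspan A G" and t: "t \<in> mspan A G"
  shows "s \<oplus> t \<in> mspan A G"
  using s
proof induction
  case zero
  then show ?case using t mspan_in_carrier[OF G] by simp
next
  case (lin a g s)
  have "a \<in> carrier R" "g \<in> carrier R" "s \<in> carrier R" "t \<in> carrier R"
    using lin t G subringE(1)[OF A] mspan_in_carrier[OF G] by auto
  then have "a \<otimes> g \<oplus> s \<oplus> t = a \<otimes> g \<oplus> (s \<oplus> t)" by (simp add: a_assoc)
  then show ?case using lin mspan.lin by simp
qed

lemma mspan_mult_closed:
  assumes G: "G \<subseteq> carrier R" and x: "x \<in> carrier R" and xG: "\<And>g. g \<in> G \<Longrightarrow> x \<otimes> g \<in> mspan A H"
    and H: "H \<subseteq> carrier R" and sc: "\<And>a s. a \<in> A \<Longrightarrow> s \<in> mspan A H \<Longrightarrow> a \<otimes> s \<in> mspan A H"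
    and s: "s \<in> mspan A G"
  shows "x \<otimes> s \<in> mspan A H"
  using s
proof induction
  case zero
  then show ?case using x by simp
next
  case (lin a g s)
  have c: "a \<in> carrier R" "g \<in> carrier R" "s \<in> carrier R"
    using lin G subringE(1)[OF A] mspan_in_carrier[OF G] by auto
  then have "x \<otimes> (a \<otimes> g \<oplus> s) = a \<otimes> (x \<otimes> g) \<oplus> x \<otimes> s"
    using x by algebra
  then show ?case using lin mspan_add_closed[OF H] sc xG by simp
qed

lemma mspan_incl: "g \<in> G \<Longrightarrow> g \<in> carrier R \<Longrightarrow> g \<in> mspan A G"
  using mspan.lin[of \<one> A g G \<zero>] subringE(3)[OF A] by simp

lemma mspan_scale:
  assumes G: "G \<subseteq> carrier R" and a: "a \<in> A" and s: "s \<in> mspan A G"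
  shows "a \<otimes> s \<in> mspan A G"
  using s
proof induction
  case zero
  then show ?case using a subringE(1)[OF A] by auto
next
  case (lin b g s)
  have c: "a \<in> carrier R" "b \<in> carrier R" "g \<in> carrier R" "s \<in> carrier R"
    using lin a G subringE(1)[OF A] mspan_in_carrier[OF G] by auto
  then have "a \<otimes> (b \<otimes> g \<oplus> s) = (a \<otimes> b) \<otimes> g \<oplus> a \<otimes> s"
    by algebra
  then show ?case using lin mspan.lin[of "a \<otimes> b"] subringE(6)[OF A a] by simp
qed

lemma mspan_submodule: "G \<subseteq> carrier R \<Longrightarrow> submodule_over R A (mspan A G)"
  unfolding submodule_over_def
  using mspan_in_carrier mspan_add_closed mspan_scale by auto

lemma submodule_over_minus:
  assumes "submodule_over R A N" "x \<in> N" "y \<in> N"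
  shows "x \<ominus> y \<in> N"
proof -
  have c: "x \<in> carrier R" "y \<in> carrier R" using assms unfolding submodule_over_def by auto
  have "\<ominus> \<one> \<in> A" using subringE(3,5)[OF A] by auto
  then have "\<ominus> \<one> \<otimes> y \<in> N" using assms unfolding submodule_over_def by auto
  then have "\<ominus> y \<in> N" using c by (simp add: l_minus)
  then show ?thesis using assms c unfolding submodule_over_def a_minus_def by auto
qed

lemma mspan_mono: "G \<subseteq> H \<Longrightarrow> H \<subseteq> carrier R \<Longrightarrow> mspan A G \<subseteq> mspan A H"
  using mspan_least[OF mspan_submodule[of H], of G] mspan_incl[of _ H] by blast

lemma mspan_insertE:
  assumes G: "insert g G \<subseteq> carrier R" and v: "v \<in> mspan A (insert g G)"
  obtains k s where "k \<in> A" "s \<in> mspan A G" "v = k \<otimes> g \<oplus> s"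
proof -
  have "\<exists>k\<in>A. \<exists>s\<in>mspan A G. v = k \<otimes> g \<oplus> s"
    using v
  proof induction
    case zero
    show ?case using G subringE(2)[OF A] by (auto intro!: bexI[of _ \<zero>])
  next
    case (lin a h t)
    then obtain k s where ks: "k \<in> A" "s \<in> mspan A G" "t = k \<otimes> g \<oplus> s" by auto
    have c: "a \<in> carrier R" "k \<in> carrier R" "g \<in> carrier R" "s \<in> carrier R" "h \<in> carrier R"
      using lin ks G subringE(1)[OF A] mspan_in_carrier[of G] by auto
    show ?case
    proof (cases "h = g")
      case True
      have "a \<otimes> h \<oplus> t = (a \<oplus> k) \<otimes> g \<oplus> s" unfolding True ks using c by algebra
      then show ?thesis using ks lin(1) subringE(7)[OF A] by blast
    next
      case False
      then have h: "h \<in> G" using lin by auto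
      have "a \<otimes> h \<oplus> t = k \<otimes> g \<oplus> (a \<otimes> h \<oplus> s)" unfolding ks using c by algebra
      then show ?thesis using ks lin(1) h mspan.lin by blast
    qed
  qed
  then show thesis using that by blast
qed

lemma lead_ideal:
  assumes G: "insert g G \<subseteq> carrier R" and N: "submodule_over R A N"
  shows "ideal {k \<in> A. \<exists>s\<in>mspan A G. k \<otimes> g \<oplus> s \<in> N} (R\<lparr>carrier := A\<rparr>)"
proof (rule subring_idealI[OF A])
  show "\<zero> \<in> {k \<in> A. \<exists>s\<in>mspan A G. k \<otimes> g \<oplus> s \<in> N}"
    using N G subringE(2)[OF A] unfolding submodule_over_def by (auto intro!: bexI[of _ \<zero>])
next
  fix x y assume "x \<in> {k \<in> A. \<exists>s\<in>mspan A G. k \<otimes> g \<oplus> s \<in> N}" "y \<in> {k \<in> A. \<exists>s\<in>mspan A G. k \<otimes> g \<oplus> s \<in> N}"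
  then obtain s t where st: "x \<in> A" "y \<in> A" "s \<in> mspan A G" "t \<in> mspan A G"
    "x \<otimes> g \<oplus> s \<in> N" "y \<otimes> g \<oplus> t \<in> N" by auto
  have c: "x \<in> carrier R" "y \<in> carrier R" "g \<in> carrier R" "s \<in> carrier R" "t \<in> carrier R"
      using st G subringE(1)[OF A] mspan_in_carrier[of G] by auto
  have "(x \<oplus> y) \<otimes> g \<oplus> (s \<oplus> t) = (x \<otimes> g \<oplus> s) \<oplus> (y \<otimes> g \<oplus> t)" using c by algebra
  then have "(x \<oplus> y) \<otimes> g \<oplus> (s \<oplus> t) \<in> N" using st N unfolding submodule_over_def by simp
  then show "x \<oplus> y \<in> {k \<in> A. \<exists>s\<in>mspan A G. k \<otimes> g \<oplus> s \<in> N}"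
    using st subringE(7)[OF A] mspan_add_closed[of G s t] G by blast
next
  fix a x assume a: "a \<in> A" and "x \<in> {k \<in> A. \<exists>s\<in>mspan A G. k \<otimes> g \<oplus> s \<in> N}"
  then obtain s where st: "x \<in> A" "s \<in> mspan A G" "x \<otimes> g \<oplus> s \<in> N" by auto
  have c: "a \<in> carrier R" "x \<in> carrier R" "g \<in> carrier R" "s \<in> carrier R"
      using a st G subringE(1)[OF A] mspan_in_carrier[of G] by auto
  have "(a \<otimes> x) \<otimes> g \<oplus> (a \<otimes> s) = a \<otimes> (x \<otimes> g \<oplus> s)" using c by algebra
  then have "(a \<otimes> x) \<otimes> g \<oplus> (a \<otimes> s) \<in> N" using st a N unfolding submodule_over_def by simp
  then show "a \<otimes> x \<in> {k \<in> A. \<exists>s\<in>mspan A G. k \<otimes> g \<oplus> s \<in> N}"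
    using a st subringE(6)[OF A] mspan_scale[of G a s] G by blast
qed auto

text \<open>Induction on the generators, in the manner of the Hilbert basis theorem: finitely many
  elements of \<open>N\<close> realise generators of the ideal of coefficients at \<open>g\<close>,
  and subtracting a combination of them from an element of \<open>N\<close> lands in
  \<open>N \<inter> mspan A G\<close>, where the induction hypothesis applies.\<close>

lemma submodule_of_mspan_finitely_generated:
  assumes noeth: "noetherian_ring (R\<lparr>carrier := A\<rparr>)"
    and "finite G" "G \<subseteq> carrier R" "submodule_over R A N" "N \<subseteq> mspan A G"
  shows "\<exists>H\<subseteq>N. finite H \<and> N \<subseteq> mspan A H"
  using assms(2-)
proof (induction G arbitrary: N rule: finite_induct)
  case empty
  have "mspan A {} \<subseteq> {\<zero>}" by (rule mspan_least) (use subringE(1)[OF A] in \<open>auto simp: submodule_over_def\<close>)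
  then show ?case using empty by (intro exI[of _ "{}"]) auto
next
  case (insert g G)
  note G = insert(4) and N = insert(5)
  then have G': "G \<subseteq> carrier R" by auto
  have Nc: "N \<subseteq> carrier R" using N unfolding submodule_over_def by auto
  let ?I = "\<lambda>N. {k \<in> A. \<exists>s\<in>mspan A G. k \<otimes> g \<oplus> s \<in> N}"
  interpret S: noetherian_ring "R\<lparr>carrier := A\<rparr>" by fact
  obtain W where W: "W \<subseteq> A" "finite W" "?I N = Idl\<^bsub>R\<lparr>carrier := A\<rparr>\<^esub> W"
    using S.finetely_gen[OF lead_ideal[OF G N]] by auto
  have "W \<subseteq> ?I N" using W S.genideal_self by simp
  then have "\<forall>w\<in>W. \<exists>s. s \<in> mspan A G \<and> w \<otimes> g \<oplus> s \<in> N" by blast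
  then obtain f where "\<forall>w\<in>W. f w \<in> mspan A G \<and> w \<otimes> g \<oplus> f w \<in> N"
    using bchoice[of W] by metis
  then have f: "\<And>w. w \<in> W \<Longrightarrow> f w \<in> mspan A G \<and> w \<otimes> g \<oplus> f w \<in> N" by blast
  define H1 where "H1 = (\<lambda>w. w \<otimes> g \<oplus> f w) ` W"
  have H1: "H1 \<subseteq> N" "finite H1" using f W(2) unfolding H1_def by auto
  have H1c: "H1 \<subseteq> carrier R" using H1 Nc by auto
  have WI: "W \<subseteq> ?I (mspan A H1)"
  proof
    fix w assume w: "w \<in> W"
    then have "w \<otimes> g \<oplus> f w \<in> mspan A H1" using mspan_incl[of _ H1] H1c unfolding H1_def by auto
    then show "w \<in> ?I (mspan A H1)" using w W f by auto
  qed
  \<comment> \<open>The right side is an ideal containing the generators \<open>W\<close>; so each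
    coefficient at \<open>g\<close> of an element of \<open>N\<close> also occurs in the span of
    \<open>H1\<close>.\<close>
  have sub1: "?I N \<subseteq> ?I (mspan A H1)"
    unfolding W(3) by (rule S.genideal_minimal[OF lead_ideal[OF G mspan_submodule[OF H1c]] WI])
  have "submodule_over R A (N \<inter> mspan A G)"
    using N mspan_submodule[OF G'] unfolding submodule_over_def by auto
  then obtain H2 where H2: "H2 \<subseteq> N \<inter> mspan A G" "finite H2" "N \<inter> mspan A G \<subseteq> mspan A H2"
    using insert(3)[OF G'] by blast
  have Hc: "H1 \<union> H2 \<subseteq> carrier R" using H1c H2 Nc by auto
  have "N \<subseteq> mspan A (H1 \<union> H2)"
  proof
    fix v assume v: "v \<in> N"
    then obtain k s where ks: "k \<in> A" "s \<in> mspan A G" "v = k \<otimes> g \<oplus> s"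
      using mspan_insertE[OF G] insert(6) by blast
    then have "k \<in> ?I (mspan A H1)" using sub1 v by auto
    then obtain t where t: "t \<in> mspan A G" "k \<otimes> g \<oplus> t \<in> mspan A H1" by auto
    define u where "u = k \<otimes> g \<oplus> t"
    have u: "u \<in> N" "u \<in> mspan A H1" using mspan_least[OF N H1(1)] t unfolding u_def by auto
    have c: "k \<in> carrier R" "g \<in> carrier R" "s \<in> carrier R" "t \<in> carrier R"
      using ks t G subringE(1)[OF A] mspan_in_carrier[OF G'] by auto
    have "v \<ominus> u = s \<ominus> t" unfolding ks(3) u_def using c by algebra
    then have "v \<ominus> u \<in> N \<inter> mspan A G"
      using submodule_over_minus[OF N v u(1)] submodule_over_minus[OF mspan_submodule[OF G'] ks(2) t(1)] by auto
    then have 1: "v \<ominus> u \<in> mspan A (H1 \<union> H2)" using H2(3) mspan_mono[of H2 "H1 \<union> H2"] Hc by auto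
    have 2: "u \<in> mspan A (H1 \<union> H2)" using u(2) mspan_mono[of H1 "H1 \<union> H2"] Hc by auto
    have "v = (v \<ominus> u) \<oplus> u" unfolding ks(3) u_def using c by algebra
    then show "v \<in> mspan A (H1 \<union> H2)" using mspan_add_closed[OF Hc 1 2] by simp
  qed
  then show ?case using H1 H2 by (intro exI[of _ "H1 \<union> H2"]) auto
qed

end
end

subsection \<open>Integral closure\<close>

lemma (in cring) eval_map2_add:
  assumes "length p = length q" "set p \<subseteq> carrier R" "set q \<subseteq> carrier R" "x \<in> carrier R"
  shows "eval (map2 (\<oplus>) p q) x = eval p x \<oplus> eval q x"
  using assms
proof (induction p q rule: list_induct2)
  case (Cons a p b q)
  have c: "a \<in> carrier R" "b \<in> carrier R" "eval p x \<in> carrier R" "eval q x \<in> carrier R" "x [^] length p \<in> carrier R"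
    using Cons eval_in_carrier by auto
  have l: "length (map2 (\<oplus>) p q) = length p" using Cons by simp
  have "eval (map2 (\<oplus>) (a # p) (b # q)) x = (a \<oplus> b) \<otimes> x [^] length p \<oplus> eval (map2 (\<oplus>) p q) x"
    using l by simp
  also have "\<dots> = eval (a # p) x \<oplus> eval (b # q) x"
    using Cons c by (simp, algebra)
  finally show ?case .
qed simp

lemma (in cring) eval_map_mult:
  assumes "set p \<subseteq> carrier R" "x \<in> carrier R" "c \<in> carrier R"
  shows "eval (map ((\<otimes>) c) p) x = c \<otimes> eval p x"
  using assms
proof (induction p)
  case (Cons a p)
  have c: "a \<in> carrier R" "eval p x \<in> carrier R" "x [^] length p \<in> carrier R"
    using Cons eval_in_carrier by auto
  then show ?case using Cons by (simp, algebra)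
qed simp

lemma (in cring) eval_map_a_inv:
  assumes "set p \<subseteq> carrier R" "x \<in> carrier R"
  shows "eval (map (\<lambda>a. \<ominus> a) p) x = \<ominus> eval p x"
  using assms
proof (induction p)
  case (Cons a p)
  have c: "a \<in> carrier R" "eval p x \<in> carrier R" "x [^] length p \<in> carrier R"
    using Cons eval_in_carrier by auto
  then show ?case using Cons by (simp, algebra)
qed simp

lemma (in cring) eval_mult_in_submodule:
  assumes A: "subring A R" and W: "submodule_over R A W" and x: "x \<in> carrier R" and v: "v \<in> carrier R"
    and p: "set p \<subseteq> A" and "\<And>i. i < length p \<Longrightarrow> x [^] i \<otimes> v \<in> W"
  shows "eval p x \<otimes> v \<in> W"
  using p assms(6)
proof (induction p)
  case Nil
  then show ?case using W v by (simp add: submodule_over_def)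
next
  case (Cons a p)
  have c: "a \<in> carrier R" "eval p x \<in> carrier R" "x [^] length p \<in> carrier R"
    using Cons eval_in_carrier[of p x] subringE(1)[OF A] x by auto
  have "eval (a # p) x \<otimes> v = a \<otimes> (x [^] length p \<otimes> v) \<oplus> eval p x \<otimes> v"
    using c v by (simp, algebra)
  moreover have "a \<otimes> (x [^] length p \<otimes> v) \<in> W"
    using Cons W unfolding submodule_over_def by simp
  moreover have "eval p x \<otimes> v \<in> W" using Cons by simp
  ultimately show ?case using W unfolding submodule_over_def by simp
qed

lemma (in cring) eval_mult_in_subring:
  assumes A: "subring A R" and "set p \<subseteq> A" "x \<in> A"
  shows "eval p x \<in> A"
  using assms(2,3)
proof (induction p)
  case Nil
  then show ?case using subringE(2)[OF A] by simp
next
  case (Cons a p)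
  have "x [^] n \<in> A" for n :: nat
    by (induction n) (use Cons subringE(3,6)[OF A] in auto)
  then show ?case using Cons subringE(6,7)[OF A] by simp
qed

context domain
begin

text \<open>With the leading coefficient split off, \<open>p\<close> is an arbitrary list from
  \<open>A\<close> and its length is the degree of the equation.\<close>

lemma mem_integral_closure:
  assumes A: "subring A R"
  shows "x \<in> integral_closure R A \<longleftrightarrow> x \<in> carrier R \<and> (\<exists>p. set p \<subseteq> A \<and> eval (\<one> # p) x = \<zero>)"
proof
  assume "x \<in> integral_closure R A"
  then obtain p where p: "x \<in> carrier R" "polynomial A p" "p \<noteq> []" "hd p = \<one>" "eval p x = \<zero>"
    unfolding integral_closure_def univ_poly_carrier by auto
  then have "p = \<one> # tl p" "set (tl p) \<subseteq> A"
    using polynomial_incl[OF p(2)] by (auto simp: neq_Nil_conv)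
  then show "x \<in> carrier R \<and> (\<exists>p. set p \<subseteq> A \<and> eval (\<one> # p) x = \<zero>)" using p by metis
next
  assume "x \<in> carrier R \<and> (\<exists>p. set p \<subseteq> A \<and> eval (\<one> # p) x = \<zero>)"
  then obtain p where p: "x \<in> carrier R" "set p \<subseteq> A" "eval (\<one> # p) x = \<zero>" by auto
  then have "polynomial A (\<one> # p)" using subringE(3)[OF A] by (intro polynomialI) auto
  then have "\<one> # p \<in> carrier (A[X])" by (simp add: univ_poly_carrier)
  then show "x \<in> integral_closure R A" using p unfolding integral_closure_def
    by (intro CollectI conjI bexI[of _ "\<one> # p"]) auto
qed

context
  fixes A assumes A: "subring A R"
begin

text \<open>The list is padded to length exactly \<open>m\<close>, so that
  \<open>x [^] m = eval p x\<close> can be read as a monic equation of degree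
  \<open>m\<close>.\<close>

lemma mspan_powers:
  assumes x: "x \<in> carrier R" and u: "u \<in> carrier R"
    and s: "s \<in> mspan A ((\<lambda>k::nat. x [^] k \<otimes> u) ` {..<m})"
  shows "\<exists>p. set p \<subseteq> A \<and> length p = m \<and> s = eval p x \<otimes> u"
  using s
proof induction
  case zero
  have "eval (replicate m \<zero>) x = \<zero>" using eval_replicate[of "[]" x m] x by simp
  then show ?case using subringE(2)[OF A] u by (intro exI[of _ "replicate m \<zero>"]) auto
next
  case (lin a g s)
  then obtain p k where p: "set p \<subseteq> A" "length p = m" "s = eval p x \<otimes> u" and k: "k < m" "g = x [^] k \<otimes> u" by auto
  define q where "q = replicate (m - Suc k) \<zero> @ monom a k"
  have ac: "a \<in> carrier R" using lin subringE(1)[OF A] by auto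
  have q: "length q = m" "set q \<subseteq> A" using k lin subringE(2)[OF A] unfolding q_def monom_def by auto
  have qe: "eval q x = a \<otimes> x [^] k"
    unfolding q_def using eval_replicate[of "monom a k" x "m - Suc k"] monom_in_carrier[OF ac] x eval_monom[OF ac x] by simp
  have sub: "set (map2 (\<oplus>) q p) \<subseteq> A"
    using p q subringE(7)[OF A] by (auto elim!: in_set_zipE)
  have pc: "set p \<subseteq> carrier R" "set q \<subseteq> carrier R" using p q subringE(1)[OF A] by auto
  have "eval (map2 (\<oplus>) q p) x \<otimes> u = (eval q x \<oplus> eval p x) \<otimes> u"
    using eval_map2_add[of q p x] pc q p x by simp
  also have "\<dots> = a \<otimes> g \<oplus> s" unfolding k(2) p(3) qe
  proof -
    have "x [^] k \<in> carrier R" "eval p x \<in> carrier R" using x eval_in_carrier pc by auto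
    then show "(a \<otimes> x [^] k \<oplus> eval p x) \<otimes> u = a \<otimes> (x [^] k \<otimes> u) \<oplus> eval p x \<otimes> u"
      using ac u by algebra
  qed
  finally show ?case using sub p q by (intro exI[of _ "map2 (\<oplus>) q p"]) auto
qed

text \<open>The equation of \<open>x\<close> folds \<open>x [^] length p\<close> back into lower
  powers. The set \<open>W\<close> is arbitrary so that, for two integral elements, it can consist
  of the powers of the other one.\<close>

lemma mspan_powers_mult_closed:
  assumes x: "x \<in> carrier R" and p: "set p \<subseteq> A" "eval (\<one> # p) x = \<zero>" and W: "W \<subseteq> carrier R"
    and G: "G = (\<lambda>(i::nat, w). x [^] i \<otimes> w) ` ({..<length p} \<times> W)" and v: "v \<in> mspan A G"
  shows "x \<otimes> v \<in> mspan A G"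
proof -
  have Gc: "G \<subseteq> carrier R" unfolding G using x W by auto
  note sub = mspan_submodule[OF A Gc]
  have pe: "eval p x \<in> carrier R" using p subringE(1)[OF A] eval_in_carrier x by auto
  have xp: "x [^] length p = \<ominus> eval p x" using p(2) x pe by (simp add: minus_equality[symmetric] a_comm)
  have Gm: "x [^] i \<otimes> w \<in> mspan A G" if "i < length p" "w \<in> W" for i :: nat and w
    using mspan_incl[OF A, of _ G] that x W unfolding G by force
  show ?thesis
  proof (rule mspan_mult_closed[OF A Gc x _ Gc mspan_scale[OF A Gc] v])
    fix g assume "g \<in> G"
    then obtain i w where iw: "i < length p" "w \<in> W" "g = x [^] i \<otimes> w" unfolding G by auto
    have wc: "w \<in> carrier R" using iw W by auto
    have e: "x \<otimes> g = x [^] (Suc i) \<otimes> w" using iw x wc by (simp add: m_assoc m_comm m_lcomm)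
    show "x \<otimes> g \<in> mspan A G"
    proof (cases "Suc i < length p")
      case True
      then show ?thesis using e Gm[of "Suc i" w] iw by simp
    next
      case False
      then have "Suc i = length p" using iw by simp
      then have "x \<otimes> g = \<ominus> (eval p x \<otimes> w)" using e xp pe wc by (metis l_minus)
      moreover have "eval p x \<otimes> w \<in> mspan A G"
        by (rule eval_mult_in_submodule[OF A sub x wc p(1)]) (use Gm iw in auto)
      then have "\<zero> \<ominus> eval p x \<otimes> w \<in> mspan A G" by (intro submodule_over_minus[OF A sub]) simp_all
      ultimately show ?thesis using pe wc by (simp add: a_minus_def)
    qed
  qed auto
qed

context
  assumes noeth: "noetherian_ring (R\<lparr>carrier := A\<rparr>)"
begin

text \<open>A noetherian substitute for the determinant trick: the span of all
  \<open>x [^] k \<otimes> u\<close> is finitely generated, hence spanned by the first few of them,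
  and the next power gives a monic equation after \<open>u\<close> is cancelled. An arbitrary
  nonzero \<open>u\<close> is allowed so that it can be taken from an ideal stable under
  \<open>x\<close>.\<close>

lemma integralI_powers_in_mspan:
  assumes G: "finite G" "G \<subseteq> carrier R" and x: "x \<in> carrier R" and u: "u \<in> carrier R" "u \<noteq> \<zero>"
    and pow: "\<And>k::nat. x [^] k \<otimes> u \<in> mspan A G"
  shows "x \<in> integral_closure R A"
proof -
  let ?f = "\<lambda>k::nat. x [^] k \<otimes> u"
  have fc: "range ?f \<subseteq> carrier R" using x u by auto
  have "submodule_over R A (mspan A (range ?f))" by (rule mspan_submodule[OF A fc])
  moreover have "mspan A (range ?f) \<subseteq> mspan A G"
    by (rule mspan_least[OF A mspan_submodule[OF A G(2)]]) (use pow in auto)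
  ultimately obtain H where H: "H \<subseteq> mspan A (range ?f)" "finite H" "mspan A (range ?f) \<subseteq> mspan A H"
    using submodule_of_mspan_finitely_generated[OF A noeth G] by blast
  have mono: "mspan A (?f ` {..<m}) \<subseteq> mspan A (?f ` {..<m'})" if "m \<le> m'" for m m' :: nat
    by (rule mspan_mono[OF A]) (use fc that in auto)
  have ex: "\<exists>m. h \<in> mspan A (?f ` {..<m})" if "h \<in> mspan A (range ?f)" for h
    using that
  proof induction
    case (lin a g s)
    then obtain m k where mk: "s \<in> mspan A (?f ` {..<m})" "g = ?f k" by auto
    have "s \<in> mspan A (?f ` {..<max m (Suc k)})" using mono[of m "max m (Suc k)"] mk by auto
    moreover have "g \<in> ?f ` {..<max m (Suc k)}" using mk by auto
    ultimately have "a \<otimes> g \<oplus> s \<in> mspan A (?f ` {..<max m (Suc k)})" by (intro mspan.lin lin(1))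
    then show ?case by blast
  qed auto
  have "\<exists>m. H' \<subseteq> mspan A (?f ` {..<m})" if "finite H'" "H' \<subseteq> H" for H'
    using that
  proof induction
    case (insert h H')
    then obtain m where m: "H' \<subseteq> mspan A (?f ` {..<m})" by auto
    obtain m' where m': "h \<in> mspan A (?f ` {..<m'})" using ex insert H by blast
    show ?case using mono[of m "max m m'"] mono[of m' "max m m'"] m m' by (intro exI[of _ "max m m'"]) auto
  qed auto
  then obtain m where m: "H \<subseteq> mspan A (?f ` {..<m})" using H by blast
  have "mspan A H \<subseteq> mspan A (?f ` {..<m})"
    by (rule mspan_least[OF A mspan_submodule[OF A] m]) (use fc in auto)
  moreover have "?f m \<in> mspan A (range ?f)" using mspan_incl[OF A, of "?f m" "range ?f"] x u by auto
  ultimately have "?f m \<in> mspan A (?f ` {..<m})" using H by auto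
  from mspan_powers[OF x u(1) this] obtain p where p: "set p \<subseteq> A" "length p = m" "x [^] m \<otimes> u = eval p x \<otimes> u"
    by auto
  have pc: "set p \<subseteq> carrier R" "eval p x \<in> carrier R" using p subringE(1)[OF A] eval_in_carrier x by auto
  have "x [^] m = eval p x" using p(3) u x pc m_rcancel by auto
  moreover have "set (map (\<lambda>a. \<ominus> a) p) \<subseteq> A" using p subringE(5)[OF A] by auto
  ultimately show ?thesis using x pc p(2)
    by (intro mem_integral_closure[OF A, THEN iffD2] conjI exI[of _ "map (\<lambda>a. \<ominus> a) p"])
       (auto simp: eval_map_a_inv r_neg)
qed

text \<open>The products of powers of \<open>x\<close> and \<open>y\<close> span a finitely
  generated module that contains \<open>\<one>\<close> and is stable under both, hence under their
  sum and product; all powers of an element that preserves the module lie in it.\<close>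

lemma integral_closure_subring: "subring (integral_closure R A) R"
proof -
  have key: "x \<oplus> y \<in> integral_closure R A \<and> x \<otimes> y \<in> integral_closure R A \<and> \<ominus> x \<in> integral_closure R A"
    if xy: "x \<in> integral_closure R A" "y \<in> integral_closure R A" for x y
  proof -
    obtain p q where p: "set p \<subseteq> A" "eval (\<one> # p) x = \<zero>" and q: "set q \<subseteq> A" "eval (\<one> # q) y = \<zero>"
      and x: "x \<in> carrier R" and y: "y \<in> carrier R"
      using xy mem_integral_closure[OF A] by auto
    have pn: "length p > 0" "length q > 0" using p(2) q(2) by auto
    define G where "G = (\<lambda>(i::nat,j::nat). x [^] i \<otimes> y [^] j) ` ({..<length p} \<times> {..<length q})"
    have G: "finite G" "G \<subseteq> carrier R" using x y unfolding G_def by auto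
    have Gm: "x [^] i \<otimes> y [^] j \<in> mspan A G" if "i < length p" "j < length q" for i j :: nat
      using mspan_incl[OF A, of _ G] that x y unfolding G_def by force
    note sub = mspan_submodule[OF A G(2)]
    have neg: "\<ominus> v \<in> mspan A G" if "v \<in> mspan A G" for v
    proof -
      have "\<zero> \<ominus> v \<in> mspan A G" by (rule submodule_over_minus[OF A sub _ that]) simp
      then show ?thesis using mspan_in_carrier[OF A G(2) that] by (simp add: a_minus_def)
    qed
    have xG: "x \<otimes> v \<in> mspan A G" if "v \<in> mspan A G" for v
      by (rule mspan_powers_mult_closed[OF x p, of "(\<lambda>j. y [^] j) ` {..<length q}"])
         (use y that in \<open>auto simp: G_def image_iff\<close>)
    have comm: "x [^] i \<otimes> y [^] j = y [^] j \<otimes> x [^] i" for i j :: nat using x y by (simp add: m_comm)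
    have G_swap: "G = (\<lambda>(j::nat, w). y [^] j \<otimes> w) ` ({..<length q} \<times> (\<lambda>i. x [^] i) ` {..<length p})"
      unfolding G_def comm by (force simp: image_iff)
    have yG: "y \<otimes> v \<in> mspan A G" if "v \<in> mspan A G" for v
      by (rule mspan_powers_mult_closed[OF y q _ G_swap that]) (use x in auto)
    have oneG: "\<one> \<in> mspan A G" using Gm[of 0 0] pn by simp
    have stab: "z \<in> integral_closure R A" if z: "z \<in> carrier R" "\<And>v. v \<in> mspan A G \<Longrightarrow> z \<otimes> v \<in> mspan A G" for z
    proof (rule integralI_powers_in_mspan[OF G z(1), of \<one>])
      fix k :: nat
      show "z [^] k \<otimes> \<one> \<in> mspan A G"
      proof (induction k)
        case (Suc k)
        then show ?case using z(2)[of "z [^] k"] z(1) by (simp add: m_comm)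
      qed (use oneG in simp)
    qed auto
    have "x \<oplus> y \<in> integral_closure R A"
    proof (rule stab)
      fix v assume v: "v \<in> mspan A G"
      then show "(x \<oplus> y) \<otimes> v \<in> mspan A G"
        using mspan_add_closed[OF A G(2) xG[OF v] yG[OF v]] mspan_in_carrier[OF A G(2) v] x y by (simp add: l_distr)
    qed (use x y in simp)
    moreover have "x \<otimes> y \<in> integral_closure R A"
    proof (rule stab)
      fix v assume v: "v \<in> mspan A G"
      then show "(x \<otimes> y) \<otimes> v \<in> mspan A G"
        using xG[OF yG[OF v]] mspan_in_carrier[OF A G(2) v] x y by (simp add: m_assoc)
    qed (use x y in simp)
    moreover have "\<ominus> x \<in> integral_closure R A"
    proof (rule stab)
      fix v assume v: "v \<in> mspan A G"
      then show "\<ominus> x \<otimes> v \<in> mspan A G"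
        using neg[OF xG[OF v]] mspan_in_carrier[OF A G(2) v] x by (simp add: l_minus)
    qed (use x in simp)
    ultimately show ?thesis by blast
  qed
  show ?thesis
  proof (rule subringI)
    show "integral_closure R A \<subseteq> carrier R" unfolding integral_closure_def by auto
    have "eval [\<one>, \<ominus> \<one>] \<one> = \<zero>" by (simp add: r_neg)
    then show "\<one> \<in> integral_closure R A"
      using mem_integral_closure[OF A] subringE(3,5)[OF A] by (auto intro!: exI[of _ "[\<ominus> \<one>]"])
  qed (use key in auto)
qed

end

lemma subset_integral_closure: "A \<subseteq> integral_closure R A"
proof
  fix a assume a: "a \<in> A"
  then have ac: "a \<in> carrier R" using subringE(1)[OF A] by auto
  then have "eval [\<one>, \<ominus> a] a = \<zero>" by (simp add: r_neg)
  then show "a \<in> integral_closure R A"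
      using mem_integral_closure[OF A] subringE(3,5)[OF A] a ac by (auto intro!: exI[of _ "[\<ominus> a]"])
qed

end
end

subsection \<open>Prime ideals of noetherian domains of dimension one\<close>

text \<open>Noetherian induction: a maximal counterexample exists because a nonempty chain of ideals
  contains its union.\<close>

lemma (in noetherian_ring) ideal_induct [consumes 1, case_names step]:
  assumes I: "ideal I R"
    and step: "\<And>I. ideal I R \<Longrightarrow> (\<And>J. ideal J R \<Longrightarrow> I \<subset> J \<Longrightarrow> P J) \<Longrightarrow> P I"
  shows "P I"
proof (rule ccontr)
  assume nP: "\<not> P I"
  define F where "F = {I. ideal I R \<and> \<not> P I}"
  have "\<exists>M\<in>F. \<forall>Z\<in>F. M \<subseteq> Z \<longrightarrow> Z = M"
  proof (rule subset_Zorn_nonempty)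
    show "F \<noteq> {}" using I nP unfolding F_def by auto
    fix C assume C: "C \<noteq> {}" "subset.chain F C"
    then have "subset.chain {I. ideal I R} C" unfolding F_def pred_on.chain_def by auto
    then have "\<Union>C \<in> C" by (rule ideal_chain_is_trivial[OF C(1)])
    then show "\<Union>C \<in> F" using C(2) unfolding pred_on.chain_def by auto
  qed
  then obtain M where M: "M \<in> F" "\<And>Z. Z \<in> F \<Longrightarrow> M \<subseteq> Z \<Longrightarrow> Z = M" by blast
  then have "P M" using step[of M] unfolding F_def by blast
  then show False using M unfolding F_def by auto
qed

text \<open>Products of elements without sums: containment of a product of ideals in an ideal can be
  tested on these. The empty list gives \<open>{\<one>}\<close>, which lies in no proper
  ideal.\<close>

primrec set_prods :: "('a, 'm) ring_scheme \<Rightarrow> 'a set list \<Rightarrow> 'a set" where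
  "set_prods R [] = {\<one>\<^bsub>R\<^esub>}"
| "set_prods R (q # qs) = {x \<otimes>\<^bsub>R\<^esub> y | x y. x \<in> q \<and> y \<in> set_prods R qs}"

context cring
begin

lemma set_prods_carrier: "\<forall>q\<in>set qs. q \<subseteq> carrier R \<Longrightarrow> set_prods R qs \<subseteq> carrier R"
  by (induction qs) auto

lemma set_prods_remove1:
  assumes "q \<in> set qs" "\<forall>q\<in>set qs. q \<subseteq> carrier R"
  shows "set_prods R (q # remove1 q qs) \<subseteq> set_prods R qs"
  using assms
proof (induction qs)
  case (Cons a qs)
  show ?case
  proof (cases "a = q")
    case False
    then have IH: "set_prods R (q # remove1 q qs) \<subseteq> set_prods R qs" using Cons by auto
    show ?thesis
    proof
      fix z assume "z \<in> set_prods R (q # remove1 q (a # qs))"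
      then obtain x b y where xby: "x \<in> q" "b \<in> a" "y \<in> set_prods R (remove1 q qs)" "z = x \<otimes> (b \<otimes> y)"
        using False by auto
      have "y \<in> carrier R" using xby Cons(3) set_prods_carrier[of "remove1 q qs"] set_remove1_subset[of q qs] by (meson list.set_intros(2) subsetD)
      moreover have "x \<in> carrier R" "b \<in> carrier R" using xby Cons by auto
      ultimately have "z = b \<otimes> (x \<otimes> y)" using xby by (simp add: m_lcomm)
      moreover have "x \<otimes> y \<in> set_prods R qs" using IH xby by auto
      ultimately show "z \<in> set_prods R (a # qs)" using xby by auto
    qed
  qed simp
qed simp

lemma set_prods_appendE:
  assumes "z \<in> set_prods R (ps @ qs)" "\<forall>q\<in>set (ps @ qs). q \<subseteq> carrier R"
  obtains x y where "x \<in> set_prods R ps" "y \<in> set_prods R qs" "z = x \<otimes> y"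
proof -
  have "\<exists>x\<in>set_prods R ps. \<exists>y\<in>set_prods R qs. z = x \<otimes> y"
    using assms
  proof (induction ps arbitrary: z)
    case Nil
    then have "z \<in> carrier R" using set_prods_carrier[of qs] by auto
    then show ?case using Nil by (auto intro!: bexI[of _ z])
  next
    case (Cons p ps)
    then obtain a w where aw: "a \<in> p" "w \<in> set_prods R (ps @ qs)" "z = a \<otimes> w" by auto
    then obtain x y where xy: "x \<in> set_prods R ps" "y \<in> set_prods R qs" "w = x \<otimes> y" using Cons(1)[OF aw(2)] Cons(3) by auto
    have "a \<in> carrier R" "x \<in> carrier R" "y \<in> carrier R"
      using aw xy Cons(3) set_prods_carrier[of ps] set_prods_carrier[of qs] by auto
    then have "z = (a \<otimes> x) \<otimes> y" using aw xy by (simp add: m_assoc)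
    then show ?case using aw xy by auto
  qed
  then show thesis using that by blast
qed

lemma primeideal_contains_factor:
  assumes p: "primeideal p R" and "set_prods R qs \<subseteq> p" and "\<forall>q\<in>set qs. q \<subseteq> carrier R"
  shows "\<exists>q\<in>set qs. q \<subseteq> p"
  using assms(2,3)
proof (induction qs)
  case Nil
  then show ?case using primeideal.I_notcarr[OF p] ideal.one_imp_carrier[OF primeideal.axioms(1)[OF p]] by auto
next
  case (Cons q qs)
  show ?case
  proof (cases "q \<subseteq> p")
    case False
    then obtain x where x: "x \<in> q" "x \<notin> p" by auto
    have "set_prods R qs \<subseteq> p"
    proof
      fix y assume y: "y \<in> set_prods R qs"
      then have "x \<otimes> y \<in> p" using Cons(2) x by auto
      then show "y \<in> p" using primeideal.I_prime[OF p, of x y] x Cons(3) y set_prods_carrier[of qs] by auto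
    qed
    then show ?thesis using Cons by auto
  qed auto
qed

text \<open>Multiply elements taken from each \<open>J\<close> outside \<open>p\<close>; primality
  keeps the product outside \<open>p\<close>.\<close>

lemma primeideal_avoidance:
  assumes p: "primeideal p R" and "finite Z" "\<And>J. J \<in> Z \<Longrightarrow> ideal J R \<and> \<not> J \<subseteq> p"
  shows "\<exists>u\<in>carrier R. u \<notin> p \<and> (\<forall>J\<in>Z. u \<in> J)"
  using assms(2,3)
proof induction
  case empty
  then show ?case using primeideal.I_notcarr[OF p] ideal.one_imp_carrier[OF primeideal.axioms(1)[OF p]] by auto
next
  case (insert J Z)
  then obtain u where u: "u \<in> carrier R" "u \<notin> p" "\<forall>J\<in>Z. u \<in> J" by auto
  obtain v where v: "v \<in> J" "v \<notin> p" using insert by auto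
  have J: "ideal J R" using insert by auto
  have vc: "v \<in> carrier R" using v ideal.Icarr[OF J] by auto
  have "v \<otimes> u \<notin> p" using primeideal.I_prime[OF p vc u(1)] u v by auto
  moreover have "v \<otimes> u \<in> J" using ideal.I_r_closed[OF J v(1) u(1)] .
  moreover have "v \<otimes> u \<in> J'" if "J' \<in> Z" for J' using ideal.I_l_closed[of J' R u v] insert that u vc by auto
  ultimately show ?case using u vc by (intro bexI[of _ "v \<otimes> u"]) auto
qed

lemma maximalideal_inverse:
  assumes p: "maximalideal p R" and x: "x \<in> carrier R" "x \<notin> p"
  shows "\<exists>v\<in>carrier R. v \<otimes> x \<ominus> \<one> \<in> p"
proof -
  note pI = maximalideal.axioms(1)[OF p]
  have sub: "p \<subseteq> carrier R" using ideal.Icarr[OF pI] by auto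
  have ideal: "ideal (p <+> PIdl x) R" by (rule add_ideals[OF pI cgenideal_ideal[OF x(1)]])
  have p_sub: "p \<subseteq> p <+> PIdl x"
  proof
    fix y assume "y \<in> p"
    then have "y \<oplus> \<zero> \<in> p <+> PIdl x" unfolding set_add_def' cgenideal_def using x by (force intro!: exI[of _ \<zero>])
    then show "y \<in> p <+> PIdl x" using \<open>y \<in> p\<close> sub by auto
  qed
  have "\<zero> \<oplus> x \<in> p <+> PIdl x" unfolding set_add_def'
    using additive_subgroup.zero_closed[OF ideal.axioms(1)[OF pI]] cgenideal_self[OF x(1)] by blast
  then have "p <+> PIdl x \<noteq> p" using x by auto
  then have "p <+> PIdl x = carrier R"
    using maximalideal.I_maximal[OF p ideal p_sub] ideal.Icarr[OF ideal] by blast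
  then have "\<one> \<in> p <+> PIdl x" by simp
  then obtain i v where iv: "i \<in> p" "v \<in> carrier R" "\<one> = i \<oplus> v \<otimes> x" unfolding set_add_def' cgenideal_def by blast
  have "i \<in> carrier R" using iv sub by auto
  then have "v \<otimes> x \<ominus> \<one> = \<ominus> i" unfolding iv(3) using iv(2) x by algebra
  then have "v \<otimes> x \<ominus> \<one> \<in> p" using iv additive_subgroup.a_inv_closed[OF ideal.axioms(1)[OF pI]] by simp
  then show ?thesis using iv by blast
qed

end

lemma nonzero_primes_carrier: "p \<in> nonzero_primes R \<Longrightarrow> p \<subseteq> carrier R"
  unfolding nonzero_primes_def
  using additive_subgroup.a_subset[OF ideal.axioms(1)[OF primeideal.axioms(1)]] by blast

lemma (in cring) subring_primeD:
  assumes A: "subring A R" and q: "q \<in> nonzero_primes (R\<lparr>carrier := A\<rparr>)"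
  shows "primeideal q (R\<lparr>carrier := A\<rparr>)" "ideal q (R\<lparr>carrier := A\<rparr>)" "q \<noteq> {\<zero>}" "q \<subseteq> A" "\<one> \<notin> q"
    "\<And>x y. x \<in> A \<Longrightarrow> y \<in> A \<Longrightarrow> x \<otimes> y \<in> q \<Longrightarrow> x \<in> q \<or> y \<in> q"
    "\<And>x y. x \<in> q \<Longrightarrow> y \<in> q \<Longrightarrow> x \<oplus> y \<in> q" "\<And>x y. x \<in> q \<Longrightarrow> y \<in> q \<Longrightarrow> x \<ominus> y \<in> q"
    "\<And>a x. a \<in> A \<Longrightarrow> x \<in> q \<Longrightarrow> a \<otimes> x \<in> q"
proof -
  show p: "primeideal q (R\<lparr>carrier := A\<rparr>)" and i: "ideal q (R\<lparr>carrier := A\<rparr>)" and "q \<noteq> {\<zero>}"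
    using q primeideal.axioms(1) unfolding nonzero_primes_def by auto
  note I = subring_idealD[OF i]
  show "q \<subseteq> A" "\<And>x y. x \<in> q \<Longrightarrow> y \<in> q \<Longrightarrow> x \<oplus> y \<in> q" "\<And>a x. a \<in> A \<Longrightarrow> x \<in> q \<Longrightarrow> a \<otimes> x \<in> q"
    using I by auto
  show "\<one> \<notin> q" using primeideal.I_notcarr[OF p] ideal.one_imp_carrier[OF i] by auto
  show "\<And>x y. x \<in> A \<Longrightarrow> y \<in> A \<Longrightarrow> x \<otimes> y \<in> q \<Longrightarrow> x \<in> q \<or> y \<in> q"
    using primeideal.I_prime[OF p] by auto
  fix x y assume xy: "x \<in> q" "y \<in> q"
  have "\<ominus> \<one> \<otimes> y \<in> q" using I(4)[OF _ xy(2)] subringE(3,5)[OF A] by simp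
  then have "x \<oplus> \<ominus> \<one> \<otimes> y \<in> q" by (rule I(3)[OF xy(1)])
  moreover have "y \<in> carrier R" using I(1) xy subringE(1)[OF A] by auto
  ultimately show "x \<ominus> y \<in> q" by (simp add: l_minus a_minus_def)
qed

context noetherian_domain
begin

text \<open>If \<open>I\<close> is proper and not prime, some \<open>a \<otimes> b\<close> lies in
  \<open>I\<close> with \<open>a\<close> and \<open>b\<close> outside, and products of elements of
  \<open>I <+> PIdl a\<close> and \<open>I <+> PIdl b\<close> fall back into
  \<open>I\<close>.\<close>

lemma exists_set_prods_subset:
  assumes "ideal I R" "I \<noteq> {\<zero>}"
  shows "\<exists>qs. set qs \<subseteq> nonzero_primes R \<and> set_prods R qs \<subseteq> I"
  using assms
proof (induction I rule: ideal_induct)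
  case (step I)
  note I = step(1)
  interpret I: ideal I R by fact
  show ?case
  proof (cases "primeideal I R")
    case True
    then show ?thesis using step(3) I.Icarr by (intro exI[of _ "[I]"]) (auto simp: nonzero_primes_def)
  next
    case False
    then consider "carrier R = I"
      | "\<exists>a b. a \<in> carrier R \<and> b \<in> carrier R \<and> a \<otimes> b \<in> I \<and> a \<notin> I \<and> b \<notin> I"
      using I.primeidealCD[OF is_cring] by blast
    then show ?thesis
    proof cases
      case 1
      have "\<one> \<in> I" using one_closed 1 by simp
      then show ?thesis by (intro exI[of _ "[]"]) auto
    next
      case 2
      then obtain a b where ab: "a \<in> carrier R" "b \<in> carrier R" "a \<otimes> b \<in> I" "a \<notin> I" "b \<notin> I" by auto
      have *: "\<exists>qs. set qs \<subseteq> nonzero_primes R \<and> set_prods R qs \<subseteq> I <+> PIdl a"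
        if a: "a \<in> carrier R" "a \<notin> I" for a
      proof -
        have "\<zero> \<oplus> a \<in> I <+> PIdl a"
          unfolding set_add_def' using I.zero_closed cgenideal_self[OF a(1)] by blast
        then have "a \<in> I <+> PIdl a" using a by simp
        moreover have "I \<subseteq> I <+> PIdl a"
        proof
          fix y assume y: "y \<in> I"
          then have "y = y \<oplus> \<zero> \<otimes> a" using a I.Icarr by simp
          then show "y \<in> I <+> PIdl a" unfolding set_add_def' cgenideal_def using y by blast
        qed
        ultimately show ?thesis
          using step(2)[OF add_ideals[OF I cgenideal_ideal[OF a(1)]]] step(3) a I.zero_closed by blast
      qed
      obtain ps qs where ps: "set ps \<subseteq> nonzero_primes R" "set_prods R ps \<subseteq> I <+> PIdl a"
        and qs: "set qs \<subseteq> nonzero_primes R" "set_prods R qs \<subseteq> I <+> PIdl b"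
        using *[of a] *[of b] ab by metis
      have c: "\<forall>q\<in>set (ps @ qs). q \<subseteq> carrier R"
        using ps(1) qs(1) nonzero_primes_carrier[of _ R] unfolding set_append by blast
      have "set_prods R (ps @ qs) \<subseteq> I"
      proof
        fix z assume "z \<in> set_prods R (ps @ qs)"
        then obtain x y where xy: "x \<in> set_prods R ps" "y \<in> set_prods R qs" "z = x \<otimes> y"
          using set_prods_appendE c by blast
        then have "x \<in> I <+> PIdl a" "y \<in> I <+> PIdl b" using ps qs by auto
        then obtain i r j s where irjs: "i \<in> I" "r \<in> carrier R" "x = i \<oplus> r \<otimes> a" "j \<in> I" "s \<in> carrier R" "y = j \<oplus> s \<otimes> b"
          unfolding set_add_def' cgenideal_def by blast
        have c: "i \<in> carrier R" "j \<in> carrier R" using irjs I.Icarr by auto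
        have "(i \<oplus> r \<otimes> a) \<otimes> (j \<oplus> s \<otimes> b)
            = i \<otimes> (j \<oplus> s \<otimes> b) \<oplus> ((r \<otimes> a) \<otimes> j \<oplus> (r \<otimes> s) \<otimes> (a \<otimes> b))"
          using c irjs(2,5) ab(1,2) by algebra
        then have "z = i \<otimes> (j \<oplus> s \<otimes> b) \<oplus> ((r \<otimes> a) \<otimes> j \<oplus> (r \<otimes> s) \<otimes> (a \<otimes> b))"
          using xy(3) irjs(3,6) by metis
        moreover have "i \<otimes> (j \<oplus> s \<otimes> b) \<in> I" using I.I_r_closed irjs c ab by auto
        moreover have "(r \<otimes> a) \<otimes> j \<in> I" "(r \<otimes> s) \<otimes> (a \<otimes> b) \<in> I" using I.I_l_closed irjs c ab by auto
        ultimately show "z \<in> I" by auto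
      qed
      then show ?thesis using ps qs by (intro exI[of _ "ps @ qs"]) auto
    qed
  qed
qed

context
  assumes maximal: "\<And>p. p \<in> nonzero_primes R \<Longrightarrow> maximalideal p R"
begin

lemma nonzero_primes_subset_eq:
  assumes "p \<in> nonzero_primes R" "q \<in> nonzero_primes R" "p \<subseteq> q"
  shows "p = q"
proof -
  have q: "primeideal q R" using assms unfolding nonzero_primes_def by auto
  have "q = p \<or> q = carrier R" using nonzero_primes_carrier[OF assms(2)] maximalideal.I_maximal[OF maximal[OF assms(1)] primeideal.axioms(1)[OF q] assms(3)] by blast
  then show ?thesis using primeideal.I_notcarr[OF q] by auto
qed

text \<open>A prime containing \<open>a\<close> contains a fixed product of primes inside
  \<open>PIdl a\<close>, hence one of the factors, and equals it by maximality.\<close>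

lemma finite_primes_containing:
  assumes a: "a \<in> carrier R" "a \<noteq> \<zero>"
  shows "finite {p \<in> nonzero_primes R. a \<in> p}"
proof -
  have "PIdl a \<noteq> {\<zero>}" using cgenideal_self[OF a(1)] a(2) by auto
  then obtain qs where qs: "set qs \<subseteq> nonzero_primes R" "set_prods R qs \<subseteq> PIdl a"
    using exists_set_prods_subset[OF cgenideal_ideal[OF a(1)]] by auto
  have c: "\<forall>q\<in>set qs. q \<subseteq> carrier R"
    using qs(1) nonzero_primes_carrier[of _ R] by blast
  have "p \<in> set qs" if p: "p \<in> nonzero_primes R" "a \<in> p" for p
  proof -
    have pp: "primeideal p R" using p unfolding nonzero_primes_def by auto
    have "PIdl a \<subseteq> p" by (rule cgenideal_minimal[OF primeideal.axioms(1)[OF pp] p(2)])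
    then obtain q where "q \<in> set qs" "q \<subseteq> p" using primeideal_contains_factor[OF pp _ c] qs by auto
    then show ?thesis using nonzero_primes_subset_eq[of q p] p qs by auto
  qed
  then have "{p \<in> nonzero_primes R. a \<in> p} \<subseteq> set qs" by auto
  then show ?thesis using finite_subset by blast
qed

text \<open>The residues are prescribed for a multiple of \<open>t\<close>; this lets the element
  \<open>a\<close> of the overview meet its divisibility conditions at the same time.\<close>

lemma chinese_remainder_primes:
  assumes "finite P" "P \<subseteq> nonzero_primes R" and t: "t \<in> carrier R" "\<And>p. p \<in> P \<Longrightarrow> t \<notin> p"
    and g: "\<And>p. p \<in> P \<Longrightarrow> g p \<in> carrier R"
  shows "\<exists>r\<in>carrier R. \<forall>p\<in>P. r \<otimes> t \<ominus> g p \<in> p"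
  using assms(1,2) t(2) g
proof (induction P)
  case (insert p P)
  then obtain r where r: "r \<in> carrier R" "\<forall>p\<in>P. r \<otimes> t \<ominus> g p \<in> p" by auto
  have p: "primeideal p R" using insert unfolding nonzero_primes_def by auto
  note pI = primeideal.axioms(1)[OF p]
  have "ideal q R \<and> \<not> q \<subseteq> p" if "q \<in> P" for q
  proof -
    have "q \<in> nonzero_primes R" "p \<in> nonzero_primes R" "q \<noteq> p" using insert that by auto
    then show ?thesis using nonzero_primes_subset_eq[of q p] primeideal.axioms(1)[of q R]
      unfolding nonzero_primes_def by blast
  qed
  then obtain u where u: "u \<in> carrier R" "u \<notin> p" "\<forall>q\<in>P. u \<in> q"
    using primeideal_avoidance[OF p insert(1)] by blast
  have "u \<otimes> t \<notin> p" using primeideal.I_prime[OF p u(1) t(1)] u insert by auto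
  then obtain v where v: "v \<in> carrier R" "v \<otimes> (u \<otimes> t) \<ominus> \<one> \<in> p"
    using maximalideal_inverse[OF maximal, of p "u \<otimes> t"] insert u t by auto
  \<comment> \<open>The correction is divisible by \<open>u\<close>, so it vanishes modulo the old
    primes, while \<open>v \<otimes> (u \<otimes> t)\<close> is congruent to \<open>\<one>\<close>
    modulo \<open>p\<close>.\<close>
  define r' where "r' = r \<oplus> (g p \<ominus> r \<otimes> t) \<otimes> (v \<otimes> u)"
  have gp: "g p \<in> carrier R" using insert by auto
  have "r' \<otimes> t \<ominus> g p = (g p \<ominus> r \<otimes> t) \<otimes> (v \<otimes> (u \<otimes> t) \<ominus> \<one>)"
    unfolding r'_def using gp r(1) v(1) u(1) t(1) by algebra
  then have 1: "r' \<otimes> t \<ominus> g p \<in> p" using ideal.I_l_closed[OF pI v(2)] gp r(1) t(1) by auto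
  have 2: "r' \<otimes> t \<ominus> g q \<in> q" if q: "q \<in> P" for q
  proof -
    have qI: "ideal q R" using insert q unfolding nonzero_primes_def by (auto dest: primeideal.axioms(1))
    have gq: "g q \<in> carrier R" using insert q by auto
    have "r' \<otimes> t \<ominus> g q = (r \<otimes> t \<ominus> g q) \<oplus> ((g p \<ominus> r \<otimes> t) \<otimes> (v \<otimes> t)) \<otimes> u"
      unfolding r'_def using gp gq r(1) v(1) u(1) t(1) by algebra
    moreover have "((g p \<ominus> r \<otimes> t) \<otimes> (v \<otimes> t)) \<otimes> u \<in> q"
      using ideal.I_l_closed[OF qI, of u] u q gp r(1) v(1) t(1) by auto
    ultimately show ?thesis using r(2) q additive_subgroup.a_closed[OF ideal.axioms(1)[OF qI]] by auto
  qed
  have "r' \<in> carrier R" unfolding r'_def using gp r(1) v(1) u(1) t(1) by auto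
  with 1 2 show ?case by blast
next
  case empty
  show ?case by blast
qed

end
end

subsection \<open>Multipliers and factorization of ideals\<close>

lemma (in noetherian_ring) exists_maximalideal:
  assumes "ideal I R" "I \<noteq> carrier R"
  shows "\<exists>J. maximalideal J R \<and> I \<subseteq> J"
  using assms
proof (induction I rule: ideal_induct)
  case (step I)
  show ?case
  proof (cases "maximalideal I R")
    case False
    then obtain J where J: "ideal J R" "I \<subset> J" "J \<noteq> carrier R"
      using maximalidealI[OF step(1)] step(3) by (metis psubsetI)
    then obtain K where "maximalideal K R" "J \<subseteq> K" using step(2) by blast
    then show ?thesis using J by blast
  qed auto
qed

text \<open>Integral closedness is phrased through ideals stable under \<open>x\<close>: the
  arguments on ideals use it in this form, and finiteness of \<open>B\<close> over \<open>A\<close>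
  delivers it in this form.\<close>

locale dedekind_subring = field R + S: noetherian_domain "R\<lparr>carrier := B\<rparr>" for R (structure) and B +
  assumes B: "subring B R"
    and maximal: "\<And>q. q \<in> nonzero_primes (R\<lparr>carrier := B\<rparr>) \<Longrightarrow> maximalideal q (R\<lparr>carrier := B\<rparr>)"
    and integrally_closed: "\<And>x I. \<lbrakk>x \<in> carrier R; ideal I (R\<lparr>carrier := B\<rparr>); I \<noteq> {\<zero>}; \<And>y. y \<in> I \<Longrightarrow> x \<otimes> y \<in> I\<rbrakk> \<Longrightarrow> x \<in> B"
begin

abbreviation "S \<equiv> R\<lparr>carrier := B\<rparr>"

lemma B_carrier: "x \<in> B \<Longrightarrow> x \<in> carrier R"
  using subringE(1)[OF B] by auto

lemmas nonzero_primesD = subring_primeD[OF B]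

lemma ideal_nonzero_elt:
  assumes "ideal I S" "I \<noteq> {\<zero>}"
  obtains a where "a \<in> I" "a \<noteq> \<zero>" "a \<in> B"
  using subring_idealD[OF assms(1)] assms(2) by blast

text \<open>An element of the inverse of \<open>q\<close> outside \<open>B\<close>. In a shortest
  product of primes inside the principal ideal of some \<open>a \<in> q\<close>, the factor
  \<open>q\<close> must occur; an element \<open>b\<close> of the product of the other factors that
  is not divisible by \<open>a\<close> yields \<open>b \<otimes> inv a\<close>. By integral
  closedness it cannot map \<open>q\<close> into \<open>q\<close>.\<close>

lemma prime_inverse_elt:
  assumes q: "q \<in> nonzero_primes S"
  shows "\<exists>x\<in>carrier R. (\<forall>y\<in>q. x \<otimes> y \<in> B) \<and> (\<exists>y\<in>q. x \<otimes> y \<notin> q) \<and> x \<notin> B"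
proof -
  note qD = nonzero_primesD[OF q]
  obtain a where a: "a \<in> q" "a \<noteq> \<zero>" "a \<in> B" using ideal_nonzero_elt qD by blast
  define P where "P = (\<lambda>qs. set qs \<subseteq> nonzero_primes S \<and> set_prods S qs \<subseteq> PIdl\<^bsub>S\<^esub> a)"
  have aI: "ideal (PIdl\<^bsub>S\<^esub> a) S" using S.cgenideal_ideal a by simp
  have "a \<in> PIdl\<^bsub>S\<^esub> a" using S.cgenideal_self[of a] a by simp
  then have "\<exists>qs. P qs" unfolding P_def using S.exists_set_prods_subset[OF aI] a by auto
  then obtain qs where qs: "P qs" "\<And>qs'. P qs' \<Longrightarrow> length qs \<le> length qs'"
    using ex_has_least_nat[of P _ length] by blast
  have qs1: "set qs \<subseteq> nonzero_primes S" "set_prods S qs \<subseteq> PIdl\<^bsub>S\<^esub> a" using qs(1) unfolding P_def by auto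
  have c: "\<forall>q\<in>set qs. q \<subseteq> carrier S" using qs1 nonzero_primesD(4) by auto
  have "PIdl\<^bsub>S\<^esub> a \<subseteq> q" by (rule S.cgenideal_minimal[OF qD(2) a(1)])
  then obtain q' where q': "q' \<in> set qs" "q' \<subseteq> q" using S.primeideal_contains_factor[OF qD(1) _ c] qs1 by auto
  have "q' = q" using S.nonzero_primes_subset_eq[OF maximal, of q' q] q' qs1 q by auto
  then have q_in: "q \<in> set qs" using q' by simp
  have "\<not> P (remove1 q qs)"
  proof
    assume "P (remove1 q qs)"
    then have "length qs \<le> length (remove1 q qs)" by (rule qs(2))
    moreover have "length (remove1 q qs) = length qs - 1" by (simp add: length_remove1 q_in)
    ultimately show False using length_pos_if_in_set[OF q_in] by linarith
  qed
  moreover have "set (remove1 q qs) \<subseteq> nonzero_primes S" using set_remove1_subset[of q qs] qs1 by blast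
  ultimately obtain b where b: "b \<in> set_prods S (remove1 q qs)" "b \<notin> PIdl\<^bsub>S\<^esub> a" unfolding P_def by blast
  have bB: "b \<in> B" using b S.set_prods_carrier[of "remove1 q qs"] c set_remove1_subset[of q qs] by auto
  define x where "x = b \<otimes> inv a"
  have ac: "a \<in> carrier R" "a \<in> Units R" using a B_carrier field_Units by auto
  have bc: "b \<in> carrier R" using bB B_carrier by auto
  have xc: "x \<in> carrier R" unfolding x_def using ac bc by auto
  have xa: "x \<otimes> a = b" unfolding x_def using ac bc by (simp add: m_assoc)
  have xB: "x \<notin> B"
  proof
    assume "x \<in> B"
    then have "b \<in> PIdl\<^bsub>S\<^esub> a" unfolding cgenideal_def using xa by auto
    then show False using b by simp
  qed
  have xq: "x \<otimes> y \<in> B" if y: "y \<in> q" for y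
  proof -
    have "y \<otimes> b \<in> set_prods S (q # remove1 q qs)" using y b by auto
    then have "y \<otimes> b \<in> PIdl\<^bsub>S\<^esub> a" by (rule subsetD[OF qs1(2) subsetD[OF S.set_prods_remove1[OF q_in c]]])
    then obtain r where r: "r \<in> B" "y \<otimes> b = r \<otimes> a" unfolding cgenideal_def by auto
    have yc: "y \<in> carrier R" "r \<in> carrier R" using y qD(4) r B_carrier by auto
    have "(x \<otimes> y) \<otimes> a = y \<otimes> (x \<otimes> a)" using xc yc(1) ac(1) by algebra
    then have "(x \<otimes> y) \<otimes> a = r \<otimes> a" unfolding xa r(2) .
    then have "x \<otimes> y = r" using m_rcancel[of a] a ac yc xc by auto
    then show ?thesis using r by simp
  qed
  have "\<exists>y\<in>q. x \<otimes> y \<notin> q" using integrally_closed[OF xc qD(2,3)] xB by blast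
  then show ?thesis using xc xq xB by blast
qed

text \<open>The ideal \<open>I + x I\<close> stays in \<open>B\<close> because
  \<open>I \<subseteq> q\<close>, and equality with \<open>I\<close> would put \<open>x\<close> into
  \<open>B\<close> by integral closedness. Its strict growth makes noetherian induction
  applicable.\<close>

lemma enlarge_ideal:
  assumes q: "q \<in> nonzero_primes S" and I: "ideal I S" "I \<noteq> {\<zero>}" "I \<subseteq> q"
    and x: "x \<in> carrier R" "\<And>y. y \<in> q \<Longrightarrow> x \<otimes> y \<in> B" "x \<notin> B"
  shows "ideal {u \<oplus> x \<otimes> v | u v. u \<in> I \<and> v \<in> I} S"
    and "I \<subset> {u \<oplus> x \<otimes> v | u v. u \<in> I \<and> v \<in> I}"
    and "\<And>v. v \<in> I \<Longrightarrow> x \<otimes> v \<in> {u \<oplus> x \<otimes> v | u v. u \<in> I \<and> v \<in> I}"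
proof -
  let ?J = "{u \<oplus> x \<otimes> v | u v. u \<in> I \<and> v \<in> I}"
  note ID = subring_idealD[OF I(1)]
  have Ic: "v \<in> I \<Longrightarrow> v \<in> carrier R" for v using ID B_carrier by auto
  show "ideal ?J S"
  proof (rule subring_idealI[OF B])
    show "?J \<subseteq> B" using ID(1) x(2) I(3) subringE(7)[OF B] by blast
    have "\<zero> = \<zero> \<oplus> x \<otimes> \<zero>" using x by simp
    then show "\<zero> \<in> ?J" using ID(2) by blast
  next
    fix y z assume "y \<in> ?J" "z \<in> ?J"
    then obtain u v u' v' where uv: "u \<in> I" "v \<in> I" "u' \<in> I" "v' \<in> I" "y = u \<oplus> x \<otimes> v" "z = u' \<oplus> x \<otimes> v'" by blast
    have "(u \<oplus> x \<otimes> v) \<oplus> (u' \<oplus> x \<otimes> v') = (u \<oplus> u') \<oplus> x \<otimes> (v \<oplus> v')" using uv(1-4)[THEN Ic] x(1) by algebra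
    then show "y \<oplus> z \<in> ?J" using uv ID(3) by blast
  next
    fix a y assume a: "a \<in> B" "y \<in> ?J"
    then obtain u v where uv: "u \<in> I" "v \<in> I" "y = u \<oplus> x \<otimes> v" by blast
    have "a \<otimes> (u \<oplus> x \<otimes> v) = (a \<otimes> u) \<oplus> x \<otimes> (a \<otimes> v)" using uv(1-2)[THEN Ic] x(1) B_carrier[OF a(1)] by algebra
    then show "a \<otimes> y \<in> ?J" using uv ID(4)[OF a(1)] by blast
  qed
  have sub: "I \<subseteq> ?J"
  proof
    fix u assume u: "u \<in> I"
    then have "u = u \<oplus> x \<otimes> \<zero>" using Ic x by simp
    then show "u \<in> ?J" using u ID(2) by blast
  qed
  show xJ: "x \<otimes> v \<in> ?J" if v: "v \<in> I" for v
  proof -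
    have "x \<otimes> v = \<zero> \<oplus> x \<otimes> v" using v Ic x by simp
    then show ?thesis using v ID(2) by blast
  qed
  have "I \<noteq> ?J" using integrally_closed[OF x(1) I(1,2)] x(3) xJ by blast
  then show "I \<subset> ?J" using sub by blast
qed

text \<open>Invertibility of \<open>I\<close> at the single prime \<open>q\<close>. If
  \<open>I \<subseteq> q\<close>, take a multiplier \<open>y\<close> for the larger ideal
  \<open>I + x I\<close>; should \<open>y\<close> send \<open>I\<close> into \<open>q\<close>, then
  \<open>y \<otimes> x\<close> does not.\<close>

lemma exists_multiplier_not_in_prime:
  assumes q: "q \<in> nonzero_primes S" and "ideal I S" "I \<noteq> {\<zero>}"
  shows "\<exists>y\<in>carrier R. (\<forall>m\<in>I. y \<otimes> m \<in> B) \<and> (\<exists>m\<in>I. y \<otimes> m \<notin> q)"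
  using assms(2,3)
proof (induction I rule: S.ideal_induct)
  case (step I)
  note ID = subring_idealD[OF step(1)]
  have Ic: "v \<in> I \<Longrightarrow> v \<in> carrier R" for v using ID B_carrier by auto
  show ?case
  proof (cases "I \<subseteq> q")
    case False
    then have "\<exists>m\<in>I. \<one> \<otimes> m \<notin> q" using Ic by force
    moreover have "\<forall>m\<in>I. \<one> \<otimes> m \<in> B" using Ic ID by force
    ultimately show ?thesis by blast
  next
    case True
    obtain x where x: "x \<in> carrier R" "\<And>y. y \<in> q \<Longrightarrow> x \<otimes> y \<in> B" "x \<notin> B"
      using prime_inverse_elt[OF q] by metis
    define J where "J = {u \<oplus> x \<otimes> v | u v. u \<in> I \<and> v \<in> I}"
    note J = enlarge_ideal[OF q step(1,3) True x, folded J_def]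
    have "J \<noteq> {\<zero>}" using J(2) ID(2) by blast
    then obtain y where y: "y \<in> carrier R" "\<forall>m\<in>J. y \<otimes> m \<in> B" "\<exists>m\<in>J. y \<otimes> m \<notin> q"
      using step(2)[OF J(1,2)] by blast
    have yI: "\<forall>m\<in>I. y \<otimes> m \<in> B" using y J(2) by blast
    show ?thesis
    proof (cases "\<exists>m\<in>I. y \<otimes> m \<notin> q")
      case True
      then show ?thesis using y yI by blast
    next
      case False
      obtain u v where uv: "u \<in> I" "v \<in> I" "y \<otimes> (u \<oplus> x \<otimes> v) \<notin> q" using y(3) unfolding J_def by blast
      have "y \<otimes> (u \<oplus> x \<otimes> v) = y \<otimes> u \<oplus> (y \<otimes> x) \<otimes> v" using uv(1,2)[THEN Ic] x y(1) by algebra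
      then have "(y \<otimes> x) \<otimes> v \<notin> q" using uv False subring_idealD(3)[OF nonzero_primesD(2)[OF q]] by metis
      moreover have "\<forall>m\<in>I. (y \<otimes> x) \<otimes> m \<in> B" using y J(3) x(1) Ic by (simp add: m_assoc)
      ultimately show ?thesis using y x uv by blast
    qed
  qed
qed

text \<open>A proper \<open>I\<close> lies in some maximal \<open>q\<close>, and
  \<open>I = q J\<close> for the strictly larger \<open>J = I + x I\<close>. The clause
  \<open>I \<subseteq> q\<close> is carried along because it passes what is known of primes
  containing \<open>I\<close> to the factors.\<close>

lemma ideal_factorization:
  assumes "ideal I S" "I \<noteq> {\<zero>}"
  shows "\<exists>T e. finite T \<and> T \<subseteq> nonzero_primes S \<and> (\<forall>q\<in>T. I \<subseteq> q \<and> (e q :: nat) \<ge> 1) \<and>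
    (\<Otimes>\<^bsub>ideals_set S\<^esub>q\<in>T. q [^]\<^bsub>ideals_set S\<^esub> e q) = I"
  using assms
proof (induction I rule: S.ideal_induct)
  case (step I)
  interpret M: comm_monoid "ideals_set S" by (rule S.ideals_set_is_comm_monoid)
  note ID = subring_idealD[OF step(1)]
  have Ic: "v \<in> I \<Longrightarrow> v \<in> carrier R" for v using ID B_carrier by auto
  show ?case
  proof (cases "I = carrier S")
    case True
    moreover have "\<one>\<^bsub>ideals_set S\<^esub> = carrier S" by (simp add: ideals_set_def)
    ultimately show ?thesis by (intro exI[of _ "{}"]) simp
  next
    case False
    then obtain q where q: "maximalideal q S" "I \<subseteq> q" using S.exists_maximalideal[OF step(1)] by blast
    have "q \<noteq> {\<zero>}" using q(2) step(3) ID(2) by auto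
    then have qp: "q \<in> nonzero_primes S" using S.maximalideal_prime[OF q(1)] unfolding nonzero_primes_def by auto
    note qD = nonzero_primesD[OF qp] and qI = subring_idealD[OF nonzero_primesD(2)[OF qp]]
    obtain x where x: "x \<in> carrier R" "\<And>y. y \<in> q \<Longrightarrow> x \<otimes> y \<in> B" "\<exists>y\<in>q. x \<otimes> y \<notin> q" "x \<notin> B"
      using prime_inverse_elt[OF qp] by metis
    define J where "J = {u \<oplus> x \<otimes> v | u v. u \<in> I \<and> v \<in> I}"
    note J = enlarge_ideal[OF qp step(1,3) q(2) x(1,2,4), folded J_def]
    have qc: "y \<in> q \<Longrightarrow> y \<in> carrier R" for y using qD(4) B_carrier by auto
    have "ideal_prod S q J = I"
    proof
      show "ideal_prod S q J \<subseteq> I"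
      proof
        fix z assume "z \<in> ideal_prod S q J"
        then show "z \<in> I"
        proof induction
          case (prod y j)
          from prod(2) obtain u v where uv: "u \<in> I" "v \<in> I" "j = u \<oplus> x \<otimes> v" unfolding J_def by auto
          have "u \<in> carrier R" "v \<in> carrier R" "y \<in> carrier R" using uv(1,2) Ic qc prod(1) by auto
          then have "y \<otimes> (u \<oplus> x \<otimes> v) = y \<otimes> u \<oplus> (x \<otimes> y) \<otimes> v" using x(1) by algebra
          moreover have "y \<otimes> u \<in> I" "(x \<otimes> y) \<otimes> v \<in> I" using ID(4) uv prod qD(4) x(2) by auto
          ultimately show ?case using ID(3) uv by simp
        qed (use ID(3) in simp)
      qed
      obtain y where y: "y \<in> q" "x \<otimes> y \<notin> q" using x(3) by blast
      obtain v where v: "v \<in> B" "v \<otimes> (x \<otimes> y) \<ominus>\<^bsub>S\<^esub> \<one> \<in> q"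
        using S.maximalideal_inverse[OF q(1), of "x \<otimes> y"] x(2) y by auto
      then have i: "v \<otimes> (x \<otimes> y) \<ominus> \<one> \<in> q"
        using subring_a_inv[OF B subringE(3)[OF B]] unfolding a_minus_def by simp
      show "I \<subseteq> ideal_prod S q J"
      proof
        fix w assume w: "w \<in> I"
        \<comment> \<open>Thus \<open>\<one> = i' \<oplus> v \<otimes> (x \<otimes> y)\<close>;
          multiplied by \<open>w\<close> it writes \<open>w\<close> as a sum of two products of an
          element of \<open>q\<close> with an element of \<open>J\<close>, since
          \<open>x \<otimes> w \<in> J\<close>.\<close>
        define i' where "i' = \<ominus> (v \<otimes> (x \<otimes> y) \<ominus> \<one>)"
        have c: "v \<in> carrier R" "y \<in> carrier R" "w \<in> carrier R" using v y qc w Ic B_carrier by auto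
        have "\<ominus> \<one> \<otimes> (v \<otimes> (x \<otimes> y) \<ominus> \<one>) \<in> q" using qI(4)[OF _ i] subringE(3,5)[OF B] by simp
        then have i': "i' \<in> q" unfolding i'_def using c x(1) by (simp add: l_minus)
        have "i' \<otimes> w \<oplus> (v \<otimes> y) \<otimes> (x \<otimes> w) = w" unfolding i'_def using c x(1) by algebra
        moreover have "i' \<otimes>\<^bsub>S\<^esub> w \<in> ideal_prod S q J" using i' w J(2) by (intro ideal_prod.prod) auto
        moreover have "(v \<otimes> y) \<otimes>\<^bsub>S\<^esub> (x \<otimes> w) \<in> ideal_prod S q J" using qI(4) v y w J(3) by (intro ideal_prod.prod) auto
        ultimately show "w \<in> ideal_prod S q J" using ideal_prod.sum[of "i' \<otimes> w" S q J "(v \<otimes> y) \<otimes> (x \<otimes> w)"] by simp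
      qed
    qed
    then have qJ: "q \<otimes>\<^bsub>ideals_set S\<^esub> J = I" by (simp add: ideals_set_def)
    have "J \<noteq> {\<zero>}" using J(2) ID(2) by blast
    then obtain T e where T: "finite T" "T \<subseteq> nonzero_primes S" "\<forall>q\<in>T. J \<subseteq> q \<and> (e q :: nat) \<ge> 1"
      "(\<Otimes>\<^bsub>ideals_set S\<^esub>q\<in>T. q [^]\<^bsub>ideals_set S\<^esub> e q) = J"
      using step(2)[OF J(1,2)] by blast
    have Mc: "p \<in> carrier (ideals_set S)" if "p \<in> nonzero_primes S" for p
      using nonzero_primesD(2)[OF that] by (simp add: ideals_set_def)
    \<comment> \<open>Multiplication by \<open>q\<close> raises an exponent already present and
      otherwise starts with 1, so all exponents stay positive.\<close>
    define e' where "e' = (\<lambda>p. if p = q then (if q \<in> T then Suc (e q) else 1) else e p)"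
    let ?F = "\<lambda>e T. \<Otimes>\<^bsub>ideals_set S\<^esub>q\<in>T. q [^]\<^bsub>ideals_set S\<^esub> (e q :: nat)"
    have Fc: "?F e (T - {q}) \<in> carrier (ideals_set S)" using Mc T(2) by (intro M.finprod_closed) auto
    have cong: "?F e' (T - {q}) = ?F e (T - {q})"
      by (rule M.finprod_cong') (use Mc T(2) in \<open>auto simp: e'_def\<close>)
    have ins: "?F d (insert q (T - {q})) = q [^]\<^bsub>ideals_set S\<^esub> (d q) \<otimes>\<^bsub>ideals_set S\<^esub> ?F d (T - {q})" for d
      by (rule M.finprod_insert) (use Mc T qp in auto)
    have "?F e' (insert q T) = I"
    proof (cases "q \<in> T")
      case True
      then have eq: "insert q (T - {q}) = T" by auto
      have "?F e' (insert q T) = ?F e' (insert q (T - {q}))" by (simp add: insert_absorb)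
      also have "\<dots> = q [^]\<^bsub>ideals_set S\<^esub> Suc (e q) \<otimes>\<^bsub>ideals_set S\<^esub> ?F e (T - {q})"
        unfolding ins cong using True by (simp add: e'_def)
      also have "\<dots> = q \<otimes>\<^bsub>ideals_set S\<^esub> (q [^]\<^bsub>ideals_set S\<^esub> (e q) \<otimes>\<^bsub>ideals_set S\<^esub> ?F e (T - {q}))"
        using Mc[OF qp] Fc M.nat_pow_closed[OF Mc[OF qp], of "e q"] by (simp add: M.m_ac)
      also have "\<dots> = q \<otimes>\<^bsub>ideals_set S\<^esub> ?F e T" unfolding ins[symmetric] eq ..
      finally show ?thesis using T(4) qJ by simp
    next
      case False
      then have "?F e' (insert q T) = ?F e' (insert q (T - {q}))" by simp
      also have "\<dots> = q [^]\<^bsub>ideals_set S\<^esub> (1::nat) \<otimes>\<^bsub>ideals_set S\<^esub> ?F e (T - {q})"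
        unfolding ins cong using False by (simp add: e'_def)
      also have "\<dots> = q \<otimes>\<^bsub>ideals_set S\<^esub> ?F e T"
        using False Mc[OF qp] by simp
      finally show ?thesis using T(4) qJ by simp
    qed
    moreover have "\<forall>p\<in>insert q T. I \<subseteq> p \<and> e' p \<ge> 1" using T(3) q(2) J(2) by (auto simp: e'_def)
    ultimately show ?thesis using T qp by (intro exI[of _ "insert q T"] exI[of _ e']) auto
  qed
qed

end

subsection \<open>Synthetic division, interpolation and simple roots\<close>

context cring
begin

text \<open>For \<open>a = \<zero>\<close> this is the coefficient list of \<open>(X - w) q + r\<close>; the argument \<open>a\<close>
  is the coefficient preceding \<open>q\<close>.\<close>

primrec lin_mult :: "'a \<Rightarrow> 'a \<Rightarrow> 'a \<Rightarrow> 'a list \<Rightarrow> 'a list" where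
  "lin_mult w r a [] = [r \<ominus> w \<otimes> a]"
| "lin_mult w r a (q # qs) = (q \<ominus> w \<otimes> a) # lin_mult w r q qs"

lemma length_lin_mult [simp]: "length (lin_mult w r a q) = Suc (length q)"
  by (induction q arbitrary: a) auto

lemma lin_mult_in_subring:
  assumes C: "subring C R" and "w \<in> C" "r \<in> C" "a \<in> C" "set q \<subseteq> C"
  shows "set (lin_mult w r a q) \<subseteq> C"
  using assms(4,5)
  by (induction q arbitrary: a) (use assms(2,3) subringE(5-7)[OF C] in \<open>auto simp: a_minus_def\<close>)

lemma lin_mult_carrier:
  "\<lbrakk>w \<in> carrier R; r \<in> carrier R; a \<in> carrier R; set q \<subseteq> carrier R\<rbrakk> \<Longrightarrow> set (lin_mult w r a q) \<subseteq> carrier R"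
  by (rule lin_mult_in_subring[OF carrier_is_subring])

lemma lin_mult_snoc: "lin_mult w r a (q @ [s]) = lin_mult w s a q @ [r \<ominus> w \<otimes> s]"
  by (induction q arbitrary: a) auto

lemma hd_lin_mult: "set q \<subseteq> carrier R \<Longrightarrow> q \<noteq> [] \<Longrightarrow> w \<in> carrier R \<Longrightarrow> hd (lin_mult w r \<zero> q) = hd q"
  by (cases q) (auto simp: a_minus_def)

text \<open>Synthetic division: the next quotient coefficient is
  \<open>b \<oplus> w \<otimes> a\<close>. The divisor is monic, so everything stays in
  \<open>C\<close>.\<close>

lemma exists_lin_mult:
  assumes C: "subring C R" and w: "w \<in> C" and "a \<in> C" "p \<noteq> []" "set p \<subseteq> C"
  shows "\<exists>r q. r \<in> C \<and> set q \<subseteq> C \<and> p = lin_mult w r a q"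
  using assms(3-)
proof (induction p arbitrary: a)
  case (Cons b p)
  have c: "a \<in> carrier R" "b \<in> carrier R" "w \<in> carrier R"
    using Cons w subringE(1)[OF C] by auto
  have b': "b \<oplus> w \<otimes> a \<in> C" using Cons w subringE(6,7)[OF C] by auto
  have e: "(b \<oplus> w \<otimes> a) \<ominus> w \<otimes> a = b" using c by algebra
  show ?case
  proof (cases "p = []")
    case True
    then have "b # p = lin_mult w (b \<oplus> w \<otimes> a) a []" using e by simp
    then show ?thesis using b' by (metis empty_subsetI list.set(1))
  next
    case False
    then obtain r q where rq: "r \<in> C" "set q \<subseteq> C" "p = lin_mult w r (b \<oplus> w \<otimes> a) q"
      using Cons(1)[OF b' False] Cons(4) by auto
    have "b # p = lin_mult w r a ((b \<oplus> w \<otimes> a) # q)" using e rq by simp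
    moreover have "set ((b \<oplus> w \<otimes> a) # q) \<subseteq> C" using rq b' by simp
    ultimately show ?thesis using rq(1) by blast
  qed
qed simp

text \<open>In the product of \<open>X - w\<close> with \<open>a # q\<close>, the top term with
  coefficient \<open>a\<close> is left out by \<open>lin_mult\<close>; the other contribution of
  \<open>a\<close> remains and is the last term here.\<close>

lemma eval_lin_mult:
  assumes "set q \<subseteq> carrier R" "w \<in> carrier R" "r \<in> carrier R" "a \<in> carrier R" "x \<in> carrier R"
  shows "eval (lin_mult w r a q) x = (x \<ominus> w) \<otimes> eval q x \<oplus> r \<ominus> w \<otimes> a \<otimes> x [^] length q"
  using assms(1,4)
proof (induction q arbitrary: a)
  case Nil
  then show ?case using assms by (simp add: a_minus_def)
next
  case (Cons b q)
  define E where "E = eval q x"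
  define P where "P = x [^] length q"
  have c: "E \<in> carrier R" "P \<in> carrier R" "a \<in> carrier R" "b \<in> carrier R"
    using Cons assms eval_in_carrier unfolding E_def P_def by auto
  have "eval (lin_mult w r a (b # q)) x = (b \<ominus> w \<otimes> a) \<otimes> (P \<otimes> x) \<oplus> ((x \<ominus> w) \<otimes> E \<oplus> r \<ominus> w \<otimes> b \<otimes> P)"
    using Cons c unfolding E_def P_def by simp
  also have "\<dots> = (x \<ominus> w) \<otimes> (b \<otimes> P \<oplus> E) \<oplus> r \<ominus> w \<otimes> a \<otimes> (P \<otimes> x)"
    using c assms by algebra
  finally show ?case unfolding E_def P_def by simp
qed

lemma eval_lin_mult_0:
  assumes "set q \<subseteq> carrier R" "w \<in> carrier R" "r \<in> carrier R" "x \<in> carrier R"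
  shows "eval (lin_mult w r \<zero> q) x = (x \<ominus> w) \<otimes> eval q x \<oplus> r"
  using eval_lin_mult[OF assms(1-3) _ assms(4), of \<zero>] assms eval_in_carrier[of q x]
  by (simp add: a_minus_def)

lemma root_imp_lin_mult:
  assumes C: "subring C R" and w: "w \<in> C" and p: "p \<noteq> []" "set p \<subseteq> C" and root: "eval p w = \<zero>"
  shows "\<exists>q. set q \<subseteq> C \<and> p = lin_mult w \<zero> \<zero> q"
proof -
  obtain r q where rq: "r \<in> C" "set q \<subseteq> C" "p = lin_mult w r \<zero> q"
    using exists_lin_mult[OF C w subringE(2)[OF C] p] by blast
  have c: "set q \<subseteq> carrier R" "w \<in> carrier R" "r \<in> carrier R" using rq w subringE(1)[OF C] by auto
  then have "eval p w = r" using eval_lin_mult_0[OF c c(2)] eval_in_carrier[of q w] rq(3) by (simp add: r_neg a_minus_def)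
  then have "r = \<zero>" using root by simp
  then have "p = lin_mult w \<zero> \<zero> q" using rq(3) by simp
  then show ?thesis using rq(2) by metis
qed

text \<open>For the induction, \<open>b\<close> and \<open>a\<close> stand for the two coefficients
  preceding \<open>q\<close>; the inner multiplication passes
  \<open>a \<ominus> v \<otimes> b\<close>, respectively \<open>a \<ominus> w \<otimes> b\<close>,
  to the outer one.\<close>

lemma lin_mult_commute:
  assumes "set q \<subseteq> carrier R" "w \<in> carrier R" "v \<in> carrier R" "a \<in> carrier R" "b \<in> carrier R"
  shows "lin_mult w \<zero> (a \<ominus> v \<otimes> b) (lin_mult v \<zero> a q) = lin_mult v \<zero> (a \<ominus> w \<otimes> b) (lin_mult w \<zero> a q)"
  using assms(1,4,5)
proof (induction q arbitrary: a b)
  case Nil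
  have "\<zero> \<ominus> v \<otimes> a \<ominus> w \<otimes> (a \<ominus> v \<otimes> b) = \<zero> \<ominus> w \<otimes> a \<ominus> v \<otimes> (a \<ominus> w \<otimes> b)"
    "\<zero> \<ominus> w \<otimes> (\<zero> \<ominus> v \<otimes> a) = \<zero> \<ominus> v \<otimes> (\<zero> \<ominus> w \<otimes> a)"
    using Nil assms by algebra+
  then show ?case by simp
next
  case (Cons c q)
  have "c \<ominus> v \<otimes> a \<ominus> w \<otimes> (a \<ominus> v \<otimes> b) = c \<ominus> w \<otimes> a \<ominus> v \<otimes> (a \<ominus> w \<otimes> b)"
    using Cons(2-) assms by (simp, algebra)
  then show ?case using Cons by simp
qed

lemma lin_mult_commute_0:
  assumes "set q \<subseteq> carrier R" "w \<in> carrier R" "v \<in> carrier R"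
  shows "lin_mult w \<zero> \<zero> (lin_mult v \<zero> \<zero> q) = lin_mult v \<zero> \<zero> (lin_mult w \<zero> \<zero> q)"
  using lin_mult_commute[OF assms, of \<zero> \<zero>] assms by (simp add: a_minus_def)

text \<open>On coefficient lists before normalization this is the rule
  \<open>(X p + c)' = X p' + p\<close>.\<close>

lemma formal_deriv_snoc:
  assumes p: "set p \<subseteq> carrier R" "p \<noteq> []"
  defines "D \<equiv> \<lambda>p. map (\<lambda>i. add_pow R (Suc i) (coeff p (Suc i))) (rev [0..<length p - 1])"
  shows "D (p @ [c]) = map2 (\<oplus>) (D p @ [\<zero>]) p"
proof -
  obtain n where n: "length p = Suc n" using p(2) by (cases p) auto
  have 1: "D (p @ [c]) = map (\<lambda>i. add_pow R (Suc i) (coeff p i)) (rev [0..<Suc n])"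
    unfolding D_def using n by (simp add: append_coeff)
  have r: "rev [0..<Suc n] = map Suc (rev [0..<n]) @ [0]"
    by (simp add: rev_map[symmetric] map_Suc_upt upt_conv_Cons del: upt_Suc)
  have 2: "D p @ [\<zero>] = map (\<lambda>i. add_pow R i (coeff p i)) (rev [0..<Suc n])"
    unfolding D_def r using n by (simp add: comp_def)
  have 3: "p = map (coeff p) (rev [0..<Suc n])" using coeff_list[of p] n by simp
  have "map2 (\<oplus>) (D p @ [\<zero>]) p = map2 (\<oplus>) (map (\<lambda>i. add_pow R i (coeff p i)) (rev [0..<Suc n])) (map (coeff p) (rev [0..<Suc n]))"
    using 2 3 by simp
  also have "\<dots> = map (\<lambda>i. add_pow R i (coeff p i) \<oplus> coeff p i) (rev [0..<Suc n])"
    by (simp only: map2_map_map)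
  also have "\<dots> = D (p @ [c])" unfolding 1 by (simp add: add_pow_def)
  finally show ?thesis by simp
qed

text \<open>The cofactor of \<open>X - w\<close> computes the derivative at \<open>w\<close>.
  Removing the last coefficient of \<open>q @ [s]\<close> turns the remainder into \<open>s\<close>,
  hence the induction keeps \<open>r\<close> arbitrary.\<close>

lemma eval_formal_deriv:
  assumes "set q \<subseteq> carrier R" "w \<in> carrier R" "r \<in> carrier R"
  shows "eval (formal_deriv R (lin_mult w r \<zero> q)) w = eval q w"
proof -
  define D where "D = (\<lambda>p. map (\<lambda>i. add_pow R (Suc i) (coeff p (Suc i))) (rev [0..<length p - 1]))"
  have Dc: "set (D p) \<subseteq> carrier R" if "set p \<subseteq> carrier R" for p
    using that unfolding D_def by auto
  have "eval (D (lin_mult w r \<zero> q)) w = eval q w"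
    using assms
  proof (induction q arbitrary: r rule: rev_induct)
    case Nil
    then show ?case by (simp add: D_def)
  next
    case (snoc s q)
    let ?p = "lin_mult w s \<zero> q"
    have c: "set q \<subseteq> carrier R" "s \<in> carrier R" "w \<in> carrier R" using snoc by auto
    have pc: "set ?p \<subseteq> carrier R" using lin_mult_carrier c by simp
    have pn: "?p \<noteq> []" by (metis length_0_conv length_lin_mult nat.distinct(1))
    have "D (lin_mult w r \<zero> (q @ [s])) = map2 (\<oplus>) (D ?p @ [\<zero>]) ?p"
      unfolding lin_mult_snoc D_def by (rule formal_deriv_snoc[OF pc pn])
    moreover have "length (D ?p @ [\<zero>]) = length ?p" by (simp add: D_def)
    ultimately have "eval (D (lin_mult w r \<zero> (q @ [s]))) w = eval (D ?p @ [\<zero>]) w \<oplus> eval ?p w"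
      using eval_map2_add[of "D ?p @ [\<zero>]" ?p w] pc Dc[OF pc] c by simp
    also have "eval (D ?p @ [\<zero>]) w = eval (D ?p) w \<otimes> w"
      using eval_append_aux[OF Dc[OF pc], of \<zero> w] eval_in_carrier[OF Dc[OF pc]] c by simp
    also have "eval (D ?p) w = eval q w" using snoc c by simp
    also have "eval ?p w = s" using eval_lin_mult_0[OF c(1,3,2,3)] eval_in_carrier[of q w] c by (simp add: r_neg a_minus_def)
    finally show ?case using eval_append_aux[OF c(1,2,3)] by simp
  qed
  moreover have "eval (formal_deriv R p) w = eval (D p) w" if "set p \<subseteq> carrier R" for p
    unfolding formal_deriv_def using eval_normalize[OF Dc[OF that] assms(2)] unfolding D_def .
  ultimately show ?thesis using lin_mult_carrier[OF assms(2,3) _ assms(1), of \<zero>] by simp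
qed

end

lemma (in domain) formal_deriv_carrier:
  assumes K: "subring K R" and "set p \<subseteq> K"
  shows "formal_deriv R p \<in> carrier (K[X])"
proof -
  have pow: "add_pow R n a \<in> K" if "a \<in> K" for n :: nat and a
    by (induction n) (use that subringE(2,7)[OF K] in \<open>auto simp: add_pow_def\<close>)
  have "range (coeff p) \<subseteq> K"
    unfolding coeff_img(3) using assms(2) subringE(2)[OF K] by simp
  then have ci: "coeff p i \<in> K" for i by blast
  have "set (map (\<lambda>i. add_pow R (Suc i) (coeff p (Suc i))) (rev [0..<length p - 1])) \<subseteq> K"
    using pow[OF ci] by (auto simp del: add.nat_pow_Suc)
  then show ?thesis unfolding formal_deriv_def univ_poly_carrier[symmetric]
    by (rule normalize_gives_polynomial)
qed

text \<open>Otherwise the derivative vanishes at \<open>y\<close>, so the minimal polynomial divides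
  it and is a common divisor that is not a unit.\<close>

lemma (in domain) separable_simple_root:
  assumes K: "subfield K R" and y: "y \<in> carrier R" "(algebraic over K) y"
    and sep: "separable_poly R K (Irr K y)"
    and q: "set q \<subseteq> carrier R" "Irr K y = lin_mult y \<zero> \<zero> q"
  shows "eval q y \<noteq> \<zero>"
proof
  assume "eval q y = \<zero>"
  note irr = IrrE[OF K y]
  have KR: "subring K R" using subfieldE(1)[OF K] .
  have pK: "set (Irr K y) \<subseteq> K" using irr(1) polynomial_incl unfolding univ_poly_carrier[symmetric] by blast
  have D: "formal_deriv R (Irr K y) \<in> carrier (K[X])" by (rule formal_deriv_carrier[OF KR pK])
  have "eval (formal_deriv R (Irr K y)) y = \<zero>"
    unfolding q(2) using eval_formal_deriv[OF q(1) y(1), of \<zero>] \<open>eval q y = \<zero>\<close> by simp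
  then have "Irr K y pdivides formal_deriv R (Irr K y)" by (rule Irr_minimal[OF K y D])
  then have "Irr K y divides\<^bsub>K[X]\<^esub> formal_deriv R (Irr K y)"
    unfolding pdivides_iff_shell[OF K irr(1) D] .
  moreover have "Irr K y divides\<^bsub>K[X]\<^esub> Irr K y"
    by (rule monoid.divides_refl[OF ring.is_monoid[OF univ_poly_is_ring[OF KR]] irr(1)])
  ultimately have "Irr K y \<in> Units (K[X])" using sep irr(1) unfolding separable_poly_def by blast
  then show False using irr(2) unfolding ring_irreducible_def irreducible_def by simp
qed

lemma (in algebraically_closed) exists_root:
  assumes p: "set p \<subseteq> carrier L" "hd p \<noteq> \<zero>" "length p \<ge> 2"
  shows "\<exists>w\<in>carrier L. eval p w = \<zero>"
proof -
  have "p \<in> carrier (poly_ring L)" using p unfolding univ_poly_carrier[symmetric] by (intro polynomialI) auto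
  then have "size (roots p) = degree p" "p \<in> carrier (poly_ring L)" using roots_over_carrier[of p] unfolding splitted_def by auto
  then have "roots p \<noteq> {#}" using p(3) by auto
  then obtain w where "w \<in># roots p" by blast
  then have "is_root p w" using roots_mem_iff_is_root[OF \<open>p \<in> carrier (poly_ring L)\<close>] by simp
  then show ?thesis unfolding is_root_def by auto
qed

text \<open>If \<open>p\<close> has roots \<open>w\<^sub>1, \<dots>, w\<^sub>n\<close> then \<open>g\<close> is its Lagrange interpolation
  \<open>\<Sum>i c\<^sub>i \<Prod>j\<noteq>i (X - w\<^sub>j)\<close>, where \<open>g(w\<^sub>i) = c\<^sub>i p'(w\<^sub>i)\<close>.\<close>

lemma (in algebraically_closed) interpolation_in_subring:
  assumes C: "subring C L"
    and "set p \<subseteq> carrier L" "p \<noteq> []" "hd p = \<one>" "set g \<subseteq> carrier L" "length p = Suc (length g)"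
    and "\<And>w. w \<in> carrier L \<Longrightarrow> eval p w = \<zero> \<Longrightarrow> w \<in> C"
    and "\<And>w q. w \<in> carrier L \<Longrightarrow> set q \<subseteq> carrier L \<Longrightarrow> p = lin_mult w \<zero> \<zero> q \<Longrightarrow>
      eval q w \<noteq> \<zero> \<and> (\<exists>c\<in>C. eval g w = c \<otimes> eval q w)"
  shows "set p \<subseteq> C \<and> set g \<subseteq> C"
  using assms(2-)
proof (induction "length g" arbitrary: p g)
  case 0
  then show ?case using subringE(3)[OF C] by (cases p) auto
next
  case (Suc n)
  note pc = Suc(3) and gc = Suc(6) and rootC = Suc(8) and simple = Suc(9)
  have len: "length p = Suc (Suc n)" using Suc by simp
  obtain w where w: "w \<in> carrier L" "eval p w = \<zero>" using exists_root[of p] Suc(3-5) len by auto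
  obtain q where q: "set q \<subseteq> carrier L" "p = lin_mult w \<zero> \<zero> q"
    using root_imp_lin_mult[OF carrier_is_subring w(1) Suc(4) pc w(2)] by blast
  have lq: "length q = Suc n" using len q(2) by simp
  then have qn: "q \<noteq> []" by auto
  have hq: "hd q = \<one>" using hd_lin_mult[OF q(1) qn w(1), of \<zero>] q(2) Suc(5) by simp
  have wC: "w \<in> C" using rootC w by blast
  obtain c where c: "c \<in> C" "eval g w = c \<otimes> eval q w" "eval q w \<noteq> \<zero>" using simple[OF w(1) q] by blast
  have cc: "c \<in> carrier L" using c subringE(1)[OF C] by auto
  \<comment> \<open>Subtracting \<open>c\<close> times \<open>q\<close> makes \<open>g\<close>
    vanish at \<open>w\<close>. Dividing by \<open>X - w\<close> gives \<open>h\<close>, and the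
    pair \<open>q\<close>, \<open>h\<close> has one root less, with the same ratios at the remaining
    roots.\<close>
  define g' where "g' = map2 (\<oplus>) g (map ((\<otimes>) (\<ominus> c)) q)"
  have lg: "length g = length (map ((\<otimes>) (\<ominus> c)) q)" "length g' = Suc n" using Suc(2) lq by (auto simp: g'_def)
  have mc: "set (map ((\<otimes>) (\<ominus> c)) q) \<subseteq> carrier L" using q cc by auto
  have g'c: "set g' \<subseteq> carrier L"
  proof
    fix z assume "z \<in> set g'"
    then obtain a x where "a \<in> set g" "x \<in> set q" "z = a \<oplus> \<ominus> c \<otimes> x" unfolding g'_def by (auto elim!: in_set_zipE)
    moreover have "a \<in> carrier L" "x \<in> carrier L" using calculation gc q(1) by auto
    ultimately show "z \<in> carrier L" using cc by simp
  qed
  have g'_eval: "eval g' x = eval g x \<oplus> \<ominus> c \<otimes> eval q x" if "x \<in> carrier L" for x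
    unfolding g'_def using eval_map2_add[OF lg(1) gc mc that] eval_map_mult[OF q(1) that, of "\<ominus> c"] cc by simp
  have "eval g' w = \<zero>" using g'_eval[OF w(1)] c(2) cc eval_in_carrier[OF q(1) w(1)] by (simp add: l_minus r_neg)
  moreover have "g' \<noteq> []" using lg(2) by auto
  ultimately obtain h where h: "set h \<subseteq> carrier L" "g' = lin_mult w \<zero> \<zero> h"
    using root_imp_lin_mult[OF carrier_is_subring w(1) _ g'c] by blast
  have lh: "n = length h" using lg(2) h(2) by simp
  have "set q \<subseteq> C \<and> set h \<subseteq> C"
  proof (rule Suc(1)[OF lh q(1) qn hq h(1)])
    show "length q = Suc (length h)" using lq lh by simp
    fix v assume v: "v \<in> carrier L"
    show "v \<in> C" if "eval q v = \<zero>"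
      using rootC[OF v] eval_lin_mult_0[OF q(1) w(1) _ v, of \<zero>] q(2) that v w by simp
    fix s assume s: "set s \<subseteq> carrier L" "q = lin_mult v \<zero> \<zero> s"
    have ps: "p = lin_mult v \<zero> \<zero> (lin_mult w \<zero> \<zero> s)"
      unfolding q(2) s(2) by (rule lin_mult_commute_0[OF s(1) w(1) v])
    have sc: "set (lin_mult w \<zero> \<zero> s) \<subseteq> carrier L" using lin_mult_carrier w(1) s by simp
    obtain d where d: "d \<in> C" "eval g v = d \<otimes> eval (lin_mult w \<zero> \<zero> s) v" "eval (lin_mult w \<zero> \<zero> s) v \<noteq> \<zero>"
      using simple[OF v sc ps] by blast
    have ec: "eval s v \<in> carrier L" "eval h v \<in> carrier L" "d \<in> carrier L" "eval g v \<in> carrier L"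
      using eval_in_carrier[OF s(1) v] eval_in_carrier[OF h(1) v] eval_in_carrier[OF gc v] d(1) subringE(1)[OF C] by blast+
    have ls: "eval (lin_mult w \<zero> \<zero> s) v = (v \<ominus> w) \<otimes> eval s v"
      using eval_lin_mult_0[OF s(1) w(1) _ v, of \<zero>] v w ec by simp
    have vw: "v \<ominus> w \<in> carrier L" using v w by simp
    have "(v \<ominus> w) \<otimes> eval s v \<noteq> \<zero>" using d(3) ls by metis
    \<comment> \<open>Simplicity of the root \<open>v\<close> of \<open>p\<close> separates it from
      the root \<open>w\<close> already removed, so \<open>v \<ominus> w\<close> can be
      cancelled.\<close>
    then have s0: "eval s v \<noteq> \<zero>" "v \<ominus> w \<noteq> \<zero>" using l_null[OF ec(1)] r_null[OF vw] by metis+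
    have "eval q v = \<zero>" unfolding s(2) using eval_lin_mult_0[OF s(1) v _ v, of \<zero>] ec v by (simp add: r_neg a_minus_def)
    then have "eval g' v = eval g v" using g'_eval[OF v] ec cc by simp
    moreover have "eval g' v = (v \<ominus> w) \<otimes> eval h v"
      unfolding h(2) using eval_lin_mult_0[OF h(1) w(1) _ v, of \<zero>] v w ec by simp
    ultimately have "(v \<ominus> w) \<otimes> eval h v = (v \<ominus> w) \<otimes> (d \<otimes> eval s v)"
      using d(2) ls ec v w by (simp add: m_lcomm)
    then have "eval h v = d \<otimes> eval s v" using m_lcancel[OF s0(2) vw ec(2)] ec by simp
    then show "eval s v \<noteq> \<zero> \<and> (\<exists>c\<in>C. eval h v = c \<otimes> eval s v)" using s0 d by blast
  qed
  then have qC: "set q \<subseteq> C" and hC: "set h \<subseteq> C" by auto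
  have pC: "set p \<subseteq> C" unfolding q(2) using lin_mult_in_subring[OF C wC _ _ qC] subringE(2)[OF C] by simp
  have g'C: "set g' \<subseteq> C" unfolding h(2) using lin_mult_in_subring[OF C wC _ _ hC] subringE(2)[OF C] by simp
  have "g = map2 (\<oplus>) g' (map ((\<otimes>) c) q)"
  proof (rule nth_equalityI)
    show "length g = length (map2 (\<oplus>) g' (map ((\<otimes>) c) q))" using lg lq Suc(2) by simp
    fix i assume i: "i < length g"
    then have "g ! i \<in> carrier L" "q ! i \<in> carrier L" using gc q(1) Suc(2) lq by (auto simp: subset_code)
    then have "(g ! i \<oplus> \<ominus> c \<otimes> q ! i) \<oplus> c \<otimes> q ! i = g ! i" using cc by algebra
    moreover have "i < Suc n" "length g = Suc n" using i Suc(2) by simp_all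
    ultimately show "g ! i = map2 (\<oplus>) g' (map ((\<otimes>) c) q) ! i" using lq unfolding g'_def by simp
  qed
  moreover have "set (map2 (\<oplus>) g' (map ((\<otimes>) c) q)) \<subseteq> C"
  proof
    fix z assume "z \<in> set (map2 (\<oplus>) g' (map ((\<otimes>) c) q))"
    then obtain a x where ax: "a \<in> set g'" "x \<in> set q" "z = a \<oplus> c \<otimes> x" by (auto elim!: in_set_zipE)
    then have "a \<in> C" "c \<otimes> x \<in> C" using g'C qC subringE(6)[OF C c(1)] by blast+
    then show "z \<in> C" unfolding ax(3) by (rule subringE(7)[OF C])
  qed
  ultimately show ?case using pC by simp
qed

subsection \<open>Embeddings into an algebraic closure\<close>

lemma map_lin_mult:
  assumes "cring R" "cring S" "h \<in> ring_hom R S"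
    and "w \<in> carrier R" "r \<in> carrier R" "a \<in> carrier R" "set q \<subseteq> carrier R"
  shows "map h (cring.lin_mult R w r a q) = cring.lin_mult S (h w) (h r) (h a) (map h q)"
proof -
  interpret R: cring R by fact
  interpret S: cring S by fact
  interpret h: ring_hom_ring R S h by (rule ring_hom_ringI2[OF R.ring_axioms S.ring_axioms assms(3)])
  show ?thesis using assms(4-)
    by (induction q arbitrary: a) (auto simp: a_minus_def)
qed

lemma (in cring) lin_mult_inject:
  assumes "lin_mult w r a q = lin_mult w r a q'" "set q \<subseteq> carrier R" "set q' \<subseteq> carrier R"
    "w \<in> carrier R" "a \<in> carrier R"
  shows "q = q'"
  using assms
proof (induction q arbitrary: a q')
  case Nil
  have "length q' = 0" using arg_cong[OF Nil(1), of length] by simp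
  then show ?case by simp
next
  case (Cons b q)
  obtain c p where q': "q' = c # p" using arg_cong[OF Cons(2), of length] by (cases q') auto
  have c: "b \<in> carrier R" "c \<in> carrier R" using Cons(3,4) q' by auto
  have e: "b \<ominus> w \<otimes> a = c \<ominus> w \<otimes> a" "lin_mult w r b q = lin_mult w r c p" using Cons(2) q' by auto
  have "b = (b \<ominus> w \<otimes> a) \<oplus> w \<otimes> a" "c = (c \<ominus> w \<otimes> a) \<oplus> w \<otimes> a" using c Cons(5,6) by algebra+
  then have bc: "b = c" using e(1) by simp
  have "q = p" by (rule Cons(1)[of b]) (use e(2) bc Cons(3-5) q' c in auto)
  then show ?case using bc q' by simp
qed

text \<open>The bridge to the polynomial ring, a domain in which the factor \<open>X - w\<close> can
  be cancelled.\<close>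

lemma (in domain) lin_mult_eq_mult:
  assumes w: "w \<in> carrier R" and q: "q \<in> carrier (poly_ring R)" "q \<noteq> []"
  shows "lin_mult w \<zero> \<zero> q = [\<one>, \<ominus> w] \<otimes>\<^bsub>poly_ring R\<^esub> q"
proof -
  have qc: "set q \<subseteq> carrier R" and qh: "hd q \<noteq> \<zero>"
    using q polynomial_incl[of "carrier R" q] unfolding univ_poly_carrier[symmetric] polynomial_def by auto
  have wq: "set (map ((\<otimes>) (\<ominus> w)) q) \<subseteq> carrier R" using qc w by auto
  have q0: "set (q @ [\<zero>]) \<subseteq> carrier R" using qc by auto
  have id: "map ((\<otimes>) \<one>) q = q" using qc by (induction q) auto
  have 1: "lin_mult w \<zero> a q = map2 (\<oplus>) (q @ [\<zero>]) (map ((\<otimes>) (\<ominus> w)) (a # q))" if "a \<in> carrier R" for a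
    using qc that
    by (induction q arbitrary: a) (use w in \<open>auto simp: a_minus_def l_minus\<close>)
  have "poly_mult [\<ominus> w] q = normalize (map ((\<otimes>) (\<ominus> w)) q)"
    using poly_add_zero'(1)[OF wq] by simp
  then have "poly_mult [\<one>, \<ominus> w] q = poly_add (q @ [\<zero>]) (normalize (map ((\<otimes>) (\<ominus> w)) q))"
    using id by simp
  also have "\<dots> = poly_add (q @ [\<zero>]) (map ((\<otimes>) (\<ominus> w)) q)"
    using poly_add_normalize(2)[OF q0 wq] by simp
  also have "\<dots> = normalize (map2 (\<oplus>) (q @ [\<zero>]) (map ((\<otimes>) (\<ominus> w)) (\<zero> # q)))"
    using w by simp
  also have "\<dots> = normalize (lin_mult w \<zero> \<zero> q)" using 1[of \<zero>] by simp
  also have "\<dots> = lin_mult w \<zero> \<zero> q"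
  proof -
    have "hd (lin_mult w \<zero> \<zero> q) \<noteq> \<zero>" using hd_lin_mult[OF qc q(2) w] qh by simp
    moreover have "lin_mult w \<zero> \<zero> q \<noteq> []" by (metis length_0_conv length_lin_mult nat.distinct(1))
    ultimately show ?thesis by (metis list.exhaust_sel normalize.simps(2))
  qed
  finally show ?thesis by (simp add: univ_poly_mult)
qed

text \<open>Inside the algebraic closure, integrality is taken over the image of \<open>A\<close>;
  that the integral elements form a subring depends on this image being noetherian.\<close>

lemma noetherian_ring_image:
  assumes "cring R" "cring S" "h \<in> ring_hom R S" "inj_on h (carrier R)" "subring A R"
    and noeth: "noetherian_ring (R\<lparr>carrier := A\<rparr>)"
  shows "noetherian_ring (S\<lparr>carrier := h ` A\<rparr>)"
proof -
  interpret R: cring R by fact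
  interpret S: cring S by fact
  interpret h: ring_hom_ring R S h by (rule ring_hom_ringI2[OF R.ring_axioms S.ring_axioms assms(3)])
  interpret N: noetherian_ring "R\<lparr>carrier := A\<rparr>" by fact
  note AE = subringE[OF assms(5)]
  have hA: "subring (h ` A) S" by (rule h.img_is_subring[OF assms(5)])
  interpret T: ring "S\<lparr>carrier := h ` A\<rparr>" by (rule S.subring_is_ring[OF hA])
  have preimage: "ideal {a \<in> A. h a \<in> J} (R\<lparr>carrier := A\<rparr>)" if J: "ideal J (S\<lparr>carrier := h ` A\<rparr>)" for J
  proof -
    note JD = S.subring_idealD[OF J]
    show ?thesis
    proof (rule R.subring_idealI[OF assms(5)])
      show "{a \<in> A. h a \<in> J} \<subseteq> A" by blast
      show "\<zero>\<^bsub>R\<^esub> \<in> {a \<in> A. h a \<in> J}" using AE(2) JD(2) by simp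
    next
      fix x y assume xy: "x \<in> {a \<in> A. h a \<in> J}" "y \<in> {a \<in> A. h a \<in> J}"
      then have "x \<in> carrier R" "y \<in> carrier R" using AE(1) by blast+
      then have "h (x \<oplus>\<^bsub>R\<^esub> y) = h x \<oplus>\<^bsub>S\<^esub> h y" by simp
      then show "x \<oplus>\<^bsub>R\<^esub> y \<in> {a \<in> A. h a \<in> J}" using xy AE(7) JD(3) by simp
    next
      fix a x assume ax: "a \<in> A" "x \<in> {a \<in> A. h a \<in> J}"
      then have "x \<in> carrier R" "a \<in> carrier R" using AE(1) by blast+
      then have "h (a \<otimes>\<^bsub>R\<^esub> x) = h a \<otimes>\<^bsub>S\<^esub> h x" by simp
      then show "a \<otimes>\<^bsub>R\<^esub> x \<in> {a \<in> A. h a \<in> J}" using ax AE(6) JD(4) by simp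
    qed
  qed
  show ?thesis
  proof (rule T.noetherian_ringI)
    fix J assume J: "ideal J (S\<lparr>carrier := h ` A\<rparr>)"
    obtain W where W: "W \<subseteq> A" "finite W" "{a \<in> A. h a \<in> J} = Idl\<^bsub>R\<lparr>carrier := A\<rparr>\<^esub> W"
      using N.finetely_gen[OF preimage[OF J]] by auto
    have hW: "h ` W \<subseteq> carrier (S\<lparr>carrier := h ` A\<rparr>)" using W(1) by auto
    have WJ: "h ` W \<subseteq> J" using N.genideal_self[of W] W by auto
    let ?G = "Idl\<^bsub>S\<lparr>carrier := h ` A\<rparr>\<^esub> (h ` W)"
    have "Idl\<^bsub>R\<lparr>carrier := A\<rparr>\<^esub> W \<subseteq> {a \<in> A. h a \<in> ?G}"
      by (rule N.genideal_minimal[OF preimage[OF T.genideal_ideal[OF hW]]]) (use W(1) T.genideal_self[OF hW] in auto)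
    then have le: "{a \<in> A. h a \<in> J} \<subseteq> {a \<in> A. h a \<in> ?G}" using W(3) by simp
    have "J \<subseteq> ?G"
    proof
      fix x assume x: "x \<in> J"
      then obtain a where "a \<in> A" "x = h a" using S.subring_idealD(1)[OF J] by blast
      then show "x \<in> ?G" using le x by blast
    qed
    then have "J = ?G" using T.genideal_minimal[OF J WJ] by auto
    then show "\<exists>A'\<subseteq>carrier (S\<lparr>carrier := h ` A\<rparr>). finite A' \<and> J = Idl\<^bsub>S\<lparr>carrier := h ` A\<rparr>\<^esub> A'"
      using hW W(2) by blast
  qed
qed

locale closure_embedding = field R + M: algebraically_closed M for R (structure) and M (structure) +
  fixes i
  assumes hom: "i \<in> ring_hom R M"
begin

sublocale i: ring_hom_ring R M i
  by (rule ring_hom_ringI2[OF ring_axioms M.ring_axioms hom])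

lemma inj: "inj_on i (carrier R)"
proof -
  have "i \<one> \<noteq> \<zero>\<^bsub>M\<^esub>" using M.one_not_zero by simp
  then have "i ` carrier R \<noteq> {\<zero>\<^bsub>M\<^esub>}" using one_closed by blast
  then show ?thesis by (rule i.non_trivial_field_hom_imp_inj[OF field_axioms])
qed

abbreviation conj_eval :: "'c \<Rightarrow> 'a list \<Rightarrow> 'c" where
  "conj_eval w p \<equiv> M.eval (map i p) w"

lemma map_carrier: "set p \<subseteq> carrier R \<Longrightarrow> set (map i p) \<subseteq> carrier M"
  by auto

lemma conj_eval_add:
  assumes "set p \<subseteq> carrier R" "set q \<subseteq> carrier R" "w \<in> carrier M"
  shows "conj_eval w (poly_add p q) = conj_eval w p \<oplus>\<^bsub>M\<^esub> conj_eval w q"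
proof -
  have "conj_eval w (poly_add p q) = M.eval (M.normalize (map i (poly_add p q))) w"
    using M.eval_normalize[OF map_carrier[OF poly_add_in_carrier[OF assms(1,2)]] assms(3)] by simp
  also have "\<dots> = M.eval (M.poly_add (map i p) (map i q)) w"
    unfolding i.poly_add_hom'[OF assms(1,2)] ..
  also have "\<dots> = conj_eval w p \<oplus>\<^bsub>M\<^esub> conj_eval w q"
    by (rule M.eval_poly_add[OF map_carrier[OF assms(1)] map_carrier[OF assms(2)] assms(3)])
  finally show ?thesis .
qed

lemma conj_eval_mult:
  assumes "set p \<subseteq> carrier R" "set q \<subseteq> carrier R" "w \<in> carrier M"
  shows "conj_eval w (poly_mult p q) = conj_eval w p \<otimes>\<^bsub>M\<^esub> conj_eval w q"
proof -
  have "conj_eval w (poly_mult p q) = M.eval (M.normalize (map i (poly_mult p q))) w"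
    using M.eval_normalize[OF map_carrier[OF poly_mult_in_carrier[OF assms(1,2)]] assms(3)] by simp
  also have "\<dots> = M.eval (M.poly_mult (map i p) (map i q)) w"
    unfolding i.poly_mult_hom'[OF assms(1,2)] ..
  also have "\<dots> = conj_eval w p \<otimes>\<^bsub>M\<^esub> conj_eval w q"
    by (rule M.eval_poly_mult[OF map_carrier[OF assms(1)] map_carrier[OF assms(2)] assms(3)])
  finally show ?thesis .
qed

lemma conj_eval_vanish:
  assumes F: "subfield F R" and y: "y \<in> carrier R" "(algebraic over F) y"
    and w: "w \<in> carrier M" "conj_eval w (Irr F y) = \<zero>\<^bsub>M\<^esub>"
    and p: "p \<in> carrier (F[X])" "eval p y = \<zero>"
  shows "conj_eval w p = \<zero>\<^bsub>M\<^esub>"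
proof -
  have "Irr F y pdivides p" by (rule Irr_minimal[OF F y p])
  then obtain q where q: "q \<in> carrier (poly_ring R)" "p = poly_mult (Irr F y) q"
    unfolding pdivides_def factor_def univ_poly_mult by auto
  have c: "set q \<subseteq> carrier R" "set (Irr F y) \<subseteq> carrier R"
    using q(1) IrrE(1)[OF F y] polynomial_incl subfieldE(3)[OF F] unfolding univ_poly_carrier[symmetric] by blast+
  have "conj_eval w q \<in> carrier M" using M.eval_in_carrier[OF map_carrier[OF c(1)] w(1)] .
  then show ?thesis unfolding q(2) conj_eval_mult[OF c(2,1) w(1)] w(2) by simp
qed

text \<open>Send \<open>eval p y\<close> to \<open>conj_eval w p\<close>: polynomials with equal
  values at \<open>y\<close> differ by a multiple of the minimal polynomial, which vanishes at
  \<open>w\<close>.\<close>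

lemma extend_embedding:
  assumes F: "subfield F R" and y: "y \<in> carrier R" "(algebraic over F) y"
    and w: "w \<in> carrier M" "conj_eval w (Irr F y) = \<zero>\<^bsub>M\<^esub>"
  shows "\<exists>\<phi>. \<phi> \<in> ring_hom (R\<lparr>carrier := simple_extension F y\<rparr>) M \<and> (\<forall>a\<in>F. \<phi> a = i a) \<and> \<phi> y = w"
proof -
  note FR = subfieldE(1)[OF F] and Fc = subfieldE(3)[OF F]
  have img: "simple_extension F y = (\<lambda>p. eval p y) ` carrier (F[X])"
    by (rule simple_extension_as_eval_img[OF Fc y(1)])
  have pc: "set p \<subseteq> F" "set p \<subseteq> carrier R" if "p \<in> carrier (F[X])" for p
    using that polynomial_incl Fc unfolding univ_poly_carrier[symmetric] by blast+
  define \<phi> where "\<phi> v = conj_eval w (SOME p. p \<in> carrier (F[X]) \<and> eval p y = v)" for v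
  have wd: "conj_eval w p = conj_eval w q" if pq: "p \<in> carrier (F[X])" "q \<in> carrier (F[X])" "eval p y = eval q y" for p q
  proof -
    define n where "n = map (\<lambda>a. \<ominus> a) q"
    have nF: "set n \<subseteq> F" using pc(1)[OF pq(2)] subringE(5)[OF FR] unfolding n_def by auto
    then have nc: "set n \<subseteq> carrier R" using Fc by auto
    have "poly_add p n \<in> carrier (F[X])"
      unfolding univ_poly_carrier[symmetric] by (rule poly_add_is_polynomial[OF FR pc(1)[OF pq(1)] nF])
    moreover have "eval (poly_add p n) y = \<zero>"
      unfolding eval_poly_add[OF pc(2)[OF pq(1)] nc y(1)] unfolding n_def eval_map_a_inv[OF pc(2)[OF pq(2)] y(1)] pq(3)
      using eval_in_carrier[OF pc(2)[OF pq(2)] y(1)] by (simp add: r_neg)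
    ultimately have "conj_eval w (poly_add p n) = \<zero>\<^bsub>M\<^esub>" by (rule conj_eval_vanish[OF F y w])
    then have 0: "conj_eval w p \<oplus>\<^bsub>M\<^esub> conj_eval w n = \<zero>\<^bsub>M\<^esub>"
      using conj_eval_add[OF pc(2)[OF pq(1)] nc w(1)] by simp
    have "map i n = map (\<lambda>a. \<ominus>\<^bsub>M\<^esub> a) (map i q)" unfolding n_def using pc(2)[OF pq(2)] by auto
    then have "conj_eval w n = \<ominus>\<^bsub>M\<^esub> conj_eval w q"
      using M.eval_map_a_inv[OF map_carrier[OF pc(2)[OF pq(2)]] w(1)] by simp
    moreover have "conj_eval w p \<in> carrier M" "conj_eval w q \<in> carrier M"
      using M.eval_in_carrier[OF map_carrier[OF pc(2)[OF pq(1)]] w(1)] M.eval_in_carrier[OF map_carrier[OF pc(2)[OF pq(2)]] w(1)] .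
    ultimately show ?thesis using 0 M.minus_equality[of "conj_eval w p" "\<ominus>\<^bsub>M\<^esub> conj_eval w q"] by simp
  qed
  have \<phi>: "\<phi> (eval p y) = conj_eval w p" if p: "p \<in> carrier (F[X])" for p
  proof -
    define q where "q = (SOME q. q \<in> carrier (F[X]) \<and> eval q y = eval p y)"
    have "q \<in> carrier (F[X]) \<and> eval q y = eval p y"
      unfolding q_def by (rule someI[of _ p]) (use p in simp)
    then show ?thesis using wd[of q p] p unfolding \<phi>_def q_def[symmetric] by simp
  qed
  have const: "\<phi> a = i a" if a: "a \<in> F" for a
  proof -
    have ac: "a \<in> carrier R" using a Fc by auto
    have c: "normalize [a] \<in> carrier (F[X])"
      unfolding univ_poly_carrier[symmetric] by (rule normalize_gives_polynomial) (use a in simp)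
    have "eval (normalize [a]) y = a" "conj_eval w (normalize [a]) = i a" using ac y(1) w(1) by simp_all
    then show ?thesis using \<phi>[OF c] by metis
  qed
  have "\<phi> \<in> ring_hom (R\<lparr>carrier := simple_extension F y\<rparr>) M"
  proof (rule ring_hom_memI)
    fix u assume "u \<in> carrier (R\<lparr>carrier := simple_extension F y\<rparr>)"
    then obtain p where p: "p \<in> carrier (F[X])" "u = eval p y" using img by auto
    then show "\<phi> u \<in> carrier M" using \<phi> M.eval_in_carrier[OF map_carrier[OF pc(2)] w(1)] by simp
    fix v assume "v \<in> carrier (R\<lparr>carrier := simple_extension F y\<rparr>)"
    then obtain q where q: "q \<in> carrier (F[X])" "v = eval q y" using img by auto
    have add: "poly_add p q \<in> carrier (F[X])"
      unfolding univ_poly_carrier[symmetric] by (rule poly_add_is_polynomial[OF FR pc(1)[OF p(1)] pc(1)[OF q(1)]])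
    have mult: "poly_mult p q \<in> carrier (F[X])"
      unfolding univ_poly_carrier[symmetric] by (rule poly_mult_is_polynomial[OF FR pc(1)[OF p(1)] pc(1)[OF q(1)]])
    have "u \<oplus> v = eval (poly_add p q) y" "u \<otimes> v = eval (poly_mult p q) y"
      unfolding p(2) q(2) using eval_poly_add[OF pc(2)[OF p(1)] pc(2)[OF q(1)] y(1)]
        eval_poly_mult[OF pc(2)[OF p(1)] pc(2)[OF q(1)] y(1)] by simp_all
    then show "\<phi> (u \<oplus>\<^bsub>R\<lparr>carrier := simple_extension F y\<rparr>\<^esub> v) = \<phi> u \<oplus>\<^bsub>M\<^esub> \<phi> v"
      "\<phi> (u \<otimes>\<^bsub>R\<lparr>carrier := simple_extension F y\<rparr>\<^esub> v) = \<phi> u \<otimes>\<^bsub>M\<^esub> \<phi> v"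
      using \<phi>[OF add] \<phi>[OF mult] \<phi>[OF p(1)] \<phi>[OF q(1)] p(2) q(2)
        conj_eval_add[OF pc(2)[OF p(1)] pc(2)[OF q(1)] w(1)] conj_eval_mult[OF pc(2)[OF p(1)] pc(2)[OF q(1)] w(1)]
      by simp_all
  next
    show "\<phi> \<one>\<^bsub>R\<lparr>carrier := simple_extension F y\<rparr>\<^esub> = \<one>\<^bsub>M\<^esub>" using const[of \<one>] subringE(3)[OF FR] by simp
  qed
  moreover have "\<phi> y = w"
  proof -
    have c: "[\<one>, \<zero>] \<in> carrier (F[X])"
      unfolding univ_poly_carrier[symmetric] by (rule polynomialI) (use subringE(2,3)[OF FR] in auto)
    have "eval [\<one>, \<zero>] y = y" "conj_eval w [\<one>, \<zero>] = w" using y(1) w(1) by simp_all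
    then show ?thesis using \<phi>[OF c] by metis
  qed
  ultimately show ?thesis using const by blast
qed

end

lemma (in domain) Irr_props:
  assumes K: "subfield K R" and y: "y \<in> carrier R" "(algebraic over K) y"
  shows "set (Irr K y) \<subseteq> K" "Irr K y \<noteq> []" "length (Irr K y) \<ge> 2"
    "\<exists>q. set q \<subseteq> carrier R \<and> Irr K y = lin_mult y \<zero> \<zero> q"
proof -
  note irr = IrrE[OF K y] and KR = subfieldE(1)[OF K]
  show pK: "set (Irr K y) \<subseteq> K" using irr(1) polynomial_incl unfolding univ_poly_carrier[symmetric] by blast
  have pc: "set (Irr K y) \<subseteq> carrier R" using pK subfieldE(3)[OF K] by blast
  show ne: "Irr K y \<noteq> []" using irr(2) unfolding ring_irreducible_def univ_poly_zero by auto
  show "length (Irr K y) \<ge> 2"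
  proof (rule ccontr)
    assume "\<not> length (Irr K y) \<ge> 2"
    then have "length (Irr K y) = 1" using ne by (cases "Irr K y") (auto simp: Suc_le_eq)
    then obtain a where "Irr K y = [a]" by (auto simp: length_Suc_conv)
    then show False using irr(3,4) y(1) by simp
  qed
  show "\<exists>q. set q \<subseteq> carrier R \<and> Irr K y = lin_mult y \<zero> \<zero> q"
    by (rule root_imp_lin_mult[OF carrier_is_subring y(1) ne pc irr(4)])
qed

section \<open>Conjugates of a primitive element and integral coefficients\<close>

context closure_embedding
begin

lemma conj_eval_lin_mult:
  assumes "set q \<subseteq> carrier R" "y \<in> carrier R" "w \<in> carrier M"
  shows "conj_eval w (lin_mult y \<zero> \<zero> q) = (w \<ominus>\<^bsub>M\<^esub> i y) \<otimes>\<^bsub>M\<^esub> conj_eval w q"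
proof -
  have "map i (lin_mult y \<zero> \<zero> q) = M.lin_mult (i y) \<zero>\<^bsub>M\<^esub> \<zero>\<^bsub>M\<^esub> (map i q)"
    using map_lin_mult[OF is_cring M.is_cring hom assms(2) zero_closed zero_closed assms(1)] by simp
  moreover have "M.eval (map i q) w \<in> carrier M" by (rule M.eval_in_carrier[OF map_carrier[OF assms(1)] assms(3)])
  ultimately show ?thesis
    using M.eval_lin_mult_0[OF map_carrier[OF assms(1)], of "i y" "\<zero>\<^bsub>M\<^esub>" w] assms by simp
qed

text \<open>A second conjugate \<open>w\<close> of \<open>y\<close> over \<open>K(x + ty)\<close> yields a conjugate \<open>x'\<close> of \<open>x\<close> with
  \<open>x' + tw = x + ty\<close>.\<close>

lemma finite_exceptional_multipliers:
  assumes K: "subfield K R" and alg: "\<And>v. v \<in> carrier R \<Longrightarrow> (algebraic over K) v"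
    and x: "x \<in> carrier R" and y: "y \<in> carrier R" and sep: "separable_poly R K (Irr K y)"
  shows "finite {t \<in> K. y \<notin> simple_extension K (x \<oplus> t \<otimes> y)}"
proof -
  define Z where "Z v = {w. M.is_root (map i (Irr K v)) w}" for v
  have Kc: "K \<subseteq> carrier R" using subfieldE(3)[OF K] .
  have poly: "map i (Irr K v) \<in> carrier (poly_ring M)" "map i (Irr K v) \<noteq> []" if v: "v \<in> carrier R" for v
  proof -
    note P = Irr_props[OF K v alg[OF v]]
    show "map i (Irr K v) \<noteq> []" using P(2) by simp
    have "hd (map i (Irr K v)) = \<one>\<^bsub>M\<^esub>" using IrrE(3)[OF K v alg[OF v]] P(2) by (simp add: hd_map)
    moreover have "set (map i (Irr K v)) \<subseteq> carrier M" using map_carrier P(1) Kc by blast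
    ultimately show "map i (Irr K v) \<in> carrier (poly_ring M)"
      unfolding univ_poly_carrier[symmetric] using M.one_not_zero by (intro M.polynomialI) auto
  qed
  have Zfin: "finite (Z v)" if v: "v \<in> carrier R" for v
    unfolding Z_def by (rule M.finite_number_of_roots[OF poly(1)[OF v]])
  \<comment> \<open>Solving \<open>x' + t w = x + t y\<close> for \<open>t\<close> recovers a bad
    multiplier from a pair of roots, and there are finitely many pairs.\<close>
  let ?f = "\<lambda>(x', w). (x' \<ominus>\<^bsub>M\<^esub> i x) \<otimes>\<^bsub>M\<^esub> inv\<^bsub>M\<^esub> (i y \<ominus>\<^bsub>M\<^esub> w)"
  have key: "i t \<in> ?f ` (Z x \<times> Z y)" if t: "t \<in> K" and bad: "y \<notin> simple_extension K (x \<oplus> t \<otimes> y)" for t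
  proof -
    define z where "z = x \<oplus> t \<otimes> y"
    define F where "F = simple_extension K z"
    have tc: "t \<in> carrier R" using t Kc by auto
    have zc: "z \<in> carrier R" unfolding z_def using x y tc by simp
    have F: "subfield F R" unfolding F_def using simple_extension_is_subfield[OF K zc] alg[OF zc] by simp
    have KF: "K \<subseteq> F" unfolding F_def by (rule simple_extension_incl[OF Kc zc])
    have zF: "z \<in> F" unfolding F_def by (rule simple_extension_mem[OF subfieldE(1)[OF K] zc])
    note FR = subfieldE(1)[OF F] and Fc = subfieldE(3)[OF F]
    have yF: "(algebraic over F) y" using algebraic_mono[OF KF alg[OF y]] .
    note m = IrrE[OF F y yF] and mP = Irr_props[OF F y yF]
    \<comment> \<open>The cofactor of \<open>X - y\<close> in the minimal polynomial over
      \<open>F\<close>. It is not constant, for otherwise \<open>y\<close> would lie in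
      \<open>F\<close>; its root \<open>w\<close> is the second conjugate.\<close>
    obtain m1 where m1: "set m1 \<subseteq> carrier R" "Irr F y = lin_mult y \<zero> \<zero> m1" using mP(4) by blast
    have m1n: "m1 \<noteq> []" using mP(3) m1(2) by auto
    have hm1: "hd m1 = \<one>" using hd_lin_mult[OF m1(1) m1n y, of \<zero>] m1(2) m(3) by simp
    have "length m1 \<noteq> 1"
    proof
      assume "length m1 = 1"
      then have "m1 = [\<one>]" using hm1 by (cases m1) auto
      then have "Irr F y = [\<one>, \<ominus> y]" using m1(2) y by (simp add: a_minus_def)
      then have "\<ominus> y \<in> F" using mP(1) by simp
      then have "\<ominus> (\<ominus> y) \<in> F" by (rule subringE(5)[OF FR])
      then show False using bad y unfolding F_def z_def by simp
    qed
    then have lm1: "length (map i m1) \<ge> 2" using m1n by (cases m1) (auto simp: Suc_le_eq)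
    have "hd (map i m1) \<noteq> \<zero>\<^bsub>M\<^esub>" using hm1 m1n M.one_not_zero by (simp add: hd_map)
    then obtain w where w: "w \<in> carrier M" "conj_eval w m1 = \<zero>\<^bsub>M\<^esub>"
      using M.exists_root[OF map_carrier[OF m1(1)] _ lm1] by blast
    have wm: "conj_eval w (Irr F y) = \<zero>\<^bsub>M\<^esub>"
      unfolding m1(2) conj_eval_lin_mult[OF m1(1) y w(1)] w(2) using w(1) y by simp
    have gF: "Irr K v \<in> carrier (F[X])" if "v \<in> carrier R" for v
      using IrrE(1)[OF K that alg[OF that]] KF unfolding univ_poly_carrier[symmetric] polynomial_def by auto
    have gy: "eval (Irr K y) y = \<zero>" by (rule IrrE(4)[OF K y alg[OF y]])
    \<comment> \<open>Equality would make \<open>y\<close> a double root of its minimal polynomial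
      over \<open>F\<close>, hence of the multiple \<open>Irr K y\<close>, against separability over
      \<open>K\<close>.\<close>
    have w_ne: "w \<noteq> i y"
    proof
      assume "w = i y"
      then have "i (eval m1 y) = i \<zero>" using w(2) i.eval_hom'[OF y m1(1)] by simp
      then have m1y: "eval m1 y = \<zero>" using inj eval_in_carrier[OF m1(1) y] unfolding inj_on_def by blast
      have "Irr F y pdivides Irr K y" by (rule Irr_minimal[OF F y yF gF[OF y] gy])
      then obtain k where k: "k \<in> carrier (poly_ring R)" "Irr K y = Irr F y \<otimes>\<^bsub>poly_ring R\<^esub> k"
        unfolding pdivides_def factor_def by auto
      obtain h where h: "set h \<subseteq> carrier R" "Irr K y = lin_mult y \<zero> \<zero> h"
        using Irr_props(4)[OF K y alg[OF y]] by blast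
      have hn: "h \<noteq> []" using Irr_props(3)[OF K y alg[OF y]] h(2) by auto
      have hh: "hd h = \<one>" using hd_lin_mult[OF h(1) hn y, of \<zero>] h(2) IrrE(3)[OF K y alg[OF y]] by simp
      have hp: "h \<in> carrier (poly_ring R)" "m1 \<in> carrier (poly_ring R)"
        unfolding univ_poly_carrier[symmetric] using h(1) hh m1(1) hm1 by (auto intro!: polynomialI)
      have lp: "[\<one>, \<ominus> y] \<in> carrier (poly_ring R)"
        unfolding univ_poly_carrier[symmetric] using y by (auto intro!: polynomialI)
      interpret P: domain "poly_ring R" by (rule univ_poly_is_domain[OF carrier_is_subring])
      have "[\<one>, \<ominus> y] \<otimes>\<^bsub>poly_ring R\<^esub> h = ([\<one>, \<ominus> y] \<otimes>\<^bsub>poly_ring R\<^esub> m1) \<otimes>\<^bsub>poly_ring R\<^esub> k"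
        using k(2) unfolding h(2) m1(2) lin_mult_eq_mult[OF y hp(1) hn] lin_mult_eq_mult[OF y hp(2) m1n] .
      then have "[\<one>, \<ominus> y] \<otimes>\<^bsub>poly_ring R\<^esub> h = [\<one>, \<ominus> y] \<otimes>\<^bsub>poly_ring R\<^esub> (m1 \<otimes>\<^bsub>poly_ring R\<^esub> k)"
        using P.m_assoc[OF lp hp(2) k(1)] by simp
      moreover have "[\<one>, \<ominus> y] \<noteq> \<zero>\<^bsub>poly_ring R\<^esub>" unfolding univ_poly_zero by simp
      ultimately have "h = m1 \<otimes>\<^bsub>poly_ring R\<^esub> k"
        using P.m_lcancel[OF _ lp hp(1) P.m_closed[OF hp(2) k(1)]] by blast
      then have "h = poly_mult m1 k" by (simp add: univ_poly_mult)
      moreover have kc: "set k \<subseteq> carrier R" using k(1) polynomial_incl unfolding univ_poly_carrier[symmetric] by blast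
      ultimately have "eval h y = \<zero>" using eval_poly_mult[OF m1(1) kc y] m1y eval_in_carrier[OF kc y] by simp
      then show False using separable_simple_root[OF K y alg[OF y] sep h] by simp
    qed
    have "conj_eval w (Irr K y) = \<zero>\<^bsub>M\<^esub>" by (rule conj_eval_vanish[OF F y yF w(1) wm gF[OF y] gy])
    then have wZ: "w \<in> Z y" using w(1) poly(2)[OF y] unfolding Z_def M.is_root_def by simp
    \<comment> \<open>This embedding agrees with \<open>i\<close> on \<open>F\<close>, in particular
      at \<open>z\<close>, so it sends \<open>x\<close>, which is \<open>z - t y\<close>, to
      \<open>z - t w\<close>.\<close>
    obtain \<phi> where \<phi>: "\<phi> \<in> ring_hom (R\<lparr>carrier := simple_extension F y\<rparr>) M" "\<forall>a\<in>F. \<phi> a = i a" "\<phi> y = w"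
      using extend_embedding[OF F y yF w(1) wm] by blast
    define E where "E = simple_extension F y"
    have E: "subring E R" unfolding E_def by (rule simple_extension_is_subring[OF FR y])
    have FE: "F \<subseteq> E" unfolding E_def by (rule simple_extension_incl[OF Fc y])
    have yE: "y \<in> E" unfolding E_def by (rule simple_extension_mem[OF FR y])
    interpret e: ring_hom_ring "R\<lparr>carrier := E\<rparr>" M \<phi>
      by (rule ring_hom_ringI2[OF subring_is_ring[OF E] M.ring_axioms \<phi>(1)[folded E_def]])
    have tF: "t \<in> F" using t KF by auto
    have xe: "x = z \<oplus> (\<ominus> t) \<otimes> y" unfolding z_def using x y tc by algebra
    have tE: "\<ominus> t \<in> F" using subringE(5)[OF FR tF] .
    have ty: "(\<ominus> t) \<otimes> y \<in> E" using subringE(6)[OF E _ yE] tE FE by auto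
    have xE: "x \<in> E" using xe subringE(7)[OF E _ ty] zF FE by auto
    have it: "i t \<in> carrier M" "i x \<in> carrier M" "i y \<in> carrier M" "i z \<in> carrier M" using tc x y zc by auto
    have "\<phi> x = \<phi> z \<oplus>\<^bsub>M\<^esub> \<phi> ((\<ominus> t) \<otimes> y)"
      using e.hom_add[of z "\<ominus> t \<otimes> y"] xe zF FE ty by auto
    also have "\<phi> ((\<ominus> t) \<otimes> y) = \<phi> (\<ominus> t) \<otimes>\<^bsub>M\<^esub> \<phi> y"
      using e.hom_mult[of "\<ominus> t" y] tE FE yE by auto
    finally have \<phi>x: "\<phi> x = i z \<oplus>\<^bsub>M\<^esub> (\<ominus>\<^bsub>M\<^esub> i t) \<otimes>\<^bsub>M\<^esub> w"
      using \<phi>(2,3) zF tE tc by simp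
    have \<phi>xc: "\<phi> x \<in> carrier M" using e.hom_closed[of x] xE by simp
    have fK: "set (Irr K x) \<subseteq> K" by (rule Irr_props(1)[OF K x alg[OF x]])
    then have fE: "set (Irr K x) \<subseteq> carrier (R\<lparr>carrier := E\<rparr>)" using KF FE by auto
    have "map \<phi> (Irr K x) = map i (Irr K x)" using \<phi>(2) fK KF by (intro map_cong) auto
    moreover have "\<phi> (eval (Irr K x) x) = M.eval (map \<phi> (Irr K x)) (\<phi> x)"
      using e.eval_hom'[of x "Irr K x"] xE fE eval_consistent[OF E] by simp
    moreover have "\<phi> (eval (Irr K x) x) = \<zero>\<^bsub>M\<^esub>"
      unfolding IrrE(4)[OF K x alg[OF x]] using e.hom_zero by simp
    ultimately have "conj_eval (\<phi> x) (Irr K x) = \<zero>\<^bsub>M\<^esub>" by metis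
    then have xZ: "\<phi> x \<in> Z x" using \<phi>xc poly(2)[OF x] unfolding Z_def M.is_root_def by simp
    have "i z = i x \<oplus>\<^bsub>M\<^esub> i t \<otimes>\<^bsub>M\<^esub> i y" unfolding z_def using x y tc by simp
    then have e: "i t \<otimes>\<^bsub>M\<^esub> (i y \<ominus>\<^bsub>M\<^esub> w) = \<phi> x \<ominus>\<^bsub>M\<^esub> i x"
      unfolding \<phi>x using it w(1) by algebra
    have d: "i y \<ominus>\<^bsub>M\<^esub> w \<in> Units M"
      using w_ne it w(1) by (auto simp: M.field_Units)
    then have "i t = (\<phi> x \<ominus>\<^bsub>M\<^esub> i x) \<otimes>\<^bsub>M\<^esub> inv\<^bsub>M\<^esub> (i y \<ominus>\<^bsub>M\<^esub> w)"
      using e[symmetric] it w(1) by (simp add: M.m_assoc)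
    then show ?thesis using xZ wZ by (intro image_eqI[of _ _ "(\<phi> x, w)"]) simp_all
  qed
  have "i ` {t \<in> K. y \<notin> simple_extension K (x \<oplus> t \<otimes> y)} \<subseteq> ?f ` (Z x \<times> Z y)" using key by blast
  then have "finite (i ` {t \<in> K. y \<notin> simple_extension K (x \<oplus> t \<otimes> y)})"
    using Zfin[OF x] Zfin[OF y] finite_subset by blast
  moreover have "inj_on i {t \<in> K. y \<notin> simple_extension K (x \<oplus> t \<otimes> y)}"
    using inj by (rule inj_on_subset) (use Kc in auto)
  ultimately show ?thesis using finite_imageD by blast
qed

text \<open>Euler's formula: with \<open>f\<close> the minimal polynomial and
  \<open>D = f'(\<alpha>)\<close>, write \<open>D b = g(\<alpha>)\<close> with \<open>g\<close> of
  degree below that of \<open>f\<close>. At a conjugate \<open>w\<close>, the value of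
  \<open>g\<close> is the conjugate of \<open>b\<close> times \<open>f'(w)\<close>, so
  \<open>interpolation_in_subring\<close> makes the coefficients integral; they lie in
  \<open>K\<close>, hence in \<open>A\<close>.\<close>

lemma integral_coefficients:
  assumes A: "subring A R" and noeth: "noetherian_ring (R\<lparr>carrier := A\<rparr>)"
    and K: "subfield K R" and AK: "A \<subseteq> K" and closed: "K \<inter> integral_closure R A \<subseteq> A"
    and \<alpha>: "\<alpha> \<in> integral_closure R A" "(algebraic over K) \<alpha>" "separable_poly R K (Irr K \<alpha>)"
      "simple_extension K \<alpha> = carrier R"
  shows "set (Irr K \<alpha>) \<subseteq> A \<and>
    (\<exists>D\<in>carrier R. D \<noteq> \<zero> \<and> (\<forall>b\<in>integral_closure R A. \<exists>g. set g \<subseteq> A \<and> length g < length (Irr K \<alpha>) \<and> D \<otimes> b = eval g \<alpha>))"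
proof -
  have \<alpha>c: "\<alpha> \<in> carrier R" using \<alpha>(1) mem_integral_closure[OF A] by simp
  have Kc: "K \<subseteq> carrier R" using subfieldE(3)[OF K] .
  have Ac: "A \<subseteq> carrier R" using AK Kc by simp
  define f where "f = Irr K \<alpha>"
  note fE = IrrE[OF K \<alpha>c \<alpha>(2), folded f_def] and fP = Irr_props[OF K \<alpha>c \<alpha>(2), folded f_def]
  have fc: "set f \<subseteq> carrier R" using fP(1) Kc by blast
  obtain f1 where f1: "set f1 \<subseteq> carrier R" "f = lin_mult \<alpha> \<zero> \<zero> f1" using fP(4) by blast
  define D where "D = eval f1 \<alpha>"
  have Dc: "D \<in> carrier R" unfolding D_def by (rule eval_in_carrier[OF f1(1) \<alpha>c])
  have D0: "D \<noteq> \<zero>" unfolding D_def by (rule separable_simple_root[OF K \<alpha>c \<alpha>(2,3) f1(1) f1(2)[unfolded f_def]])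
  have iA: "subring (i ` A) M" by (rule i.img_is_subring[OF A])
  define C where "C = integral_closure M (i ` A)"
  have C: "subring C M" unfolding C_def
    by (rule M.integral_closure_subring[OF iA noetherian_ring_image[OF is_cring M.is_cring hom inj A noeth]])
  \<comment> \<open>Descent from the algebraic closure: an integral equation of \<open>i k\<close>
    pulls back along the injective \<open>i\<close>, and \<open>A\<close> is integrally closed in
    \<open>K\<close>.\<close>
  have KC: "k \<in> A" if k: "k \<in> K" "i k \<in> C" for k
  proof -
    obtain P' where P': "set P' \<subseteq> i ` A" "M.eval (\<one>\<^bsub>M\<^esub> # P') (i k) = \<zero>\<^bsub>M\<^esub>"
      using k(2) M.mem_integral_closure[OF iA] unfolding C_def by blast
    obtain P where P: "set P \<subseteq> A" "P' = map i P"
    proof -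
      have "\<forall>c\<in>set P'. \<exists>a. a \<in> A \<and> c = i a" using P'(1) by blast
      then obtain g where g: "\<forall>c\<in>set P'. g c \<in> A \<and> c = i (g c)" using bchoice[of "set P'"] by metis
      then have "map i (map g P') = P'" by (simp add: map_idI)
      moreover have "set (map g P') \<subseteq> A" using g by auto
      ultimately show ?thesis using that[of "map g P'"] by simp
    qed
    have Pc: "set (\<one> # P) \<subseteq> carrier R" using P(1) Ac by auto
    have kc: "k \<in> carrier R" using k(1) Kc by auto
    have "i (eval (\<one> # P) k) = i \<zero>"
      using i.eval_hom'[OF kc Pc] P'(2) P(2) by simp
    then have "eval (\<one> # P) k = \<zero>" using inj eval_in_carrier[OF Pc kc] unfolding inj_on_def by blast
    then have "k \<in> integral_closure R A" using mem_integral_closure[OF A] kc P(1) by blast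
    then show ?thesis using closed k(1) by auto
  qed
  have conj: "\<exists>\<phi>. \<phi> \<in> ring_hom R M \<and> (\<forall>a\<in>K. \<phi> a = i a) \<and> \<phi> \<alpha> = w" if "w \<in> carrier M" "conj_eval w f = \<zero>\<^bsub>M\<^esub>" for w
  proof -
    have "R\<lparr>carrier := simple_extension K \<alpha>\<rparr> = R" unfolding \<alpha>(4) by simp
    then show ?thesis using extend_embedding[OF K \<alpha>c \<alpha>(2) that(1)] that(2) unfolding f_def by metis
  qed
  have integral_img: "\<phi> b \<in> C" if \<phi>: "\<phi> \<in> ring_hom R M" "\<forall>a\<in>K. \<phi> a = i a" and b: "b \<in> integral_closure R A" for \<phi> b
  proof -
    interpret e: ring_hom_ring R M \<phi> by (rule ring_hom_ringI2[OF ring_axioms M.ring_axioms \<phi>(1)])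
    obtain P where P: "set P \<subseteq> A" "eval (\<one> # P) b = \<zero>" and bc: "b \<in> carrier R"
      using b mem_integral_closure[OF A] by blast
    have Pc: "set (\<one> # P) \<subseteq> carrier R" using P(1) Ac by auto
    have "M.eval (map \<phi> (\<one> # P)) (\<phi> b) = \<zero>\<^bsub>M\<^esub>"
      unfolding e.eval_hom'[OF bc Pc, symmetric] P(2) by (rule e.hom_zero)
    moreover have "map \<phi> P = map i P" using \<phi>(2) P(1) AK by (intro map_cong) auto
    then have "map \<phi> (\<one> # P) = \<one>\<^bsub>M\<^esub> # map i P" using e.hom_one by simp
    ultimately have "M.eval (\<one>\<^bsub>M\<^esub> # map i P) (\<phi> b) = \<zero>\<^bsub>M\<^esub>" by metis
    moreover have "set (map i P) \<subseteq> i ` A" using P(1) by auto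
    moreover have "\<phi> b \<in> carrier M" using bc by (rule e.hom_closed)
    ultimately show ?thesis unfolding C_def M.mem_integral_closure[OF iA] by blast
  qed
  have main: "set (map i f) \<subseteq> C \<and> set (map i g) \<subseteq> C"
    if b: "b \<in> integral_closure R A" and g: "set g \<subseteq> K" "length f = Suc (length g)" "eval g \<alpha> = D \<otimes> b" for b g
  proof (rule M.interpolation_in_subring[OF C map_carrier[OF fc]])
    have gc: "set g \<subseteq> carrier R" using g(1) Kc by auto
    show "map i f \<noteq> []" using fP(2) by simp
    show "hd (map i f) = \<one>\<^bsub>M\<^esub>" using fE(3) fP(2) by (metis hd_map i.hom_one)
    show "set (map i g) \<subseteq> carrier M" using map_carrier[OF gc] .
    show "length (map i f) = Suc (length (map i g))" using g(2) by simp
    fix w assume w: "w \<in> carrier M"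
    show "w \<in> C" if "conj_eval w f = \<zero>\<^bsub>M\<^esub>"
      using conj[OF w that] integral_img[OF _ _ \<alpha>(1)] by blast
    fix q assume q: "set q \<subseteq> carrier M" "map i f = M.lin_mult w \<zero>\<^bsub>M\<^esub> \<zero>\<^bsub>M\<^esub> q"
    have "conj_eval w f = \<zero>\<^bsub>M\<^esub>"
      unfolding q(2) using M.eval_lin_mult_0[OF q(1) w _ w, of "\<zero>\<^bsub>M\<^esub>"] M.eval_in_carrier[OF q(1) w] w
      by (simp add: M.r_neg a_minus_def)
    then obtain \<phi> where \<phi>: "\<phi> \<in> ring_hom R M" "\<forall>a\<in>K. \<phi> a = i a" "\<phi> \<alpha> = w" using conj[OF w] by blast
    interpret e: ring_hom_ring R M \<phi> by (rule ring_hom_ringI2[OF ring_axioms M.ring_axioms \<phi>(1)])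
    have "map i f = map \<phi> f" using \<phi>(2) fP(1) by (intro map_cong) auto
    also have "\<dots> = M.lin_mult w \<zero>\<^bsub>M\<^esub> \<zero>\<^bsub>M\<^esub> (map \<phi> f1)"
      unfolding f1(2) using map_lin_mult[OF is_cring M.is_cring \<phi>(1) \<alpha>c zero_closed zero_closed f1(1)] \<phi>(3) by simp
    finally have "M.lin_mult w \<zero>\<^bsub>M\<^esub> \<zero>\<^bsub>M\<^esub> q = M.lin_mult w \<zero>\<^bsub>M\<^esub> \<zero>\<^bsub>M\<^esub> (map \<phi> f1)" using q(2) by simp
    moreover have "set (map \<phi> f1) \<subseteq> carrier M" using f1(1) by auto
    \<comment> \<open>Cofactors are unique, so the value of \<open>q\<close> at \<open>w\<close> is
      the image of \<open>D\<close>, in particular nonzero.\<close>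
    ultimately have qf: "q = map \<phi> f1" using M.lin_mult_inject q(1) w by blast
    have qD: "M.eval q w = \<phi> D" unfolding qf D_def using e.eval_hom'[OF \<alpha>c f1(1)] \<phi>(3) by simp
    have "\<phi> D \<noteq> \<zero>\<^bsub>M\<^esub>"
    proof
      assume z: "\<phi> D = \<zero>\<^bsub>M\<^esub>"
      have U: "D \<in> Units R" using Dc D0 by (simp add: field_Units)
      have "\<phi> (D \<otimes> inv D) = \<phi> D \<otimes>\<^bsub>M\<^esub> \<phi> (inv D)" by (rule e.hom_mult[OF Dc Units_inv_closed[OF U]])
      then have "\<one>\<^bsub>M\<^esub> = \<zero>\<^bsub>M\<^esub>" unfolding z Units_r_inv[OF U] e.hom_one using e.hom_closed[OF Units_inv_closed[OF U]] by simp
      then show False using M.one_not_zero by simp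
    qed
    moreover have bc: "b \<in> carrier R" using b mem_integral_closure[OF A] by blast
    have "M.eval (map i g) w = \<phi> (eval g \<alpha>)"
    proof -
      have "map i g = map \<phi> g" using \<phi>(2) g(1) by (intro map_cong) auto
      then show ?thesis using e.eval_hom'[OF \<alpha>c gc] \<phi>(3) by metis
    qed
    then have "M.eval (map i g) w = \<phi> b \<otimes>\<^bsub>M\<^esub> M.eval q w"
      unfolding g(3) qD e.hom_mult[OF Dc bc]
      using M.m_comm[OF e.hom_closed[OF Dc] e.hom_closed[OF bc]] by simp
    moreover have "\<phi> b \<in> C" by (rule integral_img[OF \<phi>(1,2) b])
    ultimately show "M.eval q w \<noteq> \<zero>\<^bsub>M\<^esub> \<and> (\<exists>c\<in>C. M.eval (map i g) w = c \<otimes>\<^bsub>M\<^esub> M.eval q w)"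
      using qD by metis
  qed
  have rep: "\<exists>g. set g \<subseteq> K \<and> length f = Suc (length g) \<and> eval g \<alpha> = v" if v: "v \<in> carrier R" for v
  proof -
    have "v \<in> Span K (exp_base \<alpha> (degree f))" using Span_exp_base[OF K \<alpha>c \<alpha>(2)] v \<alpha>(4) unfolding f_def by simp
    then obtain p where p: "p \<in> carrier (K[X])" "length p \<le> degree f" "v = eval p \<alpha>"
      unfolding Span_eq_eval_img[OF K \<alpha>c] by auto
    have pK: "set p \<subseteq> K" using p(1) polynomial_incl unfolding univ_poly_carrier[symmetric] by blast
    \<comment> \<open>Leading zeros give \<open>g\<close> exactly one entry less than
      \<open>f\<close>, the shape required for interpolation.\<close>
    define g where "g = replicate (degree f - length p) \<zero> @ p"
    have "set g \<subseteq> K" unfolding g_def using pK subringE(2)[OF subfieldE(1)[OF K]] by auto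
    moreover have "length f = Suc (length g)" unfolding g_def using p(2) fP(2) by (cases f) auto
    moreover have "eval g \<alpha> = v" unfolding g_def p(3) by (rule eval_replicate) (use pK Kc \<alpha>c in auto)
    ultimately show ?thesis by blast
  qed
  have B1: "\<one> \<in> integral_closure R A" using subset_integral_closure[OF A] subringE(3)[OF A] by auto
  have fA: "set f \<subseteq> A"
  proof
    fix k assume k: "k \<in> set f"
    \<comment> \<open>The case \<open>b = \<one>\<close> is enough for the coefficients of
      \<open>f\<close> itself.\<close>
    obtain g where g: "set g \<subseteq> K" "length f = Suc (length g)" "eval g \<alpha> = D \<otimes> \<one>" using rep[of "D \<otimes> \<one>"] Dc by auto
    have "i k \<in> C" using main[OF B1 g] k by auto
    then show "k \<in> A" using KC k fP(1) by blast
  qed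
  have "\<exists>g. set g \<subseteq> A \<and> length g < length f \<and> D \<otimes> b = eval g \<alpha>" if b: "b \<in> integral_closure R A" for b
  proof -
    have bc: "b \<in> carrier R" using b mem_integral_closure[OF A] by blast
    obtain g where g: "set g \<subseteq> K" "length f = Suc (length g)" "eval g \<alpha> = D \<otimes> b" using rep[of "D \<otimes> b"] Dc bc by auto
    have "set (map i g) \<subseteq> C" using main[OF b g] by simp
    then have "set g \<subseteq> A" using KC g(1) by (auto simp: subset_iff)
    then show ?thesis using g(2,3) by (metis lessI)
  qed
  then show ?thesis using fA Dc D0 unfolding f_def by blast
qed

end

section \<open>Approximation at finitely many primes, nonroots modulo a prime, common
  multiples\<close>

text \<open>If \<open>y\<close> fails at the new prime \<open>q\<close>, add
  \<open>u \<otimes> z\<close>, where \<open>z\<close> works at \<open>q\<close> and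
  \<open>u\<close> lies in all primes treated before but not in \<open>q\<close>. Nothing changes
  modulo the old primes, and the failure at \<open>q\<close> is repaired.\<close>

lemma (in dedekind_subring) exists_multiplier_avoiding_primes:
  assumes "finite Q" "Q \<subseteq> nonzero_primes S" and I: "ideal I S" "I \<noteq> {\<zero>}"
  shows "\<exists>y\<in>carrier R. (\<forall>m\<in>I. y \<otimes> m \<in> B) \<and> (\<forall>q\<in>Q. \<exists>m\<in>I. y \<otimes> m \<notin> q)"
  using assms(1,2)
proof (induction Q)
  case empty
  have "\<forall>m\<in>I. \<zero> \<otimes> m \<in> B" using subring_idealD(1)[OF I(1)] B_carrier subringE(2)[OF B] by force
  then show ?case by blast
next
  case (insert q Q)
  then obtain y where y: "y \<in> carrier R" "\<forall>m\<in>I. y \<otimes> m \<in> B" "\<forall>q\<in>Q. \<exists>m\<in>I. y \<otimes> m \<notin> q" by auto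
  have q: "q \<in> nonzero_primes S" using insert by auto
  note qD = nonzero_primesD[OF q] and qI = subring_idealD[OF nonzero_primesD(2)[OF q]]
  have Ic: "m \<in> I \<Longrightarrow> m \<in> carrier R" for m using subring_idealD(1)[OF I(1)] B_carrier by auto
  show ?case
  proof (cases "\<exists>m\<in>I. y \<otimes> m \<notin> q")
    case True
    then show ?thesis using y by blast
  next
    case False
    obtain z where z: "z \<in> carrier R" "\<forall>m\<in>I. z \<otimes> m \<in> B" "\<exists>m\<in>I. z \<otimes> m \<notin> q"
      using exists_multiplier_not_in_prime[OF q I] by blast
    have "ideal p S \<and> \<not> p \<subseteq> q" if "p \<in> Q" for p
    proof -
      have p: "p \<in> nonzero_primes S" "p \<noteq> q" using insert that by auto
      then show ?thesis using S.nonzero_primes_subset_eq[OF maximal p(1) q] nonzero_primesD(2)[OF p(1)] by blast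
    qed
    then obtain u where u: "u \<in> B" "u \<notin> q" "\<forall>p\<in>Q. u \<in> p"
      using S.primeideal_avoidance[OF qD(1) insert(1)] by auto
    have uc: "u \<in> carrier R" using u B_carrier by auto
    define v where "v = y \<oplus> u \<otimes> z"
    have vm: "v \<otimes> m = y \<otimes> m \<oplus> u \<otimes> (z \<otimes> m)" if "m \<in> I" for m
      unfolding v_def using y(1) z(1) uc Ic[OF that] by algebra
    have vB: "\<forall>m\<in>I. v \<otimes> m \<in> B" using vm y(2) z(2) u(1) subringE(6,7)[OF B] by simp
    have "\<exists>m\<in>I. v \<otimes> m \<notin> p" if p: "p \<in> Q" for p
    proof -
      have "p \<in> nonzero_primes S" using insert p by auto
      note pD = nonzero_primesD[OF this]
      obtain m where m: "m \<in> I" "y \<otimes> m \<notin> p" using y(3) p by blast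
      have "z \<otimes> m \<in> B" "u \<in> p" using z(2) m u(3) p by auto
      then have uzm: "u \<otimes> (z \<otimes> m) \<in> p" by (intro subring_idealD(5)[OF pD(2)])
      have "y \<otimes> m = v \<otimes> m \<ominus> u \<otimes> (z \<otimes> m)"
        unfolding vm[OF m(1)] using y(1) z(1) uc Ic[OF m(1)] by algebra
      then have "v \<otimes> m \<notin> p" using pD(8)[OF _ uzm] m(2) by metis
      then show ?thesis using m by blast
    qed
    moreover have "\<exists>m\<in>I. v \<otimes> m \<notin> q"
    proof -
      obtain m where m: "m \<in> I" "z \<otimes> m \<notin> q" using z(3) by blast
      have zm: "z \<otimes> m \<in> B" "y \<otimes> m \<in> B" "y \<otimes> m \<in> q" using z(2) y(2) m False by auto
      then have n: "u \<otimes> (z \<otimes> m) \<notin> q" using qD(6)[OF u(1) zm(1)] u(2) m(2) by blast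
      have "u \<otimes> (z \<otimes> m) = v \<otimes> m \<ominus> y \<otimes> m"
        unfolding vm[OF m(1)] using B_carrier[OF zm(1)] B_carrier[OF zm(2)] uc by algebra
      then have "v \<otimes> m \<notin> q" using qD(8)[OF _ zm(3)] n by metis
      then show ?thesis using m by blast
    qed
    moreover have "v \<in> carrier R" unfolding v_def using y(1) z(1) uc by simp
    ultimately show ?thesis using vB by blast
  qed
qed

text \<open>Modulo \<open>p\<close> this is the bound of the number of roots by the degree, which is
  one less than \<open>length f\<close>. Division by \<open>X - x0\<close> takes place over
  \<open>A\<close>, so the residue ring never appears.\<close>

lemma (in domain) exists_nonroot_mod_prime:
  assumes A: "subring A R" and p: "primeideal p (R\<lparr>carrier := A\<rparr>)"
    and "finite Z" "Z \<subseteq> A" "\<And>x y. x \<in> Z \<Longrightarrow> y \<in> Z \<Longrightarrow> x \<noteq> y \<Longrightarrow> x \<ominus> y \<notin> p"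
    and "set f \<subseteq> A" "f \<noteq> []" "hd f = \<one>" "length f \<le> card Z"
  shows "\<exists>x\<in>Z. eval f x \<notin> p"
  using assms(3-)
proof (induction "length f" arbitrary: f Z)
  case (Suc n)
  note pI = subring_idealD[OF primeideal.axioms(1)[OF p]]
  have Ac: "A \<subseteq> carrier R" using subringE(1)[OF A] .
  obtain x0 where x0: "x0 \<in> Z" using Suc(2,9) by fastforce
  show ?case
  proof (cases "eval f x0 \<in> p")
    case False
    then show ?thesis using x0 by blast
  next
    case True
    have x0A: "x0 \<in> A" using x0 Suc(4) by auto
    obtain r q where rq: "r \<in> A" "set q \<subseteq> A" "f = lin_mult x0 r \<zero> q"
      using exists_lin_mult[OF A x0A subringE(2)[OF A] Suc(7,6)] by blast
    have qc: "set q \<subseteq> carrier R" "x0 \<in> carrier R" "r \<in> carrier R" using rq x0A Ac by auto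
    have ev: "eval f x = (x \<ominus> x0) \<otimes> eval q x \<oplus> r" if "x \<in> carrier R" for x
      unfolding rq(3) by (rule eval_lin_mult_0[OF qc that])
    have "eval f x0 = r" using ev[OF qc(2)] eval_in_carrier[OF qc(1,2)] qc by (simp add: r_neg a_minus_def)
    then have rp: "r \<in> p" using True by simp
    show ?thesis
    proof (cases "q = []")
      case True
      then have "f = [r]" using rq(3) qc by (simp add: a_minus_def)
      then have "\<one> \<in> p" using Suc(8) rp by simp
      then have "p = A" using ideal.one_imp_carrier[OF primeideal.axioms(1)[OF p]] by simp
      then show ?thesis using primeideal.I_notcarr[OF p] by simp
    next
      case False
      have hq: "hd q = \<one>" using hd_lin_mult[OF qc(1) False qc(2), of r] rq(3) Suc(8) by simp
      have lq: "length q = n" using rq(3) Suc(2) by simp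
      have "\<exists>x\<in>Z - {x0}. eval q x \<notin> p"
      proof (rule Suc(1)[OF lq[symmetric]])
        show "length q \<le> card (Z - {x0})" using Suc(2,3,9) x0 lq by simp
      qed (use Suc(3-5) rq(2) False hq in auto)
      then obtain x where x: "x \<in> Z" "x \<noteq> x0" "eval q x \<notin> p" by blast
      have xA: "x \<in> A" using x Suc(4) by auto
      have qA: "eval q x \<in> A" by (rule eval_mult_in_subring[OF A rq(2) xA])
      have dA: "x \<ominus> x0 \<in> A" using subringE(5,7)[OF A] xA x0A by (simp add: a_minus_def)
      have np: "(x \<ominus> x0) \<otimes> eval q x \<notin> p"
        using primeideal.I_prime[OF p, of "x \<ominus> x0" "eval q x"] dA qA x(3) Suc(5)[OF x(1) x0 x(2)] by auto
      have "eval f x \<notin> p"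
      proof
        assume "eval f x \<in> p"
        moreover have "\<ominus> \<one> \<otimes> r \<in> p" using pI(4)[OF _ rp] subringE(3,5)[OF A] by simp
        ultimately have "eval f x \<oplus> \<ominus> \<one> \<otimes> r \<in> p" by (rule pI(3))
        moreover have "eval f x \<oplus> \<ominus> \<one> \<otimes> r = (x \<ominus> x0) \<otimes> eval q x"
        proof -
          have "x \<in> carrier R" "(x \<ominus> x0) \<otimes> eval q x \<in> carrier R" using xA dA qA Ac by auto
          then show ?thesis using ev qc(3) by (simp add: l_minus a_assoc r_neg)
        qed
        ultimately show False using np by simp
      qed
      then show ?thesis using x by blast
    qed
  qed
qed simp

lemma (in domain) exists_common_multiple:
  assumes A: "subring A R" and "finite Z" "Z \<subseteq> A - {\<zero>}"
  shows "\<exists>m\<in>A - {\<zero>}. \<forall>z\<in>Z. \<exists>c\<in>A. m = c \<otimes> z"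
  using assms(2,3)
proof induction
  case empty
  then show ?case using subringE(3)[OF A] by auto
next
  case (insert z Z)
  then obtain m where m: "m \<in> A - {\<zero>}" "\<forall>z\<in>Z. \<exists>c\<in>A. m = c \<otimes> z" by auto
  have c: "m \<in> carrier R" "z \<in> carrier R" using m insert subringE(1)[OF A] by auto
  have "m \<otimes> z \<in> A - {\<zero>}" using m(1) insert(4) integral[OF _ c] subringE(6)[OF A] by blast
  moreover have "\<exists>c\<in>A. m \<otimes> z = c \<otimes> w" if w: "w \<in> Z" for w
  proof -
    obtain d where d: "d \<in> A" "m = d \<otimes> w" using m w by blast
    have "d \<in> carrier R" "w \<in> carrier R" using d w insert subringE(1)[OF A] by auto
    then have "m \<otimes> z = (d \<otimes> z) \<otimes> w" using d(2) c by (simp add: m_ac)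
    moreover have "d \<otimes> z \<in> A" using d insert subringE(6)[OF A] by auto
    ultimately show ?thesis by blast
  qed
  ultimately show ?case using m by (intro bexI[of _ "m \<otimes> z"]) auto
qed

text \<open>The set \<open>N\<close> is kept general: it is \<open>A\<close> when denominators of
  coefficients are cleared, and \<open>B\<close> when generators of the extension are made
  integral.\<close>

lemma (in domain) exists_common_multiplier:
  assumes A: "subring A R" and U: "finite U" "U \<subseteq> carrier R" and N: "\<And>a v. a \<in> A \<Longrightarrow> v \<in> N \<Longrightarrow> a \<otimes> v \<in> N"
    and ex: "\<And>u. u \<in> U \<Longrightarrow> \<exists>a\<in>A - {\<zero>}. a \<otimes> u \<in> N"
  shows "\<exists>a\<in>A - {\<zero>}. \<forall>u\<in>U. a \<otimes> u \<in> N"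
proof -
  have "\<forall>u\<in>U. \<exists>a. a \<in> A - {\<zero>} \<and> a \<otimes> u \<in> N" using ex by blast
  then obtain f where f: "\<forall>u\<in>U. f u \<in> A - {\<zero>} \<and> f u \<otimes> u \<in> N" using bchoice[of U] by metis
  then have "f ` U \<subseteq> A - {\<zero>}" by (auto simp: image_subset_iff)
  then obtain a where a: "a \<in> A - {\<zero>}" "\<forall>z\<in>f ` U. \<exists>c\<in>A. a = c \<otimes> z"
    using exists_common_multiple[OF A finite_imageI[OF U(1)]] by blast
  have "a \<otimes> u \<in> N" if u: "u \<in> U" for u
  proof -
    obtain c where c: "c \<in> A" "a = c \<otimes> f u" using a(2) u by blast
    have "c \<in> carrier R" "f u \<in> carrier R" "u \<in> carrier R" using c f u U(2) subringE(1)[OF A] by auto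
    then have "a \<otimes> u = c \<otimes> (f u \<otimes> u)" unfolding c(2) by (rule m_assoc)
    then show ?thesis using N[OF c(1)] f u by simp
  qed
  then show ?thesis using a(1) by blast
qed

section \<open>Primitive elements in a prescribed coset\<close>

text \<open>Generators are absorbed one at a time by passing from \<open>y\<close> to
  \<open>y \<oplus> t \<otimes> u\<close>. Only finitely many \<open>t\<close> fail, so the infinite
  \<open>T\<close> leaves one, and \<open>t \<otimes> u \<in> W\<close> keeps the result in the
  coset of \<open>x0\<close>; the old \<open>y\<close> is recovered from the new element and
  \<open>u\<close>.\<close>

lemma (in field) primitive_element_in_coset:
  assumes K: "subfield K R" and alg: "\<And>v. v \<in> carrier R \<Longrightarrow> (algebraic over K) v"
    and sep: "\<And>v. v \<in> carrier R \<Longrightarrow> separable_poly R K (Irr K v)"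
    and T: "infinite T" "T \<subseteq> K"
    and W: "\<zero> \<in> W" "\<And>v w. v \<in> W \<Longrightarrow> w \<in> W \<Longrightarrow> v \<oplus> w \<in> W"
    and x0: "x0 \<in> carrier R" and "set us \<subseteq> carrier R" "\<And>t u. t \<in> T \<Longrightarrow> u \<in> set us \<Longrightarrow> t \<otimes> u \<in> W"
  shows "\<exists>x\<in>carrier R. x \<ominus> x0 \<in> W \<and> x0 \<in> simple_extension K x \<and> set us \<subseteq> simple_extension K x"
  using assms(9-)
proof (induction us)
  case Nil
  have "x0 \<ominus> x0 \<in> W" using x0 W(1) by (simp add: r_neg a_minus_def)
  then show ?case using x0 simple_extension_mem[OF subfieldE(1)[OF K] x0] by (intro bexI[of _ x0]) auto
next
  case (Cons u us)
  then obtain y where y: "y \<in> carrier R" "y \<ominus> x0 \<in> W" "x0 \<in> simple_extension K y" "set us \<subseteq> simple_extension K y" by auto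
  have u: "u \<in> carrier R" using Cons by auto
  interpret ac: algebraic_closure alg_closure "indexed_const ` carrier R" by (rule alg_closureE(1))
  interpret ce: closure_embedding R alg_closure indexed_const
    by (intro closure_embedding.intro closure_embedding_axioms.intro field_axioms ac.algebraically_closed_axioms alg_closureE(2))
  have "finite {t \<in> K. u \<notin> simple_extension K (y \<oplus> t \<otimes> u)}"
    by (rule ce.finite_exceptional_multipliers[OF K alg y(1) u sep[OF u]])
  then have "\<not> T \<subseteq> {t \<in> K. u \<notin> simple_extension K (y \<oplus> t \<otimes> u)}" using T(1) finite_subset by blast
  then obtain t where t: "t \<in> T" "u \<in> simple_extension K (y \<oplus> t \<otimes> u)" using T(2) by blast
  define x where "x = y \<oplus> t \<otimes> u"
  have tK: "t \<in> K" using t T by auto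
  have tc: "t \<in> carrier R" using tK subfieldE(3)[OF K] by auto
  have xc: "x \<in> carrier R" unfolding x_def using y u tc by auto
  define F where "F = simple_extension K x"
  have F: "subring F R" unfolding F_def by (rule simple_extension_is_subring[OF subfieldE(1)[OF K] xc])
  have KF: "K \<subseteq> F" unfolding F_def by (rule simple_extension_incl[OF subfieldE(3)[OF K] xc])
  have xF: "x \<in> F" unfolding F_def by (rule simple_extension_mem[OF subfieldE(1)[OF K] xc])
  have uF: "u \<in> F" using t unfolding F_def x_def by simp
  have "\<ominus> t \<otimes> u \<in> F" using subringE(5,6)[OF F] tK KF uF by blast
  then have "x \<oplus> \<ominus> t \<otimes> u \<in> F" by (rule subringE(7)[OF F xF])
  moreover have "x \<oplus> \<ominus> t \<otimes> u = y" unfolding x_def using y(1) u tc by algebra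
  ultimately have "y \<in> F" by simp
  then have sub: "simple_extension K y \<subseteq> F" by (rule simple_extension_subring_incl[OF F KF])
  have "x \<ominus> x0 = (y \<ominus> x0) \<oplus> t \<otimes> u" unfolding x_def using y(1) u tc x0 by algebra
  then have "x \<ominus> x0 \<in> W" using W(2) y(2) Cons(3)[OF t(1)] by simp
  then show ?case using xc sub y uF unfolding F_def[symmetric] by (intro bexI[of _ x]) (auto simp: F_def)
qed

subsection \<open>Dedekind domains in finite separable extensions\<close>

locale dedekind_extension = field R for R (structure) +
  fixes K A :: "'a set"
  assumes K: "subfield K R" and dedekind: "dedekind_in R A" and fractions: "K = fraction_field R A"
    and finite_ext: "finite_dimension K (carrier R)" and separable: "separable_extension R K"
begin

abbreviation "B \<equiv> integral_closure R A"

sublocale A: noetherian_domain "R\<lparr>carrier := A\<rparr>"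
  using dedekind unfolding dedekind_in_def by simp

lemma subring_A: "subring A R"
  and maximal_A: "\<And>p. p \<in> nonzero_primes (R\<lparr>carrier := A\<rparr>) \<Longrightarrow> maximalideal p (R\<lparr>carrier := A\<rparr>)"
  and closed_A: "K \<inter> B = A"
  using dedekind unfolding dedekind_in_def fractions by simp_all

lemma noetherian_A: "noetherian_ring (R\<lparr>carrier := A\<rparr>)"
  by (rule A.noetherian_ring_axioms)

lemma A_carrier: "a \<in> A \<Longrightarrow> a \<in> carrier R"
  using subringE(1)[OF subring_A] by auto

lemma K_carrier: "a \<in> K \<Longrightarrow> a \<in> carrier R"
  using subfieldE(3)[OF K] by auto

lemma A_subset_K: "A \<subseteq> K"
  using closed_A by blast

lemma A_subset_B: "A \<subseteq> B"
  by (rule subset_integral_closure[OF subring_A])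

lemma subring_B: "subring B R"
  by (rule integral_closure_subring[OF subring_A noetherian_A])

abbreviation (input) "primes_A \<equiv> nonzero_primes (R\<lparr>carrier := A\<rparr>)"
abbreviation (input) "primes_B \<equiv> nonzero_primes (R\<lparr>carrier := B\<rparr>)"

lemmas A_add = subringE(7)[OF subring_A] and A_mult = subringE(6)[OF subring_A]
  and B_add = subringE(7)[OF subring_B] and B_mult = subringE(6)[OF subring_B]

lemma B_carrier: "b \<in> B \<Longrightarrow> b \<in> carrier R"
  using subringE(1)[OF subring_B] by auto

lemma algebraic: "v \<in> carrier R \<Longrightarrow> (algebraic over K) v"
  using separable unfolding separable_extension_def over_def by simp

lemma separable_Irr: "v \<in> carrier R \<Longrightarrow> separable_poly R K (Irr K v)"
  using separable unfolding separable_extension_def by simp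

section \<open>Denominators, and primes of B over primes of A\<close>

text \<open>The constant term of an integral equation is a multiple of \<open>b\<close>; as long as
  it is zero, \<open>b\<close> can be cancelled from the equation.\<close>

lemma exists_multiple_in_A:
  assumes b: "b \<in> B" "b \<noteq> \<zero>"
  shows "\<exists>c\<in>B. c \<otimes> b \<in> A \<and> c \<otimes> b \<noteq> \<zero>"
proof -
  have bc: "b \<in> carrier R" using b B_carrier by auto
  have "\<exists>c\<in>B. c \<otimes> b \<in> A \<and> c \<otimes> b \<noteq> \<zero>" if "set P \<subseteq> A" "eval (\<one> # P) b = \<zero>" for P
    using that
  proof (induction P rule: rev_induct)
    case Nil
    then show ?case using bc by simp
  next
    case (snoc a P)
    have PA: "set (\<one> # P) \<subseteq> A" "a \<in> A" using snoc subringE(3)[OF subring_A] by auto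
    then have Pc: "set (\<one> # P) \<subseteq> carrier R" and ac: "a \<in> carrier R" using A_carrier by auto
    define e where "e = eval (\<one> # P) b"
    have eB: "e \<in> B" unfolding e_def by (rule eval_mult_in_subring[OF subring_B _ b(1)]) (use PA A_subset_B in auto)
    have ec: "e \<in> carrier R" using eB B_carrier by auto
    have eq: "e \<otimes> b \<oplus> a = \<zero>" using eval_append_aux[OF Pc ac bc] snoc(3) unfolding e_def by simp
    show ?case
    proof (cases "a = \<zero>")
      case True
      then have "e = \<zero>" using eq ec bc b(2) integral[of e b] by auto
      then show ?thesis using snoc(1) PA unfolding e_def by simp
    next
      case False
      have "\<ominus> e \<otimes> b = (\<zero> \<ominus> (e \<otimes> b \<oplus> a)) \<oplus> a" using ec bc ac by algebra
      then have "\<ominus> e \<otimes> b = a" unfolding eq using ac by (simp add: a_minus_def)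
      then show ?thesis using False PA(2) subringE(5)[OF subring_B eB] by metis
    qed
  qed
  then show ?thesis using b(1) mem_integral_closure[OF subring_A] by blast
qed

lemma exists_multiple_in_B:
  assumes v: "v \<in> carrier R"
  shows "\<exists>a\<in>A - {\<zero>}. a \<otimes> v \<in> B"
proof -
  note irr = IrrE[OF K v algebraic[OF v]]
  obtain P where P: "Irr K v = \<one> # P"
    using Irr_props(2)[OF K v algebraic[OF v]] irr(3) by (cases "Irr K v") auto
  have PK: "set P \<subseteq> K" using Irr_props(1)[OF K v algebraic[OF v]] P by auto
  have "\<exists>a\<in>A - {\<zero>}. \<forall>k\<in>set P. a \<otimes> k \<in> A"
  proof (rule exists_common_multiplier[OF subring_A])
    fix k assume "k \<in> set P"
    then obtain n d where nd: "n \<in> A" "d \<in> A" "d \<noteq> \<zero>" "k = n \<otimes> inv d"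
      using PK unfolding fractions fraction_field_def by auto
    have c: "n \<in> carrier R" "d \<in> carrier R" "d \<in> Units R"
      using nd A_carrier by (auto simp: field_Units)
    have "d \<otimes> k = n" unfolding nd(4) using c m_lcomm[of d n "inv d"] by simp
    then show "\<exists>a\<in>A - {\<zero>}. a \<otimes> k \<in> A" using nd by blast
  qed (use PK K_carrier A_mult in auto)
  then obtain a where a: "a \<in> A" "a \<noteq> \<zero>" "\<forall>k\<in>set P. a \<otimes> k \<in> A" by blast
  have ac: "a \<in> carrier R" using a A_carrier by auto
  \<comment> \<open>The coefficient \<open>i\<close> places after the leading one is multiplied by
    \<open>a [^] i\<close>. This makes \<open>a \<otimes> v\<close> a root, and the first factor
    \<open>a\<close> already brings the coefficient into \<open>A\<close>.\<close>
  have "\<exists>P'. set P' \<subseteq> A \<and> eval (\<one> # P') (a \<otimes> v) = a [^] length P \<otimes> eval (\<one> # P) v"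
    using PK a(3)
  proof (induction P rule: rev_induct)
    case Nil
    then show ?case using ac v by (intro exI[of _ "[]"]) simp
  next
    case (snoc k P)
    then obtain P' where P': "set P' \<subseteq> A" "eval (\<one> # P') (a \<otimes> v) = a [^] length P \<otimes> eval (\<one> # P) v" by auto
    have c: "set (\<one> # P') \<subseteq> carrier R" "set (\<one> # P) \<subseteq> carrier R" "k \<in> carrier R"
      using P'(1) snoc(2) A_carrier K_carrier by auto
    define e where "e = eval (\<one> # P) v"
    define p where "p = a [^] length P"
    have ec: "e \<in> carrier R" "p \<in> carrier R" unfolding e_def p_def using eval_in_carrier[OF c(2) v] ac by auto
    have "a [^] n \<in> A" for n :: nat by (induction n) (use a(1) A_mult subringE(3)[OF subring_A] in auto)
    then have pA: "p \<in> A" unfolding p_def .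
    have "eval ((\<one> # P') @ [p \<otimes> (a \<otimes> k)]) (a \<otimes> v) = p \<otimes> e \<otimes> (a \<otimes> v) \<oplus> p \<otimes> (a \<otimes> k)"
      using eval_append_aux[OF c(1), of "p \<otimes> (a \<otimes> k)" "a \<otimes> v"] P'(2) ac v c(3) ec(2) unfolding e_def p_def by simp
    also have "\<dots> = p \<otimes> a \<otimes> (e \<otimes> v \<oplus> k)" using ec ac v c(3) by algebra
    also have "\<dots> = a [^] length (P @ [k]) \<otimes> eval ((\<one> # P) @ [k]) v"
      using eval_append_aux[OF c(2,3) v] unfolding e_def p_def by simp
    finally have "eval (\<one> # P' @ [p \<otimes> (a \<otimes> k)]) (a \<otimes> v) = a [^] length (P @ [k]) \<otimes> eval (\<one> # P @ [k]) v" by simp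
    moreover have "set (P' @ [p \<otimes> (a \<otimes> k)]) \<subseteq> A" using P'(1) A_mult[OF pA] snoc(3) by simp
    ultimately show ?case by blast
  qed
  then have "a \<otimes> v \<in> B" using mem_integral_closure[OF subring_A] irr(4) P ac v by auto
  then show ?thesis using a by blast
qed

lemma prime_under:
  assumes q: "q \<in> primes_B"
  shows "A \<inter> q \<in> primes_A"
proof -
  note qD = subring_primeD[OF subring_B q]
  have AB: "a \<in> A \<Longrightarrow> a \<in> B" for a using A_subset_B by auto
  have id: "ideal (A \<inter> q) (R\<lparr>carrier := A\<rparr>)"
    by (rule subring_idealI[OF subring_A])
       (use subring_idealD(2)[OF qD(2)] qD(7,9) AB A_add A_mult subringE(2)[OF subring_A] in auto)
  have "carrier (R\<lparr>carrier := A\<rparr>) \<noteq> A \<inter> q" using subringE(3)[OF subring_A] qD(5) by auto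
  then have "primeideal (A \<inter> q) (R\<lparr>carrier := A\<rparr>)"
    by (rule primeidealI[OF id A.is_cring]) (use qD(6) AB in auto)
  moreover have "A \<inter> q \<noteq> {\<zero>}"
  proof -
    obtain b where b: "b \<in> q" "b \<noteq> \<zero>" using qD(3) subring_idealD(2)[OF qD(2)] by blast
    then have "b \<in> B" using qD(4) by auto
    then obtain c where c: "c \<in> B" "c \<otimes> b \<in> A" "c \<otimes> b \<noteq> \<zero>" using exists_multiple_in_A b(2) by blast
    then show ?thesis using qD(9)[OF c(1) b(1)] by blast
  qed
  ultimately show ?thesis unfolding nonzero_primes_def by simp
qed

text \<open>Modulo \<open>q\<close>, the element \<open>b\<close> is integral over the field
  \<open>A / (A \<inter> q)\<close>. Trailing coefficients in \<open>q\<close> are dropped,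
  cancelling \<open>b\<close> each time; the first one outside is invertible modulo
  \<open>q\<close>, and the remaining equation then inverts \<open>b\<close>.\<close>

lemma maximal_B:
  assumes q: "q \<in> primes_B"
  shows "maximalideal q (R\<lparr>carrier := B\<rparr>)"
proof -
  note qD = subring_primeD[OF subring_B q]
  have inverse: "\<exists>v\<in>B. v \<otimes> b \<ominus> \<one> \<in> q" if b: "b \<in> B" "b \<notin> q" for b
  proof -
    have bc: "b \<in> carrier R" using b B_carrier by auto
    have "\<exists>v\<in>B. v \<otimes> b \<ominus> \<one> \<in> q" if "set P \<subseteq> A" "eval (\<one> # P) b \<in> q" for P
      using that
    proof (induction P rule: rev_induct)
      case Nil
      then show ?case using bc qD(5) by simp
    next
      case (snoc a P)
      have PA: "set (\<one> # P) \<subseteq> A" "a \<in> A" using snoc subringE(3)[OF subring_A] by auto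
      then have Pc: "set (\<one> # P) \<subseteq> carrier R" and ac: "a \<in> carrier R" using A_carrier by auto
      define e where "e = eval (\<one> # P) b"
      have eB: "e \<in> B" unfolding e_def by (rule eval_mult_in_subring[OF subring_B _ b(1)]) (use PA A_subset_B in auto)
      have ec: "e \<in> carrier R" using eB B_carrier by auto
      have eq: "e \<otimes> b \<oplus> a \<in> q" using eval_append_aux[OF Pc ac bc] snoc(3) unfolding e_def by simp
      show ?case
      proof (cases "a \<in> q")
        case True
        have "(e \<otimes> b \<oplus> a) \<ominus> a \<in> q" by (rule qD(8)[OF eq True])
        moreover have "(e \<otimes> b \<oplus> a) \<ominus> a = e \<otimes> b" using ec bc ac by algebra
        ultimately have "e \<in> q" using qD(6)[OF eB b(1)] b(2) by auto
        then show ?thesis using snoc(1) PA unfolding e_def by simp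
      next
        case False
        obtain v where v: "v \<in> A" "v \<otimes> a \<ominus>\<^bsub>R\<lparr>carrier := A\<rparr>\<^esub> \<one> \<in> A \<inter> q"
          using A.maximalideal_inverse[OF maximal_A[OF prime_under[OF q]], of a] PA(2) False by auto
        have vc: "v \<in> carrier R" using v A_carrier by auto
        have va: "v \<otimes> a \<ominus> \<one> \<in> q"
          using v(2) subring_a_inv[OF subring_A subringE(3)[OF subring_A]] unfolding a_minus_def by simp
        have "(v \<otimes> a \<ominus> \<one>) \<ominus> v \<otimes> (e \<otimes> b \<oplus> a) \<in> q"
          by (rule qD(8)[OF va qD(9)[OF subsetD[OF A_subset_B v(1)] eq]])
        moreover have "(v \<otimes> a \<ominus> \<one>) \<ominus> v \<otimes> (e \<otimes> b \<oplus> a) = (\<ominus> (v \<otimes> e)) \<otimes> b \<ominus> \<one>"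
          using ec bc ac vc by algebra
        moreover have "\<ominus> (v \<otimes> e) \<in> B"
          by (intro subringE(5)[OF subring_B] B_mult subsetD[OF A_subset_B v(1)] eB)
        ultimately show ?thesis by metis
      qed
    qed
    then show ?thesis using b(1) mem_integral_closure[OF subring_A] subring_idealD(2)[OF qD(2)] by metis
  qed
  show ?thesis
  proof (rule maximalidealI[OF qD(2)])
    show "carrier (R\<lparr>carrier := B\<rparr>) \<noteq> q" using qD(5) subringE(3)[OF subring_B] by auto
    fix J assume J: "ideal J (R\<lparr>carrier := B\<rparr>)" "q \<subseteq> J" "J \<subseteq> carrier (R\<lparr>carrier := B\<rparr>)"
    note JI = subring_idealD[OF J(1)]
    show "J = q \<or> J = carrier (R\<lparr>carrier := B\<rparr>)"
    proof (rule disjCI)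
      assume "J \<noteq> carrier (R\<lparr>carrier := B\<rparr>)"
      then have J1: "\<one> \<notin> J" using ideal.one_imp_carrier[OF J(1)] by auto
      have "b \<in> q" if b: "b \<in> J" for b
      proof (rule ccontr)
        assume nb: "b \<notin> q"
        have bB: "b \<in> B" using JI(1) b by auto
        obtain v where v: "v \<in> B" "v \<otimes> b \<ominus> \<one> \<in> q" using inverse[OF bB nb] by blast
        have vb: "v \<otimes> b \<in> J" by (rule JI(4)[OF v(1) b])
        have "\<ominus> \<one> \<otimes> (v \<otimes> b \<ominus> \<one>) \<in> J" using JI(4) subringE(3,5)[OF subring_B] v(2) J(2) by blast
        then have "v \<otimes> b \<oplus> \<ominus> \<one> \<otimes> (v \<otimes> b \<ominus> \<one>) \<in> J" by (rule JI(3)[OF vb])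
        moreover have "v \<otimes> b \<oplus> \<ominus> \<one> \<otimes> (v \<otimes> b \<ominus> \<one>) = \<one>" using B_carrier[OF v(1)] B_carrier[OF bB] by algebra
        ultimately show False using J1 by simp
      qed
      then show "J = q" using J(2) by blast
    qed
  qed
qed

section \<open>Primitive elements and finiteness of B over A\<close>

lemma exists_basis_generators:
  "\<exists>us. set us \<subseteq> carrier R \<and> (\<forall>F. subring F R \<longrightarrow> K \<subseteq> F \<longrightarrow> set us \<subseteq> F \<longrightarrow> F = carrier R)"
proof -
  obtain n where "dimension n K (carrier R)" using finite_ext by auto
  then obtain us where us: "set us \<subseteq> carrier R" "Span K us = carrier R" using exists_base[OF K] by blast
  have "F = carrier R" if F: "subring F R" "K \<subseteq> F" "set us \<subseteq> F" for F
  proof -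
    have "subgroup F (add_monoid R)" using subring.axioms(1)[OF F(1)] .
    moreover have "K <#> set us \<subseteq> F" unfolding set_mult_def using F subringE(6)[OF F(1)] by auto
    ultimately have "Span K us \<subseteq> F" by (rule Span_min[OF K us(1)])
    then show ?thesis using us(2) subringE(1)[OF F(1)] by auto
  qed
  then show ?thesis using us by blast
qed

text \<open>The element \<open>x0\<close> changes only by a multiple of \<open>e\<close>, so
  conditions arranged for \<open>x0\<close> modulo \<open>e\<close> survive.\<close>

lemma exists_primitive_element:
  assumes inf: "infinite A" and e: "e \<in> A" "e \<noteq> \<zero>" and x0: "x0 \<in> carrier R"
  shows "\<exists>x\<in>carrier R. (\<exists>b\<in>B. x = x0 \<oplus> e \<otimes> b) \<and> simple_extension K x = carrier R"
proof -
  obtain us where us: "set us \<subseteq> carrier R" "\<And>F. subring F R \<Longrightarrow> K \<subseteq> F \<Longrightarrow> set us \<subseteq> F \<Longrightarrow> F = carrier R"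
    using exists_basis_generators by blast
  have "\<exists>a\<in>A - {\<zero>}. \<forall>u\<in>set us. a \<otimes> u \<in> B"
    by (rule exists_common_multiplier[OF subring_A])
       (use us(1) B_mult A_subset_B exists_multiple_in_B in auto)
  then obtain a where a: "a \<in> A" "a \<noteq> \<zero>" "\<forall>u\<in>set us. a \<otimes> u \<in> B" by blast
  have c: "a \<in> carrier R" "e \<in> carrier R" using a e A_carrier by auto
  \<comment> \<open>Since \<open>a\<close> carries the generators into \<open>B\<close>, every
    element of \<open>T\<close> carries them into \<open>e B\<close>; and \<open>T\<close> is as
    infinite as \<open>A\<close>.\<close>
  define T where "T = (\<lambda>w. w \<otimes> (e \<otimes> a)) ` A"
  have ea: "e \<otimes> a \<noteq> \<zero>" using integral[OF _ c(2,1)] e a by auto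
  have "inj_on (\<lambda>w. w \<otimes> (e \<otimes> a)) A"
    by (rule inj_onI) (use m_rcancel[OF ea] A_carrier c in auto)
  then have Tinf: "infinite T" unfolding T_def using inf finite_imageD by blast
  have TK: "T \<subseteq> K" unfolding T_def using A_mult[OF _ A_mult[OF e(1) a(1)]] A_subset_K by auto
  define W where "W = (\<lambda>b. e \<otimes> b) ` B"
  have "\<exists>x\<in>carrier R. x \<ominus> x0 \<in> W \<and> x0 \<in> simple_extension K x \<and> set us \<subseteq> simple_extension K x"
  proof (rule primitive_element_in_coset[OF K algebraic separable_Irr Tinf TK _ _ x0 us(1)])
    show "\<zero> \<in> W" unfolding W_def using subringE(2)[OF subring_B] c by (auto intro!: image_eqI[of _ _ \<zero>])
  next
    fix v w assume "v \<in> W" "w \<in> W"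
    then obtain b b' where b: "b \<in> B" "b' \<in> B" "v = e \<otimes> b" "w = e \<otimes> b'" unfolding W_def by blast
    then have "v \<oplus> w = e \<otimes> (b \<oplus> b')" using B_carrier c by (simp add: r_distr)
    then show "v \<oplus> w \<in> W" unfolding W_def using B_add[OF b(1,2)] by blast
  next
    fix t u assume "t \<in> T" and u: "u \<in> set us"
    then obtain w where w: "w \<in> A" "t = w \<otimes> (e \<otimes> a)" unfolding T_def by blast
    have wc: "w \<in> carrier R" "u \<in> carrier R" using w A_carrier us u by auto
    have "t \<otimes> u = e \<otimes> (w \<otimes> (a \<otimes> u))" unfolding w(2) using wc c by (simp add: m_ac)
    moreover have "w \<otimes> (a \<otimes> u) \<in> B" using B_mult w(1) A_subset_B a(3) u by auto
    ultimately show "t \<otimes> u \<in> W" unfolding W_def by blast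
  qed
  then obtain x b where x: "x \<in> carrier R" "b \<in> B" "x \<ominus> x0 = e \<otimes> b" "set us \<subseteq> simple_extension K x"
    unfolding W_def by blast
  have "x = x0 \<oplus> (x \<ominus> x0)" using x(1) x0 by algebra
  then have "x = x0 \<oplus> e \<otimes> b" using x(3) by simp
  moreover have "simple_extension K x = carrier R"
    by (rule us(2)[OF simple_extension_is_subring[OF subfieldE(1)[OF K] x(1)]
          simple_extension_incl[OF subfieldE(3)[OF K] x(1)] x(4)])
  ultimately show ?thesis using x by blast
qed

lemma primitive_element_conductor:
  assumes \<alpha>: "\<alpha> \<in> B" "simple_extension K \<alpha> = carrier R"
  shows "set (Irr K \<alpha>) \<subseteq> A \<and>
    (\<exists>D\<in>carrier R. D \<noteq> \<zero> \<and> (\<forall>b\<in>B. \<exists>g. set g \<subseteq> A \<and> length g < length (Irr K \<alpha>) \<and> D \<otimes> b = eval g \<alpha>))"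
proof -
  interpret ac: algebraic_closure alg_closure "indexed_const ` carrier R" by (rule alg_closureE(1))
  interpret ce: closure_embedding R alg_closure indexed_const
    by (intro closure_embedding.intro closure_embedding_axioms.intro field_axioms ac.algebraically_closed_axioms alg_closureE(2))
  show ?thesis
    by (rule ce.integral_coefficients[OF subring_A noetherian_A K A_subset_K _ \<alpha>(1) algebraic separable_Irr \<alpha>(2)])
       (use closed_A \<alpha>(1) B_carrier in auto)
qed

text \<open>Divide the inclusion of \<open>D B\<close> in \<open>A[\<alpha>]\<close> by
  \<open>D\<close>: the generators are the powers of \<alpha> below the degree, divided by
  \<open>D\<close>. The choices \<open>x0 = \<zero>\<close> and \<open>e = \<one>\<close> put the
  primitive element into \<open>B\<close>.\<close>

lemma B_subset_mspan:
  assumes inf: "infinite A"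
  shows "\<exists>G. finite G \<and> G \<subseteq> carrier R \<and> B \<subseteq> mspan A G"
proof -
  have one: "\<one> \<in> A" "\<one> \<noteq> \<zero>" using subringE(3)[OF subring_A] by auto
  obtain \<alpha> b where \<alpha>: "\<alpha> \<in> carrier R" "b \<in> B" "\<alpha> = \<zero> \<oplus> \<one> \<otimes> b" "simple_extension K \<alpha> = carrier R"
    using exists_primitive_element[OF inf one zero_closed] by blast
  have \<alpha>B: "\<alpha> \<in> B" using \<alpha>(2,3) B_carrier by simp
  obtain D where D: "D \<in> carrier R" "D \<noteq> \<zero>"
    "\<forall>b\<in>B. \<exists>g. set g \<subseteq> A \<and> length g < length (Irr K \<alpha>) \<and> D \<otimes> b = eval g \<alpha>"
    using primitive_element_conductor[OF \<alpha>B \<alpha>(4)] by blast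
  have U: "D \<in> Units R" using D by (simp add: field_Units)
  define G where "G = (\<lambda>i::nat. \<alpha> [^] i \<otimes> inv D) ` {..<length (Irr K \<alpha>)}"
  have G: "finite G" "G \<subseteq> carrier R" unfolding G_def using \<alpha>(1) U by auto
  have "b \<in> mspan A G" if b: "b \<in> B" for b
  proof -
    obtain g where g: "set g \<subseteq> A" "length g < length (Irr K \<alpha>)" "D \<otimes> b = eval g \<alpha>" using D(3) b by blast
    have "eval g \<alpha> \<otimes> inv D \<in> mspan A G"
    proof (rule eval_mult_in_submodule[OF subring_A mspan_submodule[OF subring_A G(2)] \<alpha>(1) Units_inv_closed[OF U] g(1)])
      fix i assume "i < length g"
      then show "\<alpha> [^] i \<otimes> inv D \<in> mspan A G"
        using mspan_incl[OF subring_A, of "\<alpha> [^] i \<otimes> inv D" G] \<alpha>(1) U g(2) unfolding G_def by auto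
    qed
    moreover have "D \<otimes> b \<otimes> inv D = b" using U D(1) B_carrier[OF b] by (simp add: m_comm[of D b] m_assoc)
    ultimately show ?thesis using g(3) by simp
  qed
  then show ?thesis using G by blast
qed

text \<open>Ideals of \<open>B\<close> are \<open>A\<close>-submodules of a finitely generated
  module, so \<open>B\<close> is noetherian. If \<open>x\<close> preserves an ideal with a nonzero
  element \<open>u\<close>, all \<open>x [^] k \<otimes> u\<close> lie in that module, so
  \<open>x\<close> is integral.\<close>

lemma dedekind_subring_B:
  assumes inf: "infinite A"
  shows "dedekind_subring R B"
proof -
  obtain G where G: "finite G" "G \<subseteq> carrier R" "B \<subseteq> mspan A G" using B_subset_mspan[OF inf] by blast
  interpret S: domain "R\<lparr>carrier := B\<rparr>" by (rule subring_is_domain[OF subring_B])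
  have sub: "submodule_over R A I" if I: "ideal I (R\<lparr>carrier := B\<rparr>)" for I
    using subring_idealD[OF I] B_carrier A_subset_B unfolding submodule_over_def by auto
  have "noetherian_ring (R\<lparr>carrier := B\<rparr>)"
  proof (rule S.noetherian_ringI)
    fix I assume I: "ideal I (R\<lparr>carrier := B\<rparr>)"
    note ID = subring_idealD[OF I]
    obtain H where H: "H \<subseteq> I" "finite H" "I \<subseteq> mspan A H"
      using submodule_of_mspan_finitely_generated[OF subring_A noetherian_A G(1,2) sub[OF I]] ID(1) G(3) by blast
    have Hc: "H \<subseteq> carrier (R\<lparr>carrier := B\<rparr>)" using H ID(1) by auto
    have "mspan A H \<subseteq> Idl\<^bsub>R\<lparr>carrier := B\<rparr>\<^esub> H"
      by (rule mspan_least[OF subring_A sub[OF S.genideal_ideal[OF Hc]] S.genideal_self[OF Hc]])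
    then have "I = Idl\<^bsub>R\<lparr>carrier := B\<rparr>\<^esub> H" using H(3) S.genideal_minimal[OF I H(1)] by blast
    then show "\<exists>H\<subseteq>carrier (R\<lparr>carrier := B\<rparr>). finite H \<and> I = Idl\<^bsub>R\<lparr>carrier := B\<rparr>\<^esub> H"
      using Hc H(2) by blast
  qed
  then have "noetherian_domain (R\<lparr>carrier := B\<rparr>)"
    by (intro noetherian_domain.intro S.domain_axioms)
  moreover have "dedekind_subring_axioms R B"
  proof (rule dedekind_subring_axioms.intro)
    show "subring B R" by (rule subring_B)
    show "maximalideal q (R\<lparr>carrier := B\<rparr>)" if "q \<in> primes_B" for q
      using maximal_B that .
    fix x I assume x: "x \<in> carrier R" and I: "ideal I (R\<lparr>carrier := B\<rparr>)" "I \<noteq> {\<zero>}" and xI: "\<And>y. y \<in> I \<Longrightarrow> x \<otimes> y \<in> I"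
    note ID = subring_idealD[OF I(1)]
    obtain u where u: "u \<in> I" "u \<noteq> \<zero>" using I(2) ID(2) by blast
    have uc: "u \<in> carrier R" using u ID(1) B_carrier by auto
    show "x \<in> B"
    proof (rule integralI_powers_in_mspan[OF subring_A noetherian_A G(1,2) x uc u(2)])
      fix k :: nat
      have "x [^] k \<otimes> u \<in> I"
      proof (induction k)
        case (Suc k)
        have "x [^] Suc k \<otimes> u = x \<otimes> (x [^] k \<otimes> u)" using x uc by (simp add: m_ac)
        then show ?case using xI[OF Suc] by simp
      qed (use u uc in simp)
      then show "x [^] k \<otimes> u \<in> mspan A G" using ID(1) G(3) by blast
    qed
  qed
  ultimately show ?thesis by (intro dedekind_subring.intro field_axioms)
qed

end

subsection \<open>Ideals avoiding given primes\<close>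

context dedekind_extension
begin

lemma fractional_idealD:
  assumes "M \<in> fractional_ideals R B"
  shows "M \<subseteq> carrier R" "\<zero> \<in> M" "\<And>x y. x \<in> M \<Longrightarrow> y \<in> M \<Longrightarrow> x \<oplus> y \<in> M"
    "\<And>b m. b \<in> B \<Longrightarrow> m \<in> M \<Longrightarrow> b \<otimes> m \<in> M" "M \<noteq> {\<zero>}"
    "\<exists>d\<in>B - {\<zero>}. \<forall>m\<in>M. d \<otimes> m \<in> B"
proof -
  have M: "additive_subgroup M R" using assms unfolding fractional_ideals_def by simp
  show "M \<subseteq> carrier R" "\<zero> \<in> M" "\<And>x y. x \<in> M \<Longrightarrow> y \<in> M \<Longrightarrow> x \<oplus> y \<in> M"
    using additive_subgroup.a_subset[OF M] additive_subgroup.zero_closed[OF M] additive_subgroup.a_closed[OF M] by auto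
  show "\<And>b m. b \<in> B \<Longrightarrow> m \<in> M \<Longrightarrow> b \<otimes> m \<in> M" "M \<noteq> {\<zero>}" "\<exists>d\<in>B - {\<zero>}. \<forall>m\<in>M. d \<otimes> m \<in> B"
    using assms unfolding fractional_ideals_def by simp_all
qed

lemma scaled_fractional_ideal:
  assumes M: "M \<in> fractional_ideals R B" and x: "x \<in> carrier R" "\<And>m. m \<in> M \<Longrightarrow> x \<otimes> m \<in> B"
  shows "ideal ((\<otimes>) x ` M) (R\<lparr>carrier := B\<rparr>)"
proof -
  note MD = fractional_idealD[OF M]
  show ?thesis
  proof (rule subring_idealI[OF subring_B])
    show "(\<otimes>) x ` M \<subseteq> B" using x(2) by blast
    show "\<zero> \<in> (\<otimes>) x ` M" using MD(2) x(1) by (intro image_eqI[of _ _ \<zero>]) simp_all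
  next
    fix y z assume "y \<in> (\<otimes>) x ` M" "z \<in> (\<otimes>) x ` M"
    then obtain m n where mn: "m \<in> M" "n \<in> M" "y = x \<otimes> m" "z = x \<otimes> n" by blast
    have "m \<in> carrier R" "n \<in> carrier R" using mn MD(1) by blast+
    then have "y \<oplus> z = x \<otimes> (m \<oplus> n)" unfolding mn using x(1) by (simp add: r_distr)
    then show "y \<oplus> z \<in> (\<otimes>) x ` M" using MD(3)[OF mn(1,2)] by blast
  next
    fix b y assume b: "b \<in> B" and "y \<in> (\<otimes>) x ` M"
    then obtain m where m: "m \<in> M" "y = x \<otimes> m" by blast
    have "m \<in> carrier R" using m MD(1) by blast
    then have "b \<otimes> y = x \<otimes> (b \<otimes> m)" unfolding m using x(1) B_carrier[OF b] by (simp add: m_ac)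
    then show "b \<otimes> y \<in> (\<otimes>) x ` M" using MD(4)[OF b m(1)] by blast
  qed
qed

lemma length_Irr_primitive:
  assumes "dimension n K (carrier R)" "x \<in> carrier R" "simple_extension K x = carrier R"
  shows "length (Irr K x) = Suc n" "Irr K x \<noteq> []"
proof -
  show ne: "Irr K x \<noteq> []" by (rule Irr_props(2)[OF K assms(2) algebraic[OF assms(2)]])
  have "dimension (degree (Irr K x)) K (carrier R)"
    using dimension_simple_extension[OF K assms(2) algebraic[OF assms(2)]] assms(3) by simp
  then have "degree (Irr K x) = n" using dimension_is_inj[OF K] assms(1) by blast
  then show "length (Irr K x) = Suc n" using ne by (cases "Irr K x") auto
qed

lemmas primes_A_D = subring_primeD[OF subring_A] and primes_B_D = subring_primeD[OF subring_B]

text \<open>The choices of the overview are made for \<open>N\<close>, which is \<open>M\<close>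
  divided by one of its nonzero elements \<open>m0\<close>; then \<open>\<one> \<in> N\<close>, so
  \<beta> itself lies in \<beta>N. The multiplier for \<open>M\<close> is \<beta> divided by
  \<open>m0\<close>.\<close>

lemma exists_degree_one_multiple:
  assumes inf: "infinite A" and Q: "finite Q" "Q \<subseteq> primes_B" "Q \<noteq> {}"
    and M: "M \<in> fractional_ideals R B"
  shows "\<exists>x\<in>carrier R - {\<zero>}. (\<forall>m\<in>M. x \<otimes> m \<in> B) \<and>
    (\<forall>q\<in>primes_B. (\<otimes>) x ` M \<subseteq> q \<longrightarrow> q \<notin> Q \<and> A <+> q = B) \<and>
    (\<forall>q\<in>primes_B. \<forall>q'\<in>primes_B.
      (\<otimes>) x ` M \<subseteq> q \<longrightarrow> (\<otimes>) x ` M \<subseteq> q' \<longrightarrow> q \<noteq> q' \<longrightarrow> A \<inter> q \<noteq> A \<inter> q')"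
proof -
  interpret D: dedekind_subring R B by (rule dedekind_subring_B[OF inf])
  note MD = fractional_idealD[OF M]
  note AB = subsetD[OF A_subset_B]
  have B_diff: "u \<ominus> v \<in> B" if "u \<in> B" "v \<in> B" for u v
    using that subringE(5,7)[OF subring_B] by (simp add: a_minus_def)
  obtain m0 where m0: "m0 \<in> M" "m0 \<noteq> \<zero>" using MD(2,5) by blast
  have m0c: "m0 \<in> carrier R" using m0 MD(1) by auto
  have U: "m0 \<in> Units R" using m0 m0c by (simp add: field_Units)
  have inv0: "inv m0 \<noteq> \<zero>"
    using U m0c by (metis Units_inv_Units Units_r_inv r_null one_not_zero)
  obtain d0 where d0: "d0 \<in> B" "d0 \<noteq> \<zero>" "\<forall>m\<in>M. d0 \<otimes> m \<in> B" using MD(6) by blast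
  have dm: "d0 \<otimes> m0 \<in> B" "d0 \<otimes> m0 \<noteq> \<zero>" using d0 m0 integral[OF _ B_carrier[OF d0(1)] m0c] by auto
  obtain c0 where c0: "c0 \<in> B" "c0 \<otimes> (d0 \<otimes> m0) \<in> A" "c0 \<otimes> (d0 \<otimes> m0) \<noteq> \<zero>"
    using exists_multiple_in_A[OF dm] by blast
  \<comment> \<open>As \<open>d0\<close> is a denominator of \<open>M\<close>, the product
    \<open>d0 \<otimes> m0\<close> is one of \<open>N\<close>, and \<open>c0\<close> moves it into
    \<open>A\<close>.\<close>
  define j where "j = c0 \<otimes> (d0 \<otimes> m0)"
  have j: "j \<in> A" "j \<noteq> \<zero>" using c0 unfolding j_def by auto
  have jc: "j \<in> carrier R" using j A_carrier by auto
  define N where "N = (\<otimes>) (inv m0) ` M"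
  have Nc: "n \<in> carrier R" if "n \<in> N" for n using that U MD(1) unfolding N_def by auto
  have N1: "\<one> \<in> N" unfolding N_def using m0 U by (intro image_eqI[of _ _ m0]) simp_all
  have NB: "b \<otimes> n \<in> N" if b: "b \<in> B" and n: "n \<in> N" for b n
  proof -
    obtain m where m: "m \<in> M" "n = inv m0 \<otimes> m" using n unfolding N_def by blast
    have "m \<in> carrier R" using m MD(1) by blast
    then have "b \<otimes> n = inv m0 \<otimes> (b \<otimes> m)" unfolding m using U B_carrier[OF b] by (simp add: m_ac)
    then show ?thesis unfolding N_def using MD(4)[OF b m(1)] by blast
  qed
  have jN: "j \<otimes> n \<in> B" if n: "n \<in> N" for n
  proof -
    obtain m where m: "m \<in> M" "n = inv m0 \<otimes> m" using n unfolding N_def by blast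
    have mc: "m \<in> carrier R" using m MD(1) by blast
    have "j \<otimes> n = c0 \<otimes> (d0 \<otimes> m) \<otimes> (m0 \<otimes> inv m0)"
      unfolding m j_def using U m0c mc B_carrier[OF c0(1)] B_carrier[OF d0(1)] by (simp add: m_ac del: Units_r_inv)
    then have "j \<otimes> n = c0 \<otimes> (d0 \<otimes> m)" using U mc B_carrier[OF c0(1)] B_carrier[OF d0(1)] by simp
    then show ?thesis using d0(3) m(1) B_mult[OF c0(1)] by simp
  qed
  have scaleN: "(\<otimes>) (x \<otimes> inv m0) ` M = (\<otimes>) x ` N" if "x \<in> carrier R" for x
  proof -
    have "(x \<otimes> inv m0) \<otimes> m = x \<otimes> (inv m0 \<otimes> m)" if "m \<in> M" for m
      using \<open>x \<in> carrier R\<close> that MD(1) U by (intro m_assoc) auto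
    then show ?thesis unfolding N_def image_image by (intro image_cong) auto
  qed

  obtain n where n: "dimension n K (carrier R)" using finite_ext by auto
  \<comment> \<open>The size \<open>Suc n\<close> is the length of the coefficient list
    \<open>f\<close> below, one more than its possible number of roots.\<close>
  obtain Z where Z: "Z \<subseteq> A" "finite Z" "card Z = Suc n" using infinite_arbitrarily_large[OF inf] by blast
  have dZ: "(\<lambda>(x, y). x \<ominus> y) ` {(x, y). x \<in> Z \<and> y \<in> Z \<and> x \<noteq> y} \<subseteq> A - {\<zero>}"
  proof
    fix v assume "v \<in> (\<lambda>(x, y). x \<ominus> y) ` {(x, y). x \<in> Z \<and> y \<in> Z \<and> x \<noteq> y}"
    then obtain x y where xy: "x \<in> A" "y \<in> A" "x \<noteq> y" "v = x \<ominus> y" using Z(1) by auto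
    then have "v \<in> A" using subringE(5,7)[OF subring_A] by (simp add: a_minus_def)
    moreover have "v \<noteq> \<zero>" using xy A_carrier by simp
    ultimately show "v \<in> A - {\<zero>}" by simp
  qed
  have finZ: "finite ((\<lambda>(x, y). x \<ominus> y) ` {(x, y). x \<in> Z \<and> y \<in> Z \<and> x \<noteq> y})"
    by (rule finite_imageI[OF finite_subset[of _ "Z \<times> Z"]]) (use Z(2) in auto)
  have "\<forall>q\<in>Q. \<exists>s. s \<in> A \<inter> q \<and> s \<noteq> \<zero>"
  proof
    fix q assume "q \<in> Q"
    then have "A \<inter> q \<in> primes_A" using Q prime_under by blast
    note pD = primes_A_D[OF this]
    have "A \<inter> q \<noteq> {\<zero>}" "\<zero> \<in> A \<inter> q" using pD(3) subring_idealD(2)[OF pD(2)] by auto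
    then show "\<exists>s. s \<in> A \<inter> q \<and> s \<noteq> \<zero>" by blast
  qed
  then obtain s where s: "\<forall>q\<in>Q. s q \<in> A \<inter> q \<and> s q \<noteq> \<zero>" using bchoice[of Q] by metis
  \<comment> \<open>Of \<open>Y\<close>, whose common multiple is \<open>r\<close>, the differences
    keep \<open>Z\<close> distinct modulo primes not containing \<open>r\<close>, the
    \<open>s q\<close> put \<open>r\<close> into each prime of \<open>Q\<close>, and
    \<open>j\<close> ensures that a prime of \<open>A\<close> not containing \<open>r\<close> does
    not contain \<open>j\<close> either.\<close>
  define Y where "Y = (\<lambda>(x, y). x \<ominus> y) ` {(x, y). x \<in> Z \<and> y \<in> Z \<and> x \<noteq> y} \<union> s ` Q \<union> {j}"
  have "finite Y" "Y \<subseteq> A - {\<zero>}" unfolding Y_def using finZ dZ Q(1) s j by auto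
  then obtain r where r: "r \<in> A - {\<zero>}" "\<forall>y\<in>Y. \<exists>c\<in>A. r = c \<otimes> y"
    using exists_common_multiple[OF subring_A] by blast
  have rA: "r \<in> A" "r \<noteq> \<zero>" "r \<in> B" and rc: "r \<in> carrier R" using r(1) AB A_carrier by auto

  define P where "P = {q \<in> primes_B. r \<in> q}"
  have P: "finite P" "P \<subseteq> primes_B"
    using D.S.finite_primes_containing[OF maximal_B, of r] rA unfolding P_def by auto
  have QP: "Q \<subseteq> P"
  proof
    fix q assume q: "q \<in> Q"
    then have qp: "q \<in> primes_B" using Q by auto
    have "s q \<in> Y" unfolding Y_def using q by auto
    then obtain c where "c \<in> A" "r = c \<otimes> s q" using r(2) by blast
    then have "r \<in> q" using primes_B_D(9)[OF qp, of c "s q"] AB s q by auto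
    then show "q \<in> P" using qp unfolding P_def by simp
  qed
  have rN: "r \<otimes> b \<in> q" if "q \<in> P" "b \<in> B" for q b
    using primes_B_D(9)[of q b r] that B_carrier rc unfolding P_def by (auto simp: m_comm)

  have jNi: "ideal ((\<otimes>) j ` N) (R\<lparr>carrier := B\<rparr>)" "(\<otimes>) j ` N \<noteq> {\<zero>}"
  proof -
    have "(\<otimes>) (j \<otimes> inv m0) ` M = (\<otimes>) j ` N" by (rule scaleN[OF jc])
    moreover have "ideal ((\<otimes>) (j \<otimes> inv m0) ` M) (R\<lparr>carrier := B\<rparr>)"
    proof (rule scaled_fractional_ideal[OF M])
      show "j \<otimes> inv m0 \<in> carrier R" using jc U by simp
      fix m assume "m \<in> M"
      then have "j \<otimes> inv m0 \<otimes> m \<in> (\<otimes>) j ` N" using scaleN[OF jc] by blast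
      then show "j \<otimes> inv m0 \<otimes> m \<in> B" using jN by auto
    qed
    ultimately show "ideal ((\<otimes>) j ` N) (R\<lparr>carrier := B\<rparr>)" by simp
    have "j \<in> (\<otimes>) j ` N" using N1 jc by (intro image_eqI[of _ _ \<one>]) simp_all
    then show "(\<otimes>) j ` N \<noteq> {\<zero>}" using j by blast
  qed
  \<comment> \<open>Approximation applies to ideals of \<open>B\<close>, hence to \<open>jN\<close>;
    for \<open>N\<close> itself the multiplier is \<open>y \<otimes> j\<close>.\<close>
  obtain y where y: "y \<in> carrier R" "\<forall>m\<in>(\<otimes>) j ` N. y \<otimes> m \<in> B" "\<forall>q\<in>P. \<exists>m\<in>(\<otimes>) j ` N. y \<otimes> m \<notin> q"
    using D.exists_multiplier_avoiding_primes[OF P jNi] by blast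
  define \<alpha>0 where "\<alpha>0 = y \<otimes> j"
  have \<alpha>0c: "\<alpha>0 \<in> carrier R" unfolding \<alpha>0_def using y(1) jc by simp
  have \<alpha>0e: "\<alpha>0 \<otimes> v = y \<otimes> (j \<otimes> v)" if "v \<in> N" for v
    unfolding \<alpha>0_def using y(1) jc Nc[OF that] by (rule m_assoc)
  have \<alpha>0B: "\<alpha>0 \<otimes> v \<in> B" if "v \<in> N" for v
    unfolding \<alpha>0e[OF that] using y(2) that by blast
  have \<alpha>0P: "\<exists>v\<in>N. \<alpha>0 \<otimes> v \<notin> q" if q: "q \<in> P" for q
  proof -
    obtain m where m: "m \<in> (\<otimes>) j ` N" "y \<otimes> m \<notin> q" using y(3) q by blast
    then obtain v where v: "v \<in> N" "m = j \<otimes> v" by blast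
    then show ?thesis using m(2) \<alpha>0e[OF v(1)] by (intro bexI[of _ v]) simp_all
  qed

  have rj: "r \<otimes> j \<in> A" "r \<otimes> j \<noteq> \<zero>"
    using A_mult[OF rA(1) j(1)] integral[OF _ rc jc] rA j by auto
  \<comment> \<open>With the factor \<open>j\<close>, the correction maps \<open>N\<close> into
    \<open>r B\<close>, hence into every prime of \<open>P\<close>.\<close>
  obtain \<alpha> b where \<alpha>: "\<alpha> \<in> carrier R" "b \<in> B" "\<alpha> = \<alpha>0 \<oplus> (r \<otimes> j) \<otimes> b" "simple_extension K \<alpha> = carrier R"
    using exists_primitive_element[OF inf rj \<alpha>0c] by blast
  have \<alpha>v: "\<alpha> \<otimes> v = \<alpha>0 \<otimes> v \<oplus> r \<otimes> (b \<otimes> (j \<otimes> v))" if "v \<in> N" for v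
    unfolding \<alpha>(3) using \<alpha>0c rc jc B_carrier[OF \<alpha>(2)] Nc[OF that] by algebra
  have \<alpha>N: "\<alpha> \<otimes> v \<in> B" if "v \<in> N" for v
    unfolding \<alpha>v[OF that] by (intro B_add B_mult \<alpha>0B jN that rA \<alpha>(2))
  have \<alpha>B: "\<alpha> \<in> B" using \<alpha>N[OF N1] \<alpha>(1) by simp

  define f where "f = Irr K \<alpha>"
  have f: "set f \<subseteq> A" "f \<noteq> []" "hd f = \<one>" "length f = Suc n" "eval f \<alpha> = \<zero>"
    using primitive_element_conductor[OF \<alpha>B \<alpha>(4)] length_Irr_primitive[OF n \<alpha>(1,4)]
      IrrE(3,4)[OF K \<alpha>(1) algebraic[OF \<alpha>(1)]] unfolding f_def by auto
  obtain D' where D': "D' \<in> carrier R" "D' \<noteq> \<zero>" "\<forall>b\<in>B. \<exists>g. set g \<subseteq> A \<and> D' \<otimes> b = eval g \<alpha>"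
    using primitive_element_conductor[OF \<alpha>B \<alpha>(4)] by blast
  obtain a1 where a1: "a1 \<in> A" "a1 \<noteq> \<zero>" "a1 \<otimes> D' \<in> B" using exists_multiple_in_B[OF D'(1)] by blast
  have a1c: "a1 \<in> carrier R" using a1 A_carrier by auto
  have "a1 \<otimes> D' \<noteq> \<zero>" using integral[OF _ a1c D'(1)] a1 D' by auto
  then obtain c1 where c1: "c1 \<in> B" "c1 \<otimes> (a1 \<otimes> D') \<in> A" "c1 \<otimes> (a1 \<otimes> D') \<noteq> \<zero>"
    using exists_multiple_in_A[OF a1(3)] by blast
  \<comment> \<open>\<open>D'\<close> is only known to lie in the field; \<open>a1\<close> brings it
    into \<open>B\<close>, and \<open>c1\<close> from there into \<open>A\<close>.\<close>
  define d where "d = c1 \<otimes> (a1 \<otimes> D')"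
  have d: "d \<in> A" "d \<noteq> \<zero>" using c1 unfolding d_def by auto
  have dc: "d \<in> carrier R" using d A_carrier by auto
  have dB: "\<exists>g. set g \<subseteq> A \<and> d \<otimes> b = eval g \<alpha>" if b: "b \<in> B" for b
  proof -
    have "d \<otimes> b = D' \<otimes> ((c1 \<otimes> a1) \<otimes> b)"
      unfolding d_def using B_carrier[OF b] B_carrier[OF c1(1)] a1c D'(1) by (simp add: m_ac)
    moreover have "(c1 \<otimes> a1) \<otimes> b \<in> B" by (intro B_mult c1 AB[OF a1(1)] b)
    ultimately show ?thesis using D'(3) by metis
  qed

  \<comment> \<open>Primes containing \<open>r\<close> need no nonroot: the primes of
    \<open>B\<close> above them belong to \<open>P\<close> and will not contain \<beta>N.\<close>
  define Bad where "Bad = {p \<in> primes_A. d \<in> p \<and> r \<notin> p}"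
  have "finite {p \<in> primes_A. d \<in> p}"
    by (rule A.finite_primes_containing[OF maximal_A]) (use d in simp_all)
  then have Bad: "finite Bad" "Bad \<subseteq> primes_A"
    unfolding Bad_def by (auto elim: rev_finite_subset)
  have "\<forall>p\<in>Bad. \<exists>x. x \<in> Z \<and> eval f x \<notin> p"
  proof
    fix p assume p: "p \<in> Bad"
    have "p \<in> primes_A" using p Bad(2) by blast
    note pD = primes_A_D[OF this]
    have "x \<ominus> y \<notin> p" if xy: "x \<in> Z" "y \<in> Z" "x \<noteq> y" for x y
    proof
      assume "x \<ominus> y \<in> p"
      moreover have "x \<ominus> y \<in> Y" unfolding Y_def using xy by auto
      then obtain c where "c \<in> A" "r = c \<otimes> (x \<ominus> y)" using r(2) by blast
      ultimately have "r \<in> p" using pD(9) by simp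
      then show False using p unfolding Bad_def by simp
    qed
    then have "\<exists>x\<in>Z. eval f x \<notin> p"
      by (intro exists_nonroot_mod_prime[OF subring_A pD(1) Z(2,1)]) (use f(1-4) Z(3) in simp_all)
    then show "\<exists>x. x \<in> Z \<and> eval f x \<notin> p" by blast
  qed
  then obtain h where h: "\<forall>p\<in>Bad. h p \<in> Z \<and> eval f (h p) \<notin> p" using bchoice[of Bad] by metis
  have rj_notin: "r \<otimes> j \<notin> p" if p: "p \<in> Bad" for p
  proof
    assume "r \<otimes> j \<in> p"
    have "p \<in> primes_A" using p Bad(2) by blast
    note pD = primes_A_D[OF this]
    have "r \<notin> p" using p unfolding Bad_def by simp
    then have "j \<in> p" using pD(6)[OF rA(1) j(1) \<open>r \<otimes> j \<in> p\<close>] by blast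
    moreover have "j \<in> Y" unfolding Y_def by simp
    then obtain c where "c \<in> A" "r = c \<otimes> j" using r(2) by blast
    ultimately show False using pD(9) \<open>r \<notin> p\<close> by simp
  qed
  \<comment> \<open>The multiple of \<open>r \<otimes> j\<close> obtained here takes the nonroots
    \<open>h p\<close> as residues and at the same time maps \<open>N\<close> into
    \<open>r B\<close>.\<close>
  have "\<exists>w\<in>carrier (R\<lparr>carrier := A\<rparr>). \<forall>p\<in>Bad. w \<otimes>\<^bsub>R\<lparr>carrier := A\<rparr>\<^esub> (r \<otimes> j) \<ominus>\<^bsub>R\<lparr>carrier := A\<rparr>\<^esub> h p \<in> p"
    by (rule A.chinese_remainder_primes[OF maximal_A Bad]) (use rj rj_notin h Z(1) in auto)
  then obtain w where w: "w \<in> A" "\<forall>p\<in>Bad. w \<otimes> (r \<otimes> j) \<ominus>\<^bsub>R\<lparr>carrier := A\<rparr>\<^esub> h p \<in> p" by auto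
  define a where "a = w \<otimes> (r \<otimes> j)"
  have aA: "a \<in> A" unfolding a_def by (rule A_mult[OF w(1) rj(1)])
  have ac: "a \<in> carrier R" using aA A_carrier by auto
  have wc: "w \<in> carrier R" using w A_carrier by auto
  \<comment> \<open>Division with remainder over \<open>A\<close>; one quotient serves for
    evaluation at elements of \<open>A\<close> and at \<alpha>.\<close>
  have diff_root: "\<exists>q. set q \<subseteq> A \<and> (\<forall>x\<in>carrier R. eval g x = (x \<ominus> z) \<otimes> eval q x \<oplus> eval g z)"
    if g: "set g \<subseteq> A" and z: "z \<in> A" for g z
  proof (cases "g = []")
    case True
    then show ?thesis using z A_carrier by (intro exI[of _ "[]"]) (simp)
  next
    case False
    obtain r q where rq: "r \<in> A" "set q \<subseteq> A" "g = lin_mult z r \<zero> q"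
      using exists_lin_mult[OF subring_A z subringE(2)[OF subring_A] False g] by blast
    have c: "set q \<subseteq> carrier R" "z \<in> carrier R" "r \<in> carrier R" using rq z A_carrier by auto
    have ev: "eval g x = (x \<ominus> z) \<otimes> eval q x \<oplus> r" if "x \<in> carrier R" for x
      unfolding rq(3) by (rule eval_lin_mult_0[OF c that])
    moreover have "eval g z = r" using ev[OF c(2)] eval_in_carrier[OF c(1,2)] c by (simp add: r_neg a_minus_def)
    ultimately show ?thesis using rq(2) by metis
  qed
  have fa: "eval f a \<notin> p" if p: "p \<in> Bad" for p
  proof
    assume fap: "eval f a \<in> p"
    have "p \<in> primes_A" using p Bad(2) by blast
    note pD = primes_A_D[OF this]
    have hA: "h p \<in> A" using h p Z(1) by auto
    then have hc: "h p \<in> carrier R" using A_carrier by auto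
    obtain q where q: "set q \<subseteq> A" "\<forall>x\<in>carrier R. eval f x = (x \<ominus> a) \<otimes> eval q x \<oplus> eval f a"
      using diff_root[OF f(1) aA] by blast
    have qA: "eval q (h p) \<in> A" by (rule eval_mult_in_subring[OF subring_A q(1) hA])
    have "a \<ominus> h p \<in> p"
      using bspec[OF w(2) p] subring_a_inv[OF subring_A hA] unfolding a_def a_minus_def by simp
    then have "eval q (h p) \<otimes> (a \<ominus> h p) \<in> p" by (rule pD(9)[OF qA])
    then have "eval f a \<ominus> eval q (h p) \<otimes> (a \<ominus> h p) \<in> p" by (rule pD(8)[OF fap])
    moreover have "eval f a \<ominus> eval q (h p) \<otimes> (a \<ominus> h p) = (h p \<ominus> a) \<otimes> eval q (h p) \<oplus> eval f a"
      using ac hc A_carrier[OF qA] A_carrier[OF subsetD[OF pD(4) fap]] by algebra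
    ultimately have "eval f (h p) \<in> p" using q(2) hc by simp
    then show False using h p by blast
  qed

  define \<beta> where "\<beta> = \<alpha> \<ominus> a"
  have \<beta>c: "\<beta> \<in> carrier R" unfolding \<beta>_def using \<alpha>(1) ac by simp
  have \<beta>v: "\<beta> \<otimes> v = \<alpha> \<otimes> v \<ominus> r \<otimes> (w \<otimes> (j \<otimes> v))" if "v \<in> N" for v
    unfolding \<beta>_def a_def using \<alpha>(1) wc rc jc Nc[OF that] by algebra
  have \<beta>N: "\<beta> \<otimes> v \<in> B" if "v \<in> N" for v
    unfolding \<beta>v[OF that] by (intro B_diff B_mult \<alpha>N jN that rA AB[OF w(1)])
  \<comment> \<open>Multiplying an element of \<open>N\<close> by \<beta>, by \<alpha> or by
    \<open>\<alpha>0\<close> gives the same result modulo each prime of \<open>P\<close>, since the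
    corrections end in \<open>r B\<close>.\<close>
  have \<beta>P: "\<exists>v\<in>N. \<beta> \<otimes> v \<notin> q" if q: "q \<in> P" for q
  proof -
    obtain v where v: "v \<in> N" "\<alpha>0 \<otimes> v \<notin> q" using \<alpha>0P[OF q] by blast
    have qp: "q \<in> primes_B" using P q by auto
    have in_q: "r \<otimes> (w \<otimes> (j \<otimes> v)) \<in> q" "r \<otimes> (b \<otimes> (j \<otimes> v)) \<in> q"
      by (intro rN[OF q] B_mult jN v AB[OF w(1)] \<alpha>(2))+
    have "\<alpha>0 \<otimes> v = (\<beta> \<otimes> v \<oplus> r \<otimes> (w \<otimes> (j \<otimes> v))) \<ominus> r \<otimes> (b \<otimes> (j \<otimes> v))"
      unfolding \<beta>v[OF v(1)] \<alpha>v[OF v(1)]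
      using \<alpha>0c rc wc jc Nc[OF v(1)] B_carrier[OF \<alpha>(2)] by algebra
    then have "\<beta> \<otimes> v \<notin> q" using v(2) primes_B_D(7,8)[OF qp] in_q by metis
    then show ?thesis using v by blast
  qed
  have \<beta>_in: "\<beta> \<in> (\<otimes>) \<beta> ` N" using N1 \<beta>c by (intro image_eqI[of _ _ \<one>]) simp_all
  \<comment> \<open>As \<alpha> is a root of \<open>f\<close>, the value of \<open>f\<close> at
    \<open>a\<close> is a multiple of \<beta> and lies in \<open>q\<close>. So
    \<open>A \<inter> q\<close> is not in \<open>Bad\<close>; not containing \<open>r\<close>, it
    does not contain \<open>d\<close>.\<close>
  have good: "d \<notin> q \<and> \<beta> \<in> q" if q: "q \<in> primes_B" "(\<otimes>) \<beta> ` N \<subseteq> q" for q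
  proof -
    have \<beta>q: "\<beta> \<in> q" using \<beta>_in q(2) by blast
    have "q \<notin> P" using \<beta>P q(2) by blast
    then have rq: "r \<notin> q" using q(1) unfolding P_def by simp
    obtain g where g: "set g \<subseteq> A" "\<forall>x\<in>carrier R. eval f x = (x \<ominus> a) \<otimes> eval g x \<oplus> eval f a"
      using diff_root[OF f(1) aA] by blast
    have gB: "eval g \<alpha> \<in> B" by (rule eval_mult_in_subring[OF subring_B _ \<alpha>B]) (use g(1) AB in auto)
    have fA: "eval f a \<in> A" by (rule eval_mult_in_subring[OF subring_A f(1) aA])
    have zero: "\<beta> \<otimes> eval g \<alpha> \<oplus> eval f a = \<zero>" using g(2) \<alpha>(1) f(5) unfolding \<beta>_def by metis
    have m: "\<beta> \<otimes> eval g \<alpha> \<in> q" using primes_B_D(9)[OF q(1) gB \<beta>q] \<beta>c B_carrier[OF gB] by (simp add: m_comm)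
    have "(\<beta> \<otimes> eval g \<alpha> \<oplus> eval f a) \<ominus> \<beta> \<otimes> eval g \<alpha> = eval f a"
      using \<beta>c B_carrier[OF gB] A_carrier[OF fA] by algebra
    moreover have "\<zero> \<in> q" using primes_B_D(8)[OF q(1) m m] \<beta>c B_carrier[OF gB] by (simp add: r_neg a_minus_def)
    ultimately have "eval f a \<in> q" using primes_B_D(8)[OF q(1) _ m] unfolding zero by metis
    then have "A \<inter> q \<notin> Bad" using fa fA by blast
    then have "d \<notin> A \<inter> q" using prime_under[OF q(1)] rq unfolding Bad_def by blast
    then show ?thesis using d(1) \<beta>q by simp
  qed
  \<comment> \<open>Replacing \<alpha> by \<open>a\<close> in the polynomial for
    \<open>d \<otimes> b\<close> changes its value by a multiple of \<beta>.\<close>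
  have congruent: "\<exists>a'\<in>A. \<exists>u\<in>B. d \<otimes> b = \<beta> \<otimes> u \<oplus> a'" if b: "b \<in> B" for b
  proof -
    obtain g where g: "set g \<subseteq> A" "d \<otimes> b = eval g \<alpha>" using dB[OF b] by blast
    obtain g' where g': "set g' \<subseteq> A" "\<forall>x\<in>carrier R. eval g x = (x \<ominus> a) \<otimes> eval g' x \<oplus> eval g a"
      using diff_root[OF g(1) aA] by blast
    have "eval g' \<alpha> \<in> B" by (rule eval_mult_in_subring[OF subring_B _ \<alpha>B]) (use g'(1) AB in auto)
    moreover have "eval g a \<in> A" by (rule eval_mult_in_subring[OF subring_A g(1) aA])
    moreover have "d \<otimes> b = \<beta> \<otimes> eval g' \<alpha> \<oplus> eval g a" using g(2) g'(2) \<alpha>(1) unfolding \<beta>_def by metis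
    ultimately show ?thesis by blast
  qed
  have deg1: "A <+> q = B" if q: "q \<in> primes_B" "(\<otimes>) \<beta> ` N \<subseteq> q" for q
  proof
    note qD = primes_B_D[OF q(1)]
    show "A <+> q \<subseteq> B" unfolding set_add_def' using AB qD(4) B_add by blast
    show "B \<subseteq> A <+> q"
    proof
      fix b assume b: "b \<in> B"
      obtain a' u where a': "a' \<in> A" "u \<in> B" "d \<otimes> b = \<beta> \<otimes> u \<oplus> a'" using congruent[OF b] by blast
      have dq: "d \<notin> A \<inter> q" and \<beta>q: "\<beta> \<in> q" using good[OF q] by auto
      obtain v where v: "v \<in> A" "v \<otimes> d \<ominus>\<^bsub>R\<lparr>carrier := A\<rparr>\<^esub> \<one> \<in> A \<inter> q"
        using A.maximalideal_inverse[OF maximal_A[OF prime_under[OF q(1)]], of d] d(1) dq by auto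
      have vd: "v \<otimes> d \<ominus> \<one> \<in> q"
        using v(2) subring_a_inv[OF subring_A subringE(3)[OF subring_A]] unfolding a_minus_def by simp
      have c: "v \<in> carrier R" "b \<in> carrier R" "a' \<in> carrier R" "u \<in> carrier R"
        using v a' b A_carrier B_carrier by auto
      have e1: "(v \<otimes> u) \<otimes> \<beta> \<in> q" by (rule qD(9)[OF B_mult[OF AB[OF v(1)] a'(2)] \<beta>q])
      have e2: "b \<otimes> (v \<otimes> d \<ominus> \<one>) \<in> q" by (rule qD(9)[OF b vd])
      \<comment> \<open>Since \<open>v\<close> inverts \<open>d\<close> modulo \<open>q\<close>, the
        element \<open>b\<close> is congruent to \<open>v \<otimes> a'\<close>, which lies in
        \<open>A\<close>.\<close>
      have "b = v \<otimes> (d \<otimes> b) \<ominus> b \<otimes> (v \<otimes> d \<ominus> \<one>)" using c dc by algebra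
      also have "\<dots> = v \<otimes> a' \<oplus> ((v \<otimes> u) \<otimes> \<beta> \<ominus> b \<otimes> (v \<otimes> d \<ominus> \<one>))"
        unfolding a'(3) using c dc \<beta>c by algebra
      finally have "b = v \<otimes> a' \<oplus> ((v \<otimes> u) \<otimes> \<beta> \<ominus> b \<otimes> (v \<otimes> d \<ominus> \<one>))" .
      moreover have "v \<otimes> a' \<in> A" by (rule A_mult[OF v(1) a'(1)])
      moreover have "(v \<otimes> u) \<otimes> \<beta> \<ominus> b \<otimes> (v \<otimes> d \<ominus> \<one>) \<in> q" by (rule qD(8)[OF e1 e2])
      ultimately show "b \<in> A <+> q" unfolding set_add_def' by blast
    qed
  qed
  have dist: "A \<inter> q \<noteq> A \<inter> q'"
    if q: "q \<in> primes_B" "(\<otimes>) \<beta> ` N \<subseteq> q"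
      and q': "q' \<in> primes_B" "(\<otimes>) \<beta> ` N \<subseteq> q'" and ne: "q \<noteq> q'" for q q'
  proof
    assume eq: "A \<inter> q = A \<inter> q'"
    note qD = primes_B_D[OF q(1)] and qD' = primes_B_D[OF q'(1)]
    have "\<not> q \<subseteq> q'" using D.S.nonzero_primes_subset_eq[OF maximal_B q(1) q'(1)] ne by blast
    \<comment> \<open>The diagonal argument on elements: \<open>a'\<close> represents
      \<open>d \<otimes> b\<close> modulo both primes. It lies in \<open>A \<inter> q\<close>, hence
      in \<open>q'\<close>, and forces \<open>d \<otimes> b \<in> q'\<close>, although
      \<open>q'\<close> contains neither factor.\<close>
    then obtain b where b: "b \<in> q" "b \<notin> q'" by blast
    have bB: "b \<in> B" using b qD(4) by auto
    obtain a' u where a': "a' \<in> A" "u \<in> B" "d \<otimes> b = \<beta> \<otimes> u \<oplus> a'" using congruent[OF bB] by blast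
    have c: "a' \<in> carrier R" "u \<in> carrier R" using a' A_carrier B_carrier by auto
    have "u \<otimes> \<beta> \<in> q" "u \<otimes> \<beta> \<in> q'" using qD(9)[OF a'(2)] qD'(9)[OF a'(2)] good[OF q] good[OF q'] by auto
    then have \<beta>u: "\<beta> \<otimes> u \<in> q" "\<beta> \<otimes> u \<in> q'" using c \<beta>c by (simp_all add: m_comm)
    have db: "d \<otimes> b \<in> q" by (rule qD(9)[OF AB[OF d(1)] b(1)])
    have "a' = d \<otimes> b \<ominus> \<beta> \<otimes> u" unfolding a'(3) using c \<beta>c by algebra
    then have "a' \<in> q" using qD(8)[OF db \<beta>u(1)] by simp
    then have "a' \<in> q'" using a'(1) eq by blast
    then have "d \<otimes> b \<in> q'" unfolding a'(3) by (rule qD'(7)[OF \<beta>u(2)])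
    then have "d \<in> q'" using qD'(6)[OF AB[OF d(1)] bB] b(2) by blast
    then show False using good[OF q'] by simp
  qed
  \<comment> \<open>Since \<open>Q\<close> is nonempty there is a prime in \<open>P\<close>, and
    \<beta>N is not contained in it.\<close>
  have \<beta>0: "\<beta> \<noteq> \<zero>"
  proof
    assume z: "\<beta> = \<zero>"
    obtain q where q: "q \<in> P" using Q(3) QP by blast
    obtain v where v: "v \<in> N" "\<beta> \<otimes> v \<notin> q" using \<beta>P[OF q] by blast
    have "r \<otimes> \<zero> \<in> q" by (rule rN[OF q subringE(2)[OF subring_B]])
    then show False using v(2) Nc[OF v(1)] rc unfolding z by simp
  qed
  define x where "x = \<beta> \<otimes> inv m0"
  have xc: "x \<in> carrier R" "x \<noteq> \<zero>" unfolding x_def using \<beta>c U integral[OF _ \<beta>c Units_inv_closed[OF U]] \<beta>0 inv0 by auto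
  have xM: "(\<otimes>) x ` M = (\<otimes>) \<beta> ` N" unfolding x_def by (rule scaleN[OF \<beta>c])
  have xB: "\<forall>m\<in>M. x \<otimes> m \<in> B"
  proof
    fix m assume "m \<in> M"
    then have "x \<otimes> m \<in> (\<otimes>) \<beta> ` N" using xM by blast
    then show "x \<otimes> m \<in> B" using \<beta>N by auto
  qed
  have notQ: "q \<notin> Q" if "(\<otimes>) \<beta> ` N \<subseteq> q" for q using \<beta>P QP that by blast
  show ?thesis
  proof (intro bexI[of _ x] conjI ballI impI)
    show "x \<in> carrier R - {\<zero>}" using xc by simp
  qed (use xB notQ deg1 dist xM in simp_all)
qed

end

section \<open>Passage to ideal classes, and the case of a finite ring A\<close>

theorem theorem2p7:
  fixes L (structure) and K A B :: "'a set" and S :: "'a set set" and c :: "'a set set"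
  assumes "field L"
    and "subfield K L"
    and "dedekind_in L A"
    and "K = fraction_field L A"
    and "ring.finite_dimension L K (carrier L)"
    and "separable_extension L K"
    and "B = integral_closure L A"
    and "finite S" and "S \<subseteq> nonzero_primes (L\<lparr>carrier := B\<rparr>)"
    and "c \<in> carrier (class_group L B)"
  shows "\<exists>(T :: 'a set set) (e :: 'a set \<Rightarrow> nat).
           finite T \<and>
           (\<forall>\<qq> \<in> T. degree_one_prime L A B \<qq>) \<and>
           (\<forall>\<qq> \<in> T. e \<qq> \<ge> 1) \<and>
           (\<Otimes>\<^bsub>ideals_set (L\<lparr>carrier := B\<rparr>)\<^esub>\<qq> \<in> T. \<qq> [^]\<^bsub>ideals_set (L\<lparr>carrier := B\<rparr>)\<^esub> e \<qq>) \<in> c \<and>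
           T \<inter> S = {} \<and>
           (\<forall>\<qq> \<in> T. \<forall>\<qq>' \<in> T. \<qq> \<noteq> \<qq>' \<longrightarrow> A \<inter> \<qq> \<noteq> A \<inter> \<qq>')"
proof -
  interpret E: dedekind_extension L K A
    by (intro dedekind_extension.intro dedekind_extension_axioms.intro assms)
  have Beq: "B = E.B" by fact
  obtain M where M: "M \<in> fractional_ideals L B" "c = principal_fractional_ideals L B #>\<^bsub>fractional_ideal_group L B\<^esub> M"
    using assms(10) unfolding class_group_def FactGroup_def RCOSETS_def fractional_ideal_group_def by auto
  note MD = E.fractional_idealD[OF M(1)[unfolded Beq]]
  \<comment> \<open>The class is the coset of \<open>M\<close> modulo principal ideals. The product
    of \<open>x <# B\<close> with \<open>M\<close> consists of single multiples
    \<open>x \<otimes> m\<close>, because \<open>M\<close> absorbs both the factors from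
    \<open>B\<close> and the sums.\<close>
  have in_class: "(\<otimes>) x ` M \<in> c" if x: "x \<in> carrier L" "x \<noteq> \<zero>" for x
  proof -
    have "ideal_prod L (x <# B) M = (\<otimes>) x ` M"
    proof
      show "ideal_prod L (x <# B) M \<subseteq> (\<otimes>) x ` M"
      proof
        fix z assume "z \<in> ideal_prod L (x <# B) M"
        then show "z \<in> (\<otimes>) x ` M"
        proof induction
          case (prod u m)
          then obtain b where b: "b \<in> B" "u = x \<otimes> b" unfolding l_coset_def by blast
          have "b \<in> carrier L" "m \<in> carrier L" using b Beq E.B_carrier prod(2) MD(1) by auto
          then have "u \<otimes> m = x \<otimes> (b \<otimes> m)" unfolding b(2) using x(1) by (simp add: E.m_assoc)
          moreover have "b \<otimes> m \<in> M" using MD(4) b(1) Beq prod(2) by simp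
          ultimately show ?case by blast
        next
          case (sum u v)
          then obtain m n where mn: "m \<in> M" "n \<in> M" "u = x \<otimes> m" "v = x \<otimes> n" by blast
          have "m \<in> carrier L" "n \<in> carrier L" using mn MD(1) by auto
          then have "u \<oplus> v = x \<otimes> (m \<oplus> n)" unfolding mn(3,4) using x(1) by (simp add: E.r_distr)
          then show ?case using MD(3)[OF mn(1,2)] by blast
        qed
      qed
      show "(\<otimes>) x ` M \<subseteq> ideal_prod L (x <# B) M"
      proof
        fix z assume "z \<in> (\<otimes>) x ` M"
        then obtain m where m: "m \<in> M" "z = x \<otimes> m" by blast
        have "x \<otimes> \<one> \<in> x <# B" unfolding l_coset_def using subringE(3)[OF E.subring_B] Beq by blast
        then have "(x \<otimes> \<one>) \<otimes> m \<in> ideal_prod L (x <# B) M" using m(1) by (rule ideal_prod.prod)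
        then show "z \<in> ideal_prod L (x <# B) M" using m(2) x(1) by simp
      qed
    qed
    moreover have "x <# B \<in> principal_fractional_ideals L B"
      unfolding principal_fractional_ideals_def using x by blast
    ultimately show ?thesis unfolding M(2) r_coset_def fractional_ideal_group_def by auto
  qed
  have factor: "\<exists>T e. finite T \<and> T \<subseteq> nonzero_primes (L\<lparr>carrier := B\<rparr>) \<and> (\<forall>q\<in>T. (\<otimes>) x ` M \<subseteq> q \<and> (e q :: nat) \<ge> 1) \<and>
      (\<Otimes>\<^bsub>ideals_set (L\<lparr>carrier := B\<rparr>)\<^esub>q\<in>T. q [^]\<^bsub>ideals_set (L\<lparr>carrier := B\<rparr>)\<^esub> e q) = (\<otimes>) x ` M"
    if inf: "infinite A" and x: "x \<in> carrier L" "x \<noteq> \<zero>" "\<forall>m\<in>M. x \<otimes> m \<in> B" for x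
  proof -
    interpret D: dedekind_subring L B unfolding Beq by (rule E.dedekind_subring_B[OF inf])
    have "ideal ((\<otimes>) x ` M) (L\<lparr>carrier := B\<rparr>)"
      using E.scaled_fractional_ideal[OF M(1)[unfolded Beq] x(1)] x(3) Beq by simp
    moreover have "(\<otimes>) x ` M \<noteq> {\<zero>}"
    proof -
      obtain m where m: "m \<in> M" "m \<noteq> \<zero>" using MD(2,5) by blast
      then have "x \<otimes> m \<noteq> \<zero>" using E.integral[of x m] x MD(1) by auto
      then show ?thesis using m(1) by blast
    qed
    ultimately show ?thesis by (rule D.ideal_factorization)
  qed
  show ?thesis
  proof (cases "infinite A")
    \<comment> \<open>A finite domain is a field, so \<open>A = K\<close> and \<open>B = L\<close>;
      then \<open>M = L\<close> as well, and the empty product lies in the class.\<close>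
    case False
    have "A = K"
    proof
      show "A \<subseteq> K" by (rule E.A_subset_K)
      have inv_A: "inv a \<in> A" if a: "a \<in> A" "a \<noteq> \<zero>" for a
      proof -
        have ac: "a \<in> carrier L" using a E.A_carrier by auto
        have "inj_on ((\<otimes>) a) A"
          by (rule inj_onI) (use E.m_lcancel[OF a(2) ac] E.A_carrier in blast)
        moreover have "(\<otimes>) a ` A \<subseteq> A" using subringE(6)[OF E.subring_A a(1)] by blast
        ultimately have "(\<otimes>) a ` A = A" using False endo_inj_surj by blast
        then obtain b where b: "b \<in> A" "a \<otimes> b = \<one>" using subringE(3)[OF E.subring_A] by (metis imageE)
        have "inv a = b" by (rule E.comm_inv_char[OF ac E.A_carrier[OF b(1)] b(2)])
        then show ?thesis using b by simp
      qed
      show "K \<subseteq> A" unfolding assms(4) fraction_field_def using inv_A subringE(6)[OF E.subring_A] by blast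
    qed
    have "B = carrier L"
    proof
      show "B \<subseteq> carrier L" using Beq E.B_carrier by auto
      show "carrier L \<subseteq> B"
      proof
        fix v assume v: "v \<in> carrier L"
        obtain a where "a \<in> A - {\<zero>}" "a \<otimes> v \<in> E.B" using E.exists_multiple_in_B[OF v] by blast
        then have a: "a \<in> A" "a \<noteq> \<zero>" "a \<otimes> v \<in> B" using Beq by auto
        have ac: "a \<in> carrier L" "a \<in> Units L" using a E.A_carrier by (auto simp: E.field_Units)
        have "inv a \<in> K - {\<zero>}" using E.subfield_m_inv(1)[OF E.K, of a] a \<open>A = K\<close> by auto
        then have "inv a \<in> E.B" using \<open>A = K\<close> E.A_subset_B by auto
        then have "inv a \<otimes> (a \<otimes> v) \<in> E.B" using subringE(6)[OF E.subring_B] a(3) Beq by simp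
        moreover have "inv a \<otimes> (a \<otimes> v) = v" using ac v by (simp add: E.m_assoc[symmetric])
        ultimately show "v \<in> B" using Beq by simp
      qed
    qed
    obtain m where m: "m \<in> M" "m \<noteq> \<zero>" using MD(2,5) by blast
    have mU: "m \<in> Units L" "m \<in> carrier L" using m MD(1) by (auto simp: E.field_Units)
    have "M = carrier L"
    proof
      show "M \<subseteq> carrier L" by (rule MD(1))
      show "carrier L \<subseteq> M"
      proof
        fix v assume v: "v \<in> carrier L"
        then have "v \<otimes> inv m \<in> E.B" using \<open>B = carrier L\<close> Beq mU by simp
        then have "(v \<otimes> inv m) \<otimes> m \<in> M" using MD(4) m(1) by blast
        moreover have "(v \<otimes> inv m) \<otimes> m = v" using v mU by (simp add: E.m_assoc)
        ultimately show "v \<in> M" by simp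
      qed
    qed
    moreover have "(\<otimes>) \<one> ` carrier L = carrier L" using E.l_one by (simp add: image_def)
    ultimately have "B \<in> c" using in_class[of \<one>] \<open>B = carrier L\<close> by simp
    moreover have "\<one>\<^bsub>ideals_set (L\<lparr>carrier := B\<rparr>)\<^esub> = B" by (simp add: ideals_set_def)
    ultimately have B_in: "\<one>\<^bsub>ideals_set (L\<lparr>carrier := B\<rparr>)\<^esub> \<in> c" by simp
    interpret I: comm_monoid "ideals_set (L\<lparr>carrier := B\<rparr>)"
      unfolding Beq by (rule cring.ideals_set_is_comm_monoid[OF domain.axioms(1)[OF E.subring_is_domain[OF E.subring_B]]])
    show ?thesis using B_in by (intro exI[of _ "{}"] exI[of _ "\<lambda>_. 1"]) simp
  next
    case True
    obtain x where x: "x \<in> carrier L" "x \<noteq> \<zero>" "\<forall>m\<in>M. x \<otimes> m \<in> B"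
      and good: "\<And>q. q \<in> nonzero_primes (L\<lparr>carrier := B\<rparr>) \<Longrightarrow> (\<otimes>) x ` M \<subseteq> q \<Longrightarrow> q \<notin> S \<and> A <+> q = B"
      and dist: "\<And>q q'. q \<in> nonzero_primes (L\<lparr>carrier := B\<rparr>) \<Longrightarrow> q' \<in> nonzero_primes (L\<lparr>carrier := B\<rparr>) \<Longrightarrow>
        (\<otimes>) x ` M \<subseteq> q \<Longrightarrow> (\<otimes>) x ` M \<subseteq> q' \<Longrightarrow> q \<noteq> q' \<Longrightarrow> A \<inter> q \<noteq> A \<inter> q'"
    proof (cases "nonzero_primes (L\<lparr>carrier := B\<rparr>) = {}")
      \<comment> \<open>The conditions on primes are empty here, and any denominator of
        \<open>M\<close> serves as \<open>x\<close>.\<close>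
      case True
      obtain d where "d \<in> E.B - {\<zero>}" "\<forall>m\<in>M. d \<otimes> m \<in> E.B" using MD(6) by blast
      then show thesis using that[of d] True E.B_carrier Beq by auto
    next
      case False
      then obtain q0 where "q0 \<in> nonzero_primes (L\<lparr>carrier := B\<rparr>)" by blast
      \<comment> \<open>The prime \<open>q0\<close> makes the set to be avoided nonempty even if
        \<open>S\<close> is empty.\<close>
      then have "finite (insert q0 S)" "insert q0 S \<subseteq> nonzero_primes (L\<lparr>carrier := E.B\<rparr>)" "insert q0 S \<noteq> {}"
        using assms(8,9) Beq by auto
      from E.exists_degree_one_multiple[OF True this M(1)[unfolded Beq]]
      obtain x where "x \<in> carrier L - {\<zero>}" "\<forall>m\<in>M. x \<otimes> m \<in> B"
        "\<forall>q\<in>nonzero_primes (L\<lparr>carrier := B\<rparr>). (\<otimes>) x ` M \<subseteq> q \<longrightarrow> q \<notin> insert q0 S \<and> A <+> q = B"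
        "\<forall>q\<in>nonzero_primes (L\<lparr>carrier := B\<rparr>). \<forall>q'\<in>nonzero_primes (L\<lparr>carrier := B\<rparr>).
          (\<otimes>) x ` M \<subseteq> q \<longrightarrow> (\<otimes>) x ` M \<subseteq> q' \<longrightarrow> q \<noteq> q' \<longrightarrow> A \<inter> q \<noteq> A \<inter> q'"
        unfolding Beq[symmetric] by blast
      then show thesis using that[of x] by blast
    qed
    obtain T e where T: "finite T" "T \<subseteq> nonzero_primes (L\<lparr>carrier := B\<rparr>)"
      "\<forall>q\<in>T. (\<otimes>) x ` M \<subseteq> q \<and> (e q :: nat) \<ge> 1"
      "(\<Otimes>\<^bsub>ideals_set (L\<lparr>carrier := B\<rparr>)\<^esub>q\<in>T. q [^]\<^bsub>ideals_set (L\<lparr>carrier := B\<rparr>)\<^esub> e q) = (\<otimes>) x ` M"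
      using factor[OF True x] by blast
    have T_good: "q \<in> nonzero_primes (L\<lparr>carrier := B\<rparr>) \<and> q \<notin> S \<and> A <+> q = B" if "q \<in> T" for q
      using T(2,3) good[of q] that by blast
    then have "\<forall>q\<in>T. degree_one_prime L A B q" unfolding degree_one_prime_def by simp
    moreover have "T \<inter> S = {}" using T_good by blast
    moreover have "\<forall>q\<in>T. \<forall>q'\<in>T. q \<noteq> q' \<longrightarrow> A \<inter> q \<noteq> A \<inter> q'"
    proof (intro ballI impI)
      fix q q' assume "q \<in> T" "q' \<in> T" "q \<noteq> q'"
      then show "A \<inter> q \<noteq> A \<inter> q'" by (intro dist) (use T(2,3) in blast)+
    qed
    moreover have "(\<Otimes>\<^bsub>ideals_set (L\<lparr>carrier := B\<rparr>)\<^esub>q\<in>T. q [^]\<^bsub>ideals_set (L\<lparr>carrier := B\<rparr>)\<^esub> e q) \<in> c"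
      unfolding T(4) by (rule in_class[OF x(1,2)])
    ultimately show ?thesis using T(1,3) by (intro exI[of _ T] exI[of _ e]) simp
  qed
qed

end
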